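(* Let $S=\bigcup_{e\in E(S)}G_e$ be a Clifford semigroup such that $E(S)$ is uniformly locally finite. Then the following are equivalent: (i) $\ell^1(S)^{**}$ is left $\tilde\phi$-biflat for each $\phi\in\Delta(\ell^1(S))$; (ii) $\ell^1(S)$ is left $\phi$-biflat for each $\phi\in\Delta(\ell^1(S))$; (iii) each $G_e$ ($e\in E(S)$) is an amenable group; (iv) $\ell^1(S)$ is biflat.
   Context: A discrete semigroup $S$ is an inverse semigroup if for each $s\in S$ there exists a unique element $s^*\in S$ such that $ss^*s=s$ and $s^*ss^*=s^*$. It carries the partial order $s\le t\Leftrightarrow s=ss^*t$. For $x\in S$ put $(x]=\{y\in S : y\le x\}$; $S$ is called uniformly locally finite if $\sup\{|(x]| : x\in S\}<\infty$. $E(S)$ is the set of idempotents of $S$, which is itself an inverse semigroup, so that uniform local finiteness of $E(S)$ means $\sup_{e\in E(S)}|\{f\in E(S): f\le e\}|<\infty$. For $e\in E(S)$, $G_e=\{s\in S : ss^*=s^*s=e\}$ is the maximal subgroup of $S$ with respect to $e$. An inverse semigroup $S$ is a Clifford semigroup if $ss^*=s^*s$ for each $s\in S$; then $S=\bigcup_{e\in E(S)}G_e$. $\ell^1(S)$ is the semigroup algebra with convolution product. Each $G_e$ is a discrete group. For a Banach algebra $B$, $\Delta(B)$ denotes the set of all non-zero multiplicative linear functionals on $B$. The second dual $B^{**}$ is a Banach algebra under the first Arens product. For $\psi\in\Delta(B)$, $\tilde\psi\in\Delta(B^{**})$ is the extension of $\psi$ given by $\tilde\psi(F)=F(\psi)$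 for $F\in B^{**}$. For any Banach algebra $B$, the projective tensor product $B\otimes_p B$ is a Banach $B$-bimodule via $a\cdot(b\otimes c)=ab\otimes c$ and $(b\otimes c)\cdot a=b\otimes ca$. The product morphism $\pi_B:B\otimes_pB\to B$ is the bounded linear map with $\pi_B(a\otimes b)=ab$, and $\pi_B^{**}:(B\otimes_pB)^{**}\to B^{**}$ is its second adjoint. For a Banach $B$-bimodule $X$, the dual $X^*$ is a Banach $B$-bimodule via $(a\cdot f)(x)=f(x\cdot a)$ and $(f\cdot a)(x)=f(a\cdot x)$; applying this twice makes $X^{**}$ a Banach $B$-bimodule. For a Banach algebra $B$ and $\psi\in\Delta(B)$, $B$ is called left $\psi$-biflat if there exists a bounded linear map $\rho:B\to(B\otimes_pB)^{**}$ such that $\rho(ab)=\psi(b)\rho(a)=a\cdot\rho(b)$ and $\tilde\psi\circ\pi_B^{**}\circ\rho(a)=\psi(a)$ for all $a,b\in B$. A Banach algebra $B$ is called biflat if there exists a bounded $B$-bimodule morphism $\rho:B\to(B\otimes_pB)^{**}$ (a bounded linear map with $\rho(ab)=a\cdot\rho(b)=\rho(a)\cdot b$ for all $a,b\in B$) such that $\pi_B^{**}\circ\rho(a)=a$ for each $a\in B$, where $B$ is identified with its canonical image in $B^{**}$. *)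

theory Defs
  imports "HOL-Analysis.Bounded_Linear_Function" "HOL-Analysis.Infinite_Sum" "HOL-Algebra.Group"
begin

(* All Banach spaces and algebras are complex; the library classes only provide real scalars. *)
class complex_vector = real_vector +
  fixes scaleC :: "complex \<Rightarrow> 'a \<Rightarrow> 'a" (infixr \<open>*\<^sub>C\<close> 75)
  assumes scaleC_add_right: "c *\<^sub>C (x + y) = c *\<^sub>C x + c *\<^sub>C y"
    and scaleC_add_left: "(c + d) *\<^sub>C x = c *\<^sub>C x + d *\<^sub>C x"
    and scaleC_scaleC [simp]: "c *\<^sub>C d *\<^sub>C x = (c * d) *\<^sub>C x"
    and scaleC_one [simp]: "1 *\<^sub>C x = x"
    and scaleR_scaleC: "r *\<^sub>R x = complex_of_real r *\<^sub>C x"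

class complex_normed_vector = complex_vector + real_normed_vector +
  assumes norm_scaleC [simp]: "norm (c *\<^sub>C x) = cmod c * norm x"

class cbanach = complex_normed_vector + banach

class complex_normed_algebra = complex_normed_vector + real_normed_algebra +
  assumes mult_scaleC_left [simp]: "(c *\<^sub>C x) * y = c *\<^sub>C (x * y)"
    and mult_scaleC_right [simp]: "x * (c *\<^sub>C y) = c *\<^sub>C (x * y)"

class cbanach_algebra = complex_normed_algebra + cbanach

lemma complex_vector_space: "vector_space (scaleC :: complex \<Rightarrow> 'a \<Rightarrow> 'a::complex_vector)"
  by unfold_locales (auto simp: scaleC_add_right scaleC_add_left)

lemma scaleC_zero_left [simp]: "0 *\<^sub>C x = (0 :: 'a::complex_vector)"
  using vector_space.vector_space_assms(1) scaleC_add_left[of 0 0 x] by simp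

lemma scaleC_zero_right [simp]: "c *\<^sub>C 0 = (0 :: 'a::complex_vector)"
  using scaleC_add_right[of c 0 "0::'a"] by simp

lemma scaleC_minus_left: "(- c) *\<^sub>C x = - (c *\<^sub>C (x :: 'a::complex_vector))"
  using scaleC_add_left[of "-c" c x] by (simp add: eq_neg_iff_add_eq_0)

lemma scaleC_minus_right: "c *\<^sub>C (- x) = - (c *\<^sub>C (x :: 'a::complex_vector))"
  using scaleC_add_right[of c "-x" x] by (simp add: eq_neg_iff_add_eq_0)

lemma scaleC_diff_right: "c *\<^sub>C (x - y) = c *\<^sub>C x - c *\<^sub>C (y :: 'a::complex_vector)"
  using scaleC_add_right[of c x "-y"] by (simp add: scaleC_minus_right)

instantiation complex :: cbanach_algebra
begin
definition "scaleC_complex (c :: complex) (x :: complex) = c * x"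
instance
  by standard (auto simp: scaleC_complex_def algebra_simps norm_mult scaleR_conv_of_real)
end

definition clinear :: "('a::complex_vector \<Rightarrow> 'b::complex_vector) \<Rightarrow> bool" where
  "clinear f \<longleftrightarrow> (\<forall>x y. f (x + y) = f x + f y) \<and> (\<forall>c x. f (c *\<^sub>C x) = c *\<^sub>C f x)"

definition bounded_clinear :: "('a::complex_normed_vector \<Rightarrow> 'b::complex_normed_vector) \<Rightarrow> bool" where
  "bounded_clinear f \<longleftrightarrow> clinear f \<and> (\<exists>K. \<forall>x. norm (f x) \<le> K * norm x)"

lemma bounded_clinear_iff:
  "bounded_clinear f \<longleftrightarrow> bounded_linear f \<and> (\<forall>c x. f (c *\<^sub>C x) = c *\<^sub>C f x)"
proof
  assume "bounded_clinear f"
  then obtain K where *: "\<And>x y. f (x + y) = f x + f y" "\<And>c x. f (c *\<^sub>C x) = c *\<^sub>C f x"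
    "\<And>x. norm (f x) \<le> K * norm x"
    unfolding bounded_clinear_def clinear_def by blast
  have "bounded_linear f"
    by (rule bounded_linear_intro[where K = K]) (use * in \<open>simp_all add: scaleR_scaleC mult.commute\<close>)
  then show "bounded_linear f \<and> (\<forall>c x. f (c *\<^sub>C x) = c *\<^sub>C f x)"
    using * by blast
next
  assume f: "bounded_linear f \<and> (\<forall>c x. f (c *\<^sub>C x) = c *\<^sub>C f x)"
  then interpret bounded_linear f by simp
  show "bounded_clinear f"
    unfolding bounded_clinear_def clinear_def
    using f bounded by (auto simp: add mult.commute)
qed

lemma bounded_clinearI:
  assumes "\<And>x y. f (x + y) = f x + f y" "\<And>c x. f (c *\<^sub>C x) = c *\<^sub>C f x"
    and "\<And>x. norm (f x) \<le> K * norm x"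
  shows "bounded_clinear f"
  using assms unfolding bounded_clinear_def clinear_def by blast

lemma bounded_clinear_imp_linear: "bounded_clinear f \<Longrightarrow> bounded_linear f"
  by (simp add: bounded_clinear_iff)

lemma bounded_clinear_compose:
  "bounded_clinear f \<Longrightarrow> bounded_clinear g \<Longrightarrow> bounded_clinear (\<lambda>x. f (g x))"
  by (auto simp: bounded_clinear_iff bounded_linear_compose)

typedef (overloaded) ('a::complex_normed_vector) cdual =
  "{f :: 'a \<Rightarrow>\<^sub>L complex. \<forall>c x. f (c *\<^sub>C x) = c * f x}"
  by (rule exI[of _ 0]) simp

setup_lifting type_definition_cdual

lift_definition cdual_apply :: "'a::complex_normed_vector cdual \<Rightarrow> 'a \<Rightarrow> complex" is blinfun_apply .

(* Meaningful for bounded complex-linear f only, see cdual_of_apply. *)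
definition cdual_of :: "('a::complex_normed_vector \<Rightarrow> complex) \<Rightarrow> 'a cdual" where
  "cdual_of f = Abs_cdual (Blinfun f)"

lemma cdual_eqI: "(\<And>x. cdual_apply f x = cdual_apply g x) \<Longrightarrow> f = g"
  by transfer (rule blinfun_eqI)

lemma cdual_of_apply: "bounded_clinear f \<Longrightarrow> cdual_apply (cdual_of f) x = f x"
  unfolding cdual_of_def cdual_apply.rep_eq
  by (subst Abs_cdual_inverse) 
    (auto simp: bounded_clinear_iff bounded_linear_Blinfun_apply scaleC_complex_def)

instantiation cdual :: (complex_normed_vector) complex_normed_vector
begin
lift_definition zero_cdual :: "'a cdual" is 0 by simp
lift_definition plus_cdual :: "'a cdual \<Rightarrow> 'a cdual \<Rightarrow> 'a cdual" is "(+)"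
  by (simp add: blinfun.bilinear_simps algebra_simps)
lift_definition minus_cdual :: "'a cdual \<Rightarrow> 'a cdual \<Rightarrow> 'a cdual" is "(-)"
  by (simp add: blinfun.bilinear_simps algebra_simps)
lift_definition uminus_cdual :: "'a cdual \<Rightarrow> 'a cdual" is "uminus"
  by (simp add: blinfun.bilinear_simps algebra_simps)
lift_definition scaleR_cdual :: "real \<Rightarrow> 'a cdual \<Rightarrow> 'a cdual" is scaleR
  by (simp add: blinfun.bilinear_simps algebra_simps)
lift_definition scaleC_cdual :: "complex \<Rightarrow> 'a cdual \<Rightarrow> 'a cdual"
  is "\<lambda>c f. blinfun_compose (blinfun_mult_right c) f"
  by (simp add: blinfun.bilinear_simps algebra_simps)
lift_definition norm_cdual :: "'a cdual \<Rightarrow> real" is norm .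
definition "dist_cdual f g = norm (f - g :: 'a cdual)"
definition "sgn_cdual f = scaleR (inverse (norm f)) (f :: 'a cdual)"
definition uniformity_cdual :: "('a cdual \<times> 'a cdual) filter" where
  "uniformity_cdual = (INF e\<in>{0 <..}. principal {(x, y). dist x y < e})"
definition open_cdual :: "'a cdual set \<Rightarrow> bool" where
  "open_cdual S = (\<forall>x\<in>S. \<forall>\<^sub>F (x', y) in uniformity. x' = x \<longrightarrow> y \<in> S)"
lemma cdual_apply_simps [simp]:
  "cdual_apply 0 x = 0" "cdual_apply (f + g) x = cdual_apply f x + cdual_apply g x"
  "cdual_apply (f - g) x = cdual_apply f x - cdual_apply g x"
  "cdual_apply (- f) x = - cdual_apply f x"
  "cdual_apply (c *\<^sub>C f) x = c * cdual_apply f x"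
  "cdual_apply (r *\<^sub>R f) x = r *\<^sub>R cdual_apply f x"
  by (transfer; simp add: blinfun.bilinear_simps)+
lemma norm_cdual_apply: "cmod (cdual_apply f x) \<le> norm f * norm x"
  by transfer (rule norm_blinfun)
lemma norm_cdual_bound: "0 \<le> b \<Longrightarrow> (\<And>x. cmod (cdual_apply f x) \<le> b * norm x) \<Longrightarrow> norm f \<le> b"
  by transfer (rule norm_blinfun_bound)
instance
proof
  fix c :: complex and f :: "'a cdual"
  have le: "norm (c *\<^sub>C f) \<le> cmod c * norm f" for c and f :: "'a cdual"
  proof (rule norm_cdual_bound)
    show "0 \<le> cmod c * norm f" by transfer simp
    show "cmod (cdual_apply (c *\<^sub>C f) x) \<le> cmod c * norm f * norm x" for x
      using mult_left_mono[OF norm_cdual_apply[of f x] norm_ge_zero[of c]]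
      by (simp add: norm_mult algebra_simps)
  qed
  have *: "inverse c *\<^sub>C c *\<^sub>C f = f" if "c \<noteq> 0" 
    using that by (intro cdual_eqI) simp
  show "norm (c *\<^sub>C f) = cmod c * norm f"
  proof (cases "c = 0")
    case True
    then have "c *\<^sub>C f = 0" by (intro cdual_eqI) simp
    then show ?thesis using True by (simp add: norm_cdual.rep_eq zero_cdual.rep_eq)
  next
    case False
    have "norm f \<le> inverse (cmod c) * norm (c *\<^sub>C f)"
      using le[of "inverse c" "c *\<^sub>C f"] *[OF False] by (simp add: norm_inverse)
    then have "cmod c * norm f \<le> norm (c *\<^sub>C f)"
      using False by (simp add: field_simps)
    then show ?thesis using le[of c f] by linarith
  qed
next
  fix f g :: "'a cdual"
  show "norm f = 0 \<longleftrightarrow> f = 0" by transfer simp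
  show "norm (f + g) \<le> norm f + norm g" by transfer (rule norm_triangle_ineq)
  show "norm (r *\<^sub>R f) = \<bar>r\<bar> * norm f" for r by transfer simp
  show "open S = (\<forall>x\<in>S. \<forall>\<^sub>F (x', y) in uniformity. x' = x \<longrightarrow> y \<in> S)" for S :: "'a cdual set"
    by (rule open_cdual_def)
qed (simp_all add: dist_cdual_def sgn_cdual_def uniformity_cdual_def,
    (rule cdual_eqI; simp add: algebra_simps scaleR_conv_of_real)+)
end

instance cdual :: (complex_normed_vector) cbanach
proof
  fix X :: "nat \<Rightarrow> 'a cdual"
  assume C: "Cauchy X"
  have d: "dist (Rep_cdual f) (Rep_cdual g) = dist f g" for f g :: "'a cdual"
    by (simp add: dist_norm norm_cdual.rep_eq minus_cdual.rep_eq)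
  have "Cauchy (\<lambda>n. Rep_cdual (X n))"
    using C by (simp add: Cauchy_def d)
  then obtain F where F: "(\<lambda>n. Rep_cdual (X n)) \<longlonglongrightarrow> F"
    using Cauchy_convergent_iff convergent_def by blast
  have lim: "(\<lambda>n. Rep_cdual (X n) x) \<longlonglongrightarrow> F x" for x
    by (intro blinfun.tendsto F tendsto_const)
  have "F (c *\<^sub>C x) = c * F x" for c x
  proof (rule LIMSEQ_unique[OF lim])
    have "(\<lambda>n. c * Rep_cdual (X n) x) \<longlonglongrightarrow> c * F x" by (intro tendsto_mult lim tendsto_const)
    moreover have "Rep_cdual (X n) (c *\<^sub>C x) = c * Rep_cdual (X n) x" for n
      using Rep_cdual[of "X n"] by simp
    ultimately show "(\<lambda>n. Rep_cdual (X n) (c *\<^sub>C x)) \<longlonglongrightarrow> c * F x" by simp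
  qed
  then have "Rep_cdual (Abs_cdual F) = F" by (simp add: Abs_cdual_inverse)
  then have "X \<longlonglongrightarrow> Abs_cdual F"
    using F by (simp add: tendsto_dist_iff[of X] tendsto_dist_iff[of "\<lambda>n. Rep_cdual (X n)"] flip: d)
  then show "convergent X" by (auto simp: convergent_def)
qed

lemma bounded_clinear_cdual_apply: "bounded_clinear (cdual_apply f)"
  by (auto simp: bounded_clinear_def clinear_def cdual_apply.rep_eq blinfun.bilinear_simps
      scaleC_complex_def intro!: exI[of _ "norm f"])
    (use Rep_cdual[of f] norm_cdual_apply[of f] in \<open>auto simp: cdual_apply.rep_eq\<close>)

lemma bounded_clinear_eval: "bounded_clinear (\<lambda>f. cdual_apply f x)"
  by (rule bounded_clinearI[where K = "norm x"])
    (auto simp: scaleC_complex_def mult.commute[of "norm x"] norm_cdual_apply)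

class complex_seminormed_vector = complex_vector +
  fixes seminorm :: "'a \<Rightarrow> real"
  assumes seminorm_triangle: "seminorm (x + y) \<le> seminorm x + seminorm y"
    and seminorm_scaleC: "seminorm (c *\<^sub>C x) = cmod c * seminorm x"
lemma seminorm_zero [simp]: "seminorm (0 :: 'a::complex_seminormed_vector) = 0"
  using seminorm_scaleC[of 0 "0 :: 'a"] by simp

lemma seminorm_uminus: "seminorm (- x) = seminorm x"
  for x :: "'a::complex_seminormed_vector"
  using seminorm_scaleC[of "-1" x] by (simp add: scaleC_minus_left)

lemma seminorm_nonneg [simp]: "0 \<le> seminorm x"
  for x :: "'a::complex_seminormed_vector"
  using seminorm_triangle[of x "- x"] by (simp add: seminorm_uminus)

lemma seminorm_commute: "seminorm (x - y) = seminorm (y - x)"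
  for x :: "'a::complex_seminormed_vector"
  using seminorm_uminus[of "x - y"] by simp

lemma seminorm_triangle3: "seminorm (x - z) \<le> seminorm (x - y) + seminorm (y - z)"
  for x :: "'a::complex_seminormed_vector"
  using seminorm_triangle[of "x - y" "y - z"] by simp

lemma seminorm_abs_diff: "\<bar>seminorm x - seminorm y\<bar> \<le> seminorm (x - y)"
  for x :: "'a::complex_seminormed_vector"
  using seminorm_triangle[of "x - y" y] seminorm_triangle[of "y - x" x] seminorm_commute[of x y]
  by simp

lemma seminorm_add_diff:
  "seminorm ((x + x') - (y + y')) \<le> seminorm (x - y) + seminorm (x' - y')"
  for x :: "'a::complex_seminormed_vector"
  using seminorm_triangle[of "x - y" "x' - y'"] by (simp add: algebra_simps)

definition seminorm_Cauchy :: "(nat \<Rightarrow> 'a::complex_seminormed_vector) \<Rightarrow> bool" where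
  "seminorm_Cauchy X \<longleftrightarrow> (\<forall>e>0. \<exists>M. \<forall>m\<ge>M. \<forall>n\<ge>M. seminorm (X m - X n) < e)"

definition completion_rel ::
    "(nat \<Rightarrow> 'a::complex_seminormed_vector) \<Rightarrow> (nat \<Rightarrow> 'a) \<Rightarrow> bool" where
  "completion_rel X Y \<longleftrightarrow>
    seminorm_Cauchy X \<and> seminorm_Cauchy Y \<and> (\<lambda>n. seminorm (X n - Y n)) \<longlonglongrightarrow> 0"

lemma seminorm_Cauchy_const: "seminorm_Cauchy (\<lambda>_. x)"
  by (simp add: seminorm_Cauchy_def)

(* Hausdorff completion of a seminormed space: Cauchy sequences modulo sequences of seminorm
   tending to 0. Working with seminorms avoids proving beforehand that the projective norm
   on the algebraic tensor product is definite. *)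
quotient_type (overloaded) 'a completion =
    "nat \<Rightarrow> 'a::complex_seminormed_vector" / partial: completion_rel
proof (rule part_equivpI)
  show "\<exists>X :: nat \<Rightarrow> 'a. completion_rel X X"
    by (rule exI[of _ "\<lambda>_. 0"]) (simp add: completion_rel_def seminorm_Cauchy_const)
  show "symp (completion_rel :: (nat \<Rightarrow> 'a) \<Rightarrow> _)"
    by (rule sympI) (simp add: completion_rel_def seminorm_commute)
  show "transp (completion_rel :: (nat \<Rightarrow> 'a) \<Rightarrow> _)"
  proof (rule transpI)
    fix X Y Z :: "nat \<Rightarrow> 'a"
    assume XY: "completion_rel X Y" and YZ: "completion_rel Y Z"
    have "(\<lambda>n. seminorm (X n - Z n)) \<longlonglongrightarrow> 0"
    proof (rule tendsto_sandwich[OF _ _ tendsto_const])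
      show "(\<lambda>n. seminorm (X n - Y n) + seminorm (Y n - Z n)) \<longlonglongrightarrow> 0"
        using XY YZ tendsto_add[of _ 0 _ _ 0] by (force simp: completion_rel_def)
    qed (simp_all add: seminorm_triangle3)
    then show "completion_rel X Z" using XY YZ by (simp add: completion_rel_def)
  qed
qed

lemma seminorm_Cauchy_add:
  assumes "seminorm_Cauchy X" "seminorm_Cauchy Y"
  shows "seminorm_Cauchy (\<lambda>n. X n + Y n)"
  unfolding seminorm_Cauchy_def
proof (intro allI impI)
  fix e :: real assume "e > 0"
  then have e: "e / 2 > 0" by simp
  obtain M1 where M1: "\<And>m n. m \<ge> M1 \<Longrightarrow> n \<ge> M1 \<Longrightarrow> seminorm (X m - X n) < e / 2"
    using assms(1) e unfolding seminorm_Cauchy_def by blast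
  obtain M2 where M2: "\<And>m n. m \<ge> M2 \<Longrightarrow> n \<ge> M2 \<Longrightarrow> seminorm (Y m - Y n) < e / 2"
    using assms(2) e unfolding seminorm_Cauchy_def by blast
  show "\<exists>M. \<forall>m\<ge>M. \<forall>n\<ge>M. seminorm (X m + Y m - (X n + Y n)) < e"
  proof (intro exI[of _ "max M1 M2"] allI impI)
    fix m n assume "max M1 M2 \<le> m" "max M1 M2 \<le> n"
    then show "seminorm (X m + Y m - (X n + Y n)) < e"
      using M1[of m n] M2[of m n] seminorm_add_diff[of "X m" "Y m" "X n" "Y n"] by simp
  qed
qed

lemma seminorm_Cauchy_scaleC:
  assumes "seminorm_Cauchy X"
  shows "seminorm_Cauchy (\<lambda>n. c *\<^sub>C X n)"
proof (cases "c = 0")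
  case False
  show ?thesis
    unfolding seminorm_Cauchy_def
  proof (intro allI impI)
    fix e :: real assume "e > 0"
    then have "e / cmod c > 0" using False by simp
    then obtain M where M: "\<And>m n. m \<ge> M \<Longrightarrow> n \<ge> M \<Longrightarrow> seminorm (X m - X n) < e / cmod c"
      using assms unfolding seminorm_Cauchy_def by blast
    show "\<exists>M. \<forall>m\<ge>M. \<forall>n\<ge>M. seminorm (c *\<^sub>C X m - c *\<^sub>C X n) < e"
    proof (intro exI[of _ M] allI impI)
      fix m n assume "M \<le> m" "M \<le> n"
      then show "seminorm (c *\<^sub>C X m - c *\<^sub>C X n) < e"
        using M[of m n] False
        by (simp flip: scaleC_diff_right add: seminorm_scaleC field_simps)
    qed
  qed
qed (simp add: seminorm_Cauchy_const)

lemma completion_rel_add: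
  assumes "completion_rel X X'" "completion_rel Y Y'"
  shows "completion_rel (\<lambda>n. X n + Y n) (\<lambda>n. X' n + Y' n)"
proof -
  have "(\<lambda>n. seminorm (X n + Y n - (X' n + Y' n))) \<longlonglongrightarrow> 0"
  proof (rule tendsto_sandwich[OF _ _ tendsto_const])
    show "(\<lambda>n. seminorm (X n - X' n) + seminorm (Y n - Y' n)) \<longlonglongrightarrow> 0"
      using assms tendsto_add[of _ 0 _ _ 0] by (force simp: completion_rel_def)
  qed (simp_all add: seminorm_add_diff)
  then show ?thesis
    using assms by (simp add: completion_rel_def seminorm_Cauchy_add)
qed

lemma completion_rel_scaleC:
  assumes "completion_rel X X'"
  shows "completion_rel (\<lambda>n. c *\<^sub>C X n) (\<lambda>n. c *\<^sub>C X' n)"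
  using assms tendsto_mult_right_zero[of "\<lambda>n. seminorm (X n - X' n)" sequentially "cmod c"]
  by (simp add: completion_rel_def seminorm_Cauchy_scaleC seminorm_scaleC flip: scaleC_diff_right)

lemma minus_eq_scaleC: "- x = (- 1) *\<^sub>C (x :: 'a::complex_vector)"
  by (simp add: scaleC_minus_left)

lemma seminorm_Cauchy_convergent:
  assumes "seminorm_Cauchy X"
  shows "(\<lambda>n. seminorm (X n)) \<longlonglongrightarrow> lim (\<lambda>n. seminorm (X n))"
proof -
  have "Cauchy (\<lambda>n. seminorm (X n))"
  proof (rule CauchyI)
    fix e :: real assume "e > 0"
    then obtain M where M: "\<And>m n. m \<ge> M \<Longrightarrow> n \<ge> M \<Longrightarrow> seminorm (X m - X n) < e"
      using assms unfolding seminorm_Cauchy_def by blast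
    show "\<exists>M. \<forall>m\<ge>M. \<forall>n\<ge>M. norm (seminorm (X m) - seminorm (X n)) < e"
    proof (intro exI[of _ M] allI impI)
      fix m n assume "M \<le> m" "M \<le> n"
      then show "norm (seminorm (X m) - seminorm (X n)) < e"
        using M[of m n] seminorm_abs_diff[of "X m" "X n"] by simp
    qed
  qed
  then show ?thesis using Cauchy_convergent convergent_LIMSEQ_iff by blast
qed

lemma completion_rel_norm:
  assumes "completion_rel X Y"
  shows "lim (\<lambda>n. seminorm (X n)) = lim (\<lambda>n. seminorm (Y n))"
proof -
  have X: "(\<lambda>n. seminorm (X n)) \<longlonglongrightarrow> lim (\<lambda>n. seminorm (X n))"
    and Y: "(\<lambda>n. seminorm (Y n)) \<longlonglongrightarrow> lim (\<lambda>n. seminorm (Y n))"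
    and XY: "(\<lambda>n. seminorm (X n - Y n)) \<longlonglongrightarrow> 0"
    using assms by (auto simp: completion_rel_def seminorm_Cauchy_convergent)
  have "(\<lambda>n. seminorm (X n) - seminorm (Y n)) \<longlonglongrightarrow> 0"
    by (rule Lim_null_comparison[OF _ XY]) (simp add: seminorm_abs_diff)
  from LIMSEQ_unique[OF this tendsto_diff[OF X Y]] show ?thesis by simp
qed

instantiation completion :: (complex_seminormed_vector) complex_normed_vector
begin
lift_definition zero_completion :: "'a completion" is "\<lambda>_. 0"
  by (simp add: completion_rel_def seminorm_Cauchy_const)
lift_definition plus_completion :: "'a completion \<Rightarrow> 'a completion \<Rightarrow> 'a completion"
  is "\<lambda>X Y n. X n + Y n" by (rule completion_rel_add)
lift_definition scaleC_completion :: "complex \<Rightarrow> 'a completion \<Rightarrow> 'a completion"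
  is "\<lambda>c X n. c *\<^sub>C X n" by (rule completion_rel_scaleC)
definition "scaleR_completion r (x :: 'a completion) = complex_of_real r *\<^sub>C x"
definition "uminus_completion (x :: 'a completion) = (- 1) *\<^sub>C x"
definition "minus_completion x (y :: 'a completion) = x + (- y)"
lift_definition norm_completion :: "'a completion \<Rightarrow> real" is "\<lambda>X. lim (\<lambda>n. seminorm (X n))"
  by (rule completion_rel_norm)
definition "dist_completion x y = norm (x - y :: 'a completion)"
definition "sgn_completion x = scaleR (inverse (norm x)) (x :: 'a completion)"
definition uniformity_completion :: "('a completion \<times> 'a completion) filter" where
  "uniformity_completion = (INF e\<in>{0 <..}. principal {(x, y). dist x y < e})"
definition open_completion :: "'a completion set \<Rightarrow> bool" where
  "open_completion S = (\<forall>x\<in>S. \<forall>\<^sub>F (x', y) in uniformity. x' = x \<longrightarrow> y \<in> S)"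

lemma norm_abs_completion:
  "seminorm_Cauchy X \<Longrightarrow> (\<lambda>n. seminorm (X n)) \<longlonglongrightarrow> norm (abs_completion X)"
  using seminorm_Cauchy_convergent[of X]
  by (subst norm_completion.abs_eq) (simp_all add: completion_rel_def)

lemma norm_scaleC_completion: "norm (c *\<^sub>C x) = cmod c * norm (x :: 'a completion)"
proof (induct x rule: completion.abs_induct)
  case (1 X)
  then have X: "seminorm_Cauchy X" by (simp add: completion_rel_def)
  have "(\<lambda>n. seminorm (c *\<^sub>C X n)) \<longlonglongrightarrow> norm (c *\<^sub>C abs_completion X)"
    using norm_abs_completion[OF seminorm_Cauchy_scaleC[OF X, of c]] 1
    by (simp add: scaleC_completion.abs_eq)
  moreover have "(\<lambda>n. seminorm (c *\<^sub>C X n)) \<longlonglongrightarrow> cmod c * norm (abs_completion X)"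
    unfolding seminorm_scaleC by (intro tendsto_mult tendsto_const norm_abs_completion X)
  ultimately show ?case by (rule LIMSEQ_unique)
qed

instance
proof
  fix x y z :: "'a completion" and c d :: complex and r s :: real
  have sa: "c *\<^sub>C (x + y) = c *\<^sub>C x + c *\<^sub>C y" for c and x y :: "'a completion"
    by transfer (simp add: scaleC_add_right completion_rel_add completion_rel_scaleC)
  have sl: "(c + d) *\<^sub>C x = c *\<^sub>C x + d *\<^sub>C x" for c d and x :: "'a completion"
    by transfer (simp add: scaleC_add_left completion_rel_add completion_rel_scaleC)
  have ss: "c *\<^sub>C d *\<^sub>C x = (c * d) *\<^sub>C x" for c d and x :: "'a completion"
    by transfer (simp add: completion_rel_scaleC)
  have s1: "1 *\<^sub>C x = x" for x :: "'a completion"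
    by transfer simp
  have s0: "0 *\<^sub>C x = 0" for x :: "'a completion"
    by transfer (simp add: completion_rel_def seminorm_Cauchy_const)
  show "c *\<^sub>C (x + y) = c *\<^sub>C x + c *\<^sub>C y" "(c + d) *\<^sub>C x = c *\<^sub>C x + d *\<^sub>C x"
    "c *\<^sub>C d *\<^sub>C x = (c * d) *\<^sub>C x" "1 *\<^sub>C x = x"
    by (rule sa sl ss s1)+
  show "r *\<^sub>R x = complex_of_real r *\<^sub>C x" by (rule scaleR_completion_def)
  show "r *\<^sub>R (x + y) = r *\<^sub>R x + r *\<^sub>R y" "(r + s) *\<^sub>R x = r *\<^sub>R x + s *\<^sub>R x"
    "r *\<^sub>R s *\<^sub>R x = (r * s) *\<^sub>R x" "1 *\<^sub>R x = x"
    by (simp_all add: scaleR_completion_def sa sl ss s1)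
  show "norm (c *\<^sub>C x) = cmod c * norm x" by (rule norm_scaleC_completion)
  show "norm (r *\<^sub>R x) = \<bar>r\<bar> * norm x" by (simp add: scaleR_completion_def norm_scaleC_completion)
  show "x + y + z = x + (y + z)"
    by transfer (simp add: completion_rel_add add.assoc)
  show "x + y = y + x"
    by transfer (subst add.commute, rule completion_rel_add)
  show "0 + x = x" by transfer simp
  show "- x + x = 0"
    using sl[of "-1" 1 x] s0[of x] s1[of x] by (simp add: uminus_completion_def)
  show "x - y = x + - y" by (rule minus_completion_def)
  show "dist x y = norm (x - y)" by (rule dist_completion_def)
  show "sgn x = inverse (norm x) *\<^sub>R x" by (rule sgn_completion_def)
  show "(uniformity :: ('a completion \<times> _) filter) = (INF e\<in>{0 <..}. principal {(x, y). dist x y < e})"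
    by (rule uniformity_completion_def)
  show "open S = (\<forall>x\<in>S. \<forall>\<^sub>F (x', y) in uniformity. x' = x \<longrightarrow> y \<in> S)" for S :: "'a completion set"
    by (rule open_completion_def)
  show "norm x = 0 \<longleftrightarrow> x = 0"
  proof (induct x rule: completion.abs_induct)
    case (1 X)
    then have X: "seminorm_Cauchy X" by (simp add: completion_rel_def)
    have "norm (abs_completion X) = 0 \<longleftrightarrow> (\<lambda>n. seminorm (X n)) \<longlonglongrightarrow> 0"
      using norm_abs_completion[OF X] LIMSEQ_unique by metis
    also have "\<dots> \<longleftrightarrow> completion_rel X (\<lambda>_. 0)"
      using X by (simp add: completion_rel_def seminorm_Cauchy_const)
    also have "\<dots> \<longleftrightarrow> abs_completion X = 0"
      unfolding zero_completion_def
      using Quotient_rel[OF Quotient_completion, of X "\<lambda>_. 0"] 1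
      by (simp add: completion_rel_def seminorm_Cauchy_const)
    finally show ?case .
  qed
  show "norm (x + y) \<le> norm x + norm y"
  proof (induct x rule: completion.abs_induct)
    case (1 X)
    show ?case
    proof (induct y rule: completion.abs_induct)
      fix Y :: "nat \<Rightarrow> 'a" assume 2: "completion_rel Y Y"
      have X: "seminorm_Cauchy X" and Y: "seminorm_Cauchy Y"
        using 1 2 by (simp_all add: completion_rel_def)
      have "(\<lambda>n. seminorm (X n + Y n)) \<longlonglongrightarrow> norm (abs_completion X + abs_completion Y)"
        using norm_abs_completion[OF seminorm_Cauchy_add[OF X Y]] 1 2
        by (simp add: plus_completion.abs_eq)
      moreover have "(\<lambda>n. seminorm (X n) + seminorm (Y n))
          \<longlonglongrightarrow> norm (abs_completion X) + norm (abs_completion Y)"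
        by (intro tendsto_add norm_abs_completion X Y)
      ultimately show "norm (abs_completion X + abs_completion Y)
          \<le> norm (abs_completion X) + norm (abs_completion Y)"
        by (rule LIMSEQ_le) (auto intro: seminorm_triangle)
    qed
  qed
qed

end

lift_definition completion_of :: "'a::complex_seminormed_vector \<Rightarrow> 'a completion" is "\<lambda>x _. x"
  by (simp add: completion_rel_def seminorm_Cauchy_const)

lemma completion_of_add: "completion_of (x + y) = completion_of x + completion_of y"
  by transfer (simp add: completion_rel_def seminorm_Cauchy_const)

lemma completion_of_scaleC: "completion_of (c *\<^sub>C x) = c *\<^sub>C completion_of x"
  by transfer (simp add: completion_rel_def seminorm_Cauchy_const)

lemma completion_of_diff: "completion_of (x - y) = completion_of x - completion_of y"
  using completion_of_add[of x "- y"] completion_of_scaleC[of "-1" y]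
  by (simp add: scaleC_minus_left)

lemma norm_completion_of: "norm (completion_of x) = seminorm x"
  by transfer simp

lemma completion_of_tendsto:
  assumes X: "seminorm_Cauchy X"
  shows "(\<lambda>n. completion_of (X n)) \<longlonglongrightarrow> abs_completion X"
proof (rule LIMSEQ_I)
  fix e :: real assume "e > 0"
  then have e: "e / 2 > 0" by simp
  obtain M where M: "\<And>m n. m \<ge> M \<Longrightarrow> n \<ge> M \<Longrightarrow> seminorm (X m - X n) < e / 2"
    using X e unfolding seminorm_Cauchy_def by blast
  show "\<exists>M. \<forall>n\<ge>M. norm (completion_of (X n) - abs_completion X) < e"
  proof (intro exI[of _ M] allI impI)
    fix n assume n: "M \<le> n"
    have rel: "completion_rel X X" using X by (simp add: completion_rel_def)
    have relc: "completion_rel (\<lambda>_. X n) (\<lambda>_. X n)"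
      by (simp add: completion_rel_def seminorm_Cauchy_const)
    have C: "seminorm_Cauchy (\<lambda>m. X n + (- 1) *\<^sub>C X m)"
      by (intro seminorm_Cauchy_add seminorm_Cauchy_const seminorm_Cauchy_scaleC X)
    have eq: "completion_of (X n) - abs_completion X = abs_completion (\<lambda>m. X n + (- 1) *\<^sub>C X m)"
      unfolding minus_completion_def uminus_completion_def completion_of.abs_eq
      using rel relc completion_rel_scaleC[OF rel, of "-1"]
      by (simp add: scaleC_completion.abs_eq plus_completion.abs_eq)
    have "norm (completion_of (X n) - abs_completion X) \<le> e / 2"
      unfolding eq
    proof (rule LIMSEQ_le_const2[OF norm_abs_completion[OF C]])
      show "\<exists>N. \<forall>m\<ge>N. seminorm (X n + (- 1) *\<^sub>C X m) \<le> e / 2"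
        using M[OF n] by (intro exI[of _ M]) (auto simp: scaleC_minus_left intro: less_imp_le)
    qed
    then show "norm (completion_of (X n) - abs_completion X) < e" using e by linarith
  qed
qed

lemma completion_cases:
  obtains X where "seminorm_Cauchy X" "x = abs_completion X"
proof -
  have "\<exists>X. seminorm_Cauchy X \<and> x = abs_completion X"
    by (induct x rule: completion.abs_induct) (auto simp: completion_rel_def)
  then show ?thesis using that by blast
qed

lemma completion_dense:
  assumes "e > 0" obtains v where "norm (x - completion_of v) < e"
proof (cases x rule: completion_cases)
  case (1 X)
  then have "(\<lambda>n. completion_of (X n)) \<longlonglongrightarrow> x"
    using completion_of_tendsto[of X] by simp
  then obtain n where "norm (completion_of (X n) - x) < e"
    using LIMSEQ_D[OF _ assms] by blast
  then show ?thesis using that by (metis norm_minus_commute)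
qed

lemma seminorm_Cauchy_iff: "seminorm_Cauchy X \<longleftrightarrow> Cauchy (\<lambda>n. completion_of (X n))"
  by (simp add: seminorm_Cauchy_def Cauchy_iff flip: completion_of_diff add: norm_completion_of)

instance completion :: (complex_seminormed_vector) cbanach
proof
  fix X :: "nat \<Rightarrow> 'a completion"
  assume X: "Cauchy X"
  have "\<exists>v. norm (X n - completion_of v) < inverse (real (Suc n))" for n
    using completion_dense[of "inverse (real (Suc n))"] by (metis inverse_positive_iff_positive of_nat_0_less_iff zero_less_Suc)
  then obtain v where v: "\<And>n. norm (X n - completion_of (v n)) < inverse (real (Suc n))" by metis
  have "(\<lambda>n. norm (X n - completion_of (v n))) \<longlonglongrightarrow> 0"
    by (rule tendsto_sandwich[OF _ _ tendsto_const LIMSEQ_inverse_real_of_nat])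
      (simp_all add: less_imp_le[OF v] del: of_nat_Suc)
  then have d: "(\<lambda>n. X n - completion_of (v n)) \<longlonglongrightarrow> 0" by (rule tendsto_norm_zero_cancel)
  have "Cauchy (\<lambda>n. completion_of (v n))"
  proof (rule CauchyI)
    fix e :: real assume "e > 0"
    then have e: "e / 3 > 0" by simp
    obtain M1 where M1: "\<And>m n. m \<ge> M1 \<Longrightarrow> n \<ge> M1 \<Longrightarrow> norm (X m - X n) < e / 3"
      using CauchyD[OF X e] by blast
    obtain M2 where M2: "\<And>n. n \<ge> M2 \<Longrightarrow> norm (X n - completion_of (v n)) < e / 3"
      using LIMSEQ_D[OF d e] by auto
    have "norm (completion_of (v m) - completion_of (v n)) < e"
      if "m \<ge> max M1 M2" "n \<ge> max M1 M2" for m n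
    proof -
      have "norm (completion_of (v m) - completion_of (v n))
          \<le> norm (completion_of (v m) - X m) + norm (X m - X n) + norm (X n - completion_of (v n))"
        using norm_triangle_ineq[of "completion_of (v m) - X m" "X m - completion_of (v n)"]
          norm_triangle_ineq[of "X m - X n" "X n - completion_of (v n)"] by simp
      then show ?thesis using M1[of m n] M2[of m] M2[of n] that by (simp add: norm_minus_commute)
    qed
    then show "\<exists>M. \<forall>m\<ge>M. \<forall>n\<ge>M. norm (completion_of (v m) - completion_of (v n)) < e"
      by blast
  qed
  then have "seminorm_Cauchy v" by (simp add: seminorm_Cauchy_iff)
  then have "(\<lambda>n. completion_of (v n)) \<longlonglongrightarrow> abs_completion v" by (rule completion_of_tendsto)
  from tendsto_add[OF d this] show "convergent X" by (auto simp: convergent_def)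
qed

lemma completion_extend:
  fixes f :: "'a::complex_seminormed_vector \<Rightarrow> 'b::cbanach"
  assumes f: "clinear f" and K: "\<And>v. norm (f v) \<le> K * seminorm v" and "0 \<le> K"
  shows "\<exists>T. bounded_clinear T \<and> (\<forall>v. T (completion_of v) = f v)"
proof -
  have f_add: "f (x + y) = f x + f y" and f_scale: "f (c *\<^sub>C x) = c *\<^sub>C f x" for x y c
    using f by (auto simp: clinear_def)
  have f_diff: "f (x - y) = f x - f y" for x y
    using f_add[of x "- y"] f_scale[of "-1" y] by (simp add: scaleC_minus_left)
  define P where "P x l \<longleftrightarrow> (\<exists>v. (\<lambda>n. completion_of (v n)) \<longlonglongrightarrow> x \<and> (\<lambda>n. f (v n)) \<longlonglongrightarrow> l)" for x l
  have ex: "\<exists>l. P x l" for x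
  proof (cases x rule: completion_cases)
    case (1 v)
    then have v: "seminorm_Cauchy v" by simp
    have "Cauchy (\<lambda>n. f (v n))"
    proof (rule CauchyI)
      fix e :: real assume "e > 0"
      then have "e / (K + 1) > 0" using \<open>0 \<le> K\<close> by simp
      then obtain M where M: "\<And>m n. m \<ge> M \<Longrightarrow> n \<ge> M \<Longrightarrow> seminorm (v m - v n) < e / (K + 1)"
        using v unfolding seminorm_Cauchy_def by blast
      have "norm (f (v m) - f (v n)) < e" if "m \<ge> M" "n \<ge> M" for m n
      proof -
        have "norm (f (v m) - f (v n)) \<le> K * seminorm (v m - v n)"
          unfolding f_diff[symmetric] by (rule K)
        also have "\<dots> \<le> (K + 1) * seminorm (v m - v n)" by (simp add: algebra_simps)
        also have "\<dots> < e" using M[OF that] \<open>0 \<le> K\<close> by (simp add: field_simps)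
        finally show ?thesis .
      qed
      then show "\<exists>M. \<forall>m\<ge>M. \<forall>n\<ge>M. norm (f (v m) - f (v n)) < e" by blast
    qed
    then obtain l where "(\<lambda>n. f (v n)) \<longlonglongrightarrow> l" using Cauchy_convergent convergent_def by blast
    moreover have "(\<lambda>n. completion_of (v n)) \<longlonglongrightarrow> x"
      using completion_of_tendsto[OF v] 1 by simp
    ultimately show ?thesis unfolding P_def by blast
  qed
  have bd: "norm l \<le> K * norm x" if "P x l" for x l
  proof -
    obtain v where v: "(\<lambda>n. completion_of (v n)) \<longlonglongrightarrow> x" and l: "(\<lambda>n. f (v n)) \<longlonglongrightarrow> l"
      using \<open>P x l\<close> unfolding P_def by blast
    show ?thesis
      by (rule LIMSEQ_le[OF tendsto_norm[OF l] tendsto_mult[OF tendsto_const tendsto_norm[OF v]]])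
        (auto simp: norm_completion_of K)
  qed
  have add: "P (x + y) (l + m)" if "P x l" "P y m" for x y l m
  proof -
    obtain v where v: "(\<lambda>n. completion_of (v n)) \<longlonglongrightarrow> x" "(\<lambda>n. f (v n)) \<longlonglongrightarrow> l"
      using \<open>P x l\<close> unfolding P_def by blast
    obtain w where w: "(\<lambda>n. completion_of (w n)) \<longlonglongrightarrow> y" "(\<lambda>n. f (w n)) \<longlonglongrightarrow> m"
      using \<open>P y m\<close> unfolding P_def by blast
    show ?thesis
      unfolding P_def
      by (rule exI[of _ "\<lambda>n. v n + w n"])
        (simp add: completion_of_add f_add tendsto_add v w)
  qed
  have lim_sc: "(\<lambda>n. c *\<^sub>C g n) \<longlonglongrightarrow> c *\<^sub>C l" if "g \<longlonglongrightarrow> l" for c l and g :: "nat \<Rightarrow> 'z::complex_normed_vector"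
  proof -
    have "bounded_linear ((*\<^sub>C) c :: 'z \<Rightarrow> 'z)"
      by (rule bounded_clinear_imp_linear, rule bounded_clinearI[where K = "cmod c"])
        (simp_all add: scaleC_add_right mult.commute)
    from bounded_linear.tendsto[OF this that] show ?thesis .
  qed
  have scale: "P (c *\<^sub>C x) (c *\<^sub>C l)" if "P x l" for c x l
  proof -
    obtain v where v: "(\<lambda>n. completion_of (v n)) \<longlonglongrightarrow> x" "(\<lambda>n. f (v n)) \<longlonglongrightarrow> l"
      using \<open>P x l\<close> unfolding P_def by blast
    show ?thesis
      unfolding P_def
      by (rule exI[of _ "\<lambda>n. c *\<^sub>C v n"])
        (simp add: completion_of_scaleC f_scale lim_sc v)
  qed
  have uniq: "l = m" if "P x l" "P x m" for x l m
    using bd[OF add[OF that(1) scale[OF that(2), of "-1"]]] by (simp add: scaleC_minus_left)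
  define T where "T x = (THE l. P x l)" for x
  have T: "P x (T x)" for x
    unfolding T_def by (rule theI') (use ex uniq in blast)
  have "bounded_clinear T"
  proof (rule bounded_clinearI[where K = K])
    show "T (x + y) = T x + T y" for x y by (rule uniq[OF T add[OF T T]])
    show "T (c *\<^sub>C x) = c *\<^sub>C T x" for c x by (rule uniq[OF T scale[OF T]])
    show "norm (T x) \<le> K * norm x" for x by (rule bd[OF T])
  qed
  moreover have "T (completion_of v) = f v" for v
    by (rule uniq[OF T]) (auto simp: P_def intro!: exI[of _ "\<lambda>_. v"])
  ultimately show ?thesis by blast
qed

(* A list [(x1, y1), ..., (xn, yn)] stands for the formal sum of the symbols xi (x) yi; the
   algebraic tensor product is the quotient by the least congruence making (x) bilinear.
   Scalars and negation act on the first factor. *)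
inductive tensor_rel ::
  "('a::complex_vector \<times> 'b::complex_vector) list \<Rightarrow> ('a \<times> 'b) list \<Rightarrow> bool" where
  refl: "tensor_rel u u"
| sym: "tensor_rel u v \<Longrightarrow> tensor_rel v u"
| trans: "tensor_rel u v \<Longrightarrow> tensor_rel v w \<Longrightarrow> tensor_rel u w"
| append: "tensor_rel u u' \<Longrightarrow> tensor_rel v v' \<Longrightarrow> tensor_rel (u @ v) (u' @ v')"
| commute: "tensor_rel (u @ v) (v @ u)"
| zero: "tensor_rel [(0, y)] []"
| add_left: "tensor_rel [(x + x', y)] [(x, y), (x', y)]"
| add_right: "tensor_rel [(x, y + y')] [(x, y), (x, y')]"
| scale: "tensor_rel [(c *\<^sub>C x, y)] [(x, c *\<^sub>C y)]"

quotient_type (overloaded) ('a, 'b) tensor =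
    "('a::complex_vector \<times> 'b::complex_vector) list" / tensor_rel
  by (rule equivpI) (auto intro!: reflpI sympI transpI intro: tensor_rel.intros)

lemma tensor_rel_scale:
  "tensor_rel u v \<Longrightarrow> tensor_rel (map (\<lambda>(x, y). (c *\<^sub>C x, y)) u) (map (\<lambda>(x, y). (c *\<^sub>C x, y)) v)"
proof (induct rule: tensor_rel.induct)
  case (scale d x y)
  show ?case
    using tensor_rel.scale[of d "c *\<^sub>C x" y] by (simp add: mult.commute)
qed (auto intro: tensor_rel.intros simp: scaleC_add_right)

lemma tensor_rel_scale_add:
  "tensor_rel (map (\<lambda>(x, y). ((c + d) *\<^sub>C x, y)) u)
    (map (\<lambda>(x, y). (c *\<^sub>C x, y)) u @ map (\<lambda>(x, y). (d *\<^sub>C x, y)) u)"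
proof (induct u)
  case (Cons p u)
  obtain x y where p: "p = (x, y)" by (cases p)
  let ?c = "map (\<lambda>(x, y). (c *\<^sub>C x, y)) u" and ?d = "map (\<lambda>(x, y). (d *\<^sub>C x, y)) u"
  have 1: "tensor_rel ([((c + d) *\<^sub>C x, y)] @ map (\<lambda>(x, y). ((c + d) *\<^sub>C x, y)) u)
      ([(c *\<^sub>C x, y), (d *\<^sub>C x, y)] @ (?c @ ?d))"
    by (rule tensor_rel.append[OF _ Cons]) (simp add: scaleC_add_left tensor_rel.add_left)
  have 2: "tensor_rel ([(c *\<^sub>C x, y)] @ (([(d *\<^sub>C x, y)] @ ?c) @ ?d))
      ([(c *\<^sub>C x, y)] @ ((?c @ [(d *\<^sub>C x, y)]) @ ?d))"
    by (intro tensor_rel.append tensor_rel.refl tensor_rel.commute)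
  show ?case using tensor_rel.trans[OF 1] 2 by (simp add: p)
qed (simp add: tensor_rel.refl)

instantiation tensor :: (complex_vector, complex_vector) complex_vector
begin
lift_definition zero_tensor :: "('a, 'b) tensor" is "[]" .
lift_definition plus_tensor :: "('a, 'b) tensor \<Rightarrow> ('a, 'b) tensor \<Rightarrow> ('a, 'b) tensor"
  is "(@)" by (rule tensor_rel.append)
lift_definition scaleC_tensor :: "complex \<Rightarrow> ('a, 'b) tensor \<Rightarrow> ('a, 'b) tensor"
  is "\<lambda>c. map (\<lambda>(x, y). (c *\<^sub>C x, y))" by (rule tensor_rel_scale)
definition "scaleR_tensor r (u :: ('a, 'b) tensor) = complex_of_real r *\<^sub>C u"
definition "uminus_tensor (u :: ('a, 'b) tensor) = (- 1) *\<^sub>C u"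
definition "minus_tensor u (v :: ('a, 'b) tensor) = u + (- v)"

instance
proof
  fix u v w :: "('a, 'b) tensor" and c d :: complex and r s :: real
  have sa: "c *\<^sub>C (u + v) = c *\<^sub>C u + c *\<^sub>C v" for c and u v :: "('a, 'b) tensor"
    by transfer (simp add: tensor_rel.refl)
  have sl: "(c + d) *\<^sub>C u = c *\<^sub>C u + d *\<^sub>C u" for c d and u :: "('a, 'b) tensor"
    by transfer (rule tensor_rel_scale_add)
  have ss: "c *\<^sub>C d *\<^sub>C u = (c * d) *\<^sub>C u" for c d and u :: "('a, 'b) tensor"
    by transfer (simp add: tensor_rel.refl comp_def case_prod_unfold)
  have s1: "1 *\<^sub>C u = u" for u :: "('a, 'b) tensor"
    by transfer (simp add: tensor_rel.refl)
  have s0: "0 *\<^sub>C u = 0" for u :: "('a, 'b) tensor"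
  proof transfer
    fix u :: "('a \<times> 'b) list"
    show "tensor_rel (map (\<lambda>(x, y). (0 *\<^sub>C x, y)) u) []"
    proof (induct u)
      case (Cons p u)
      have "tensor_rel ([(0, snd p)] @ map (\<lambda>(x, y). (0 *\<^sub>C x, y)) u) ([] @ [])"
        by (rule tensor_rel.append[OF tensor_rel.zero Cons])
      then show ?case by (simp add: case_prod_unfold)
    qed (simp add: tensor_rel.refl)
  qed
  show "c *\<^sub>C (u + v) = c *\<^sub>C u + c *\<^sub>C v" "(c + d) *\<^sub>C u = c *\<^sub>C u + d *\<^sub>C u"
    "c *\<^sub>C d *\<^sub>C u = (c * d) *\<^sub>C u" "1 *\<^sub>C u = u"
    by (rule sa sl ss s1)+
  show "r *\<^sub>R u = complex_of_real r *\<^sub>C u" by (rule scaleR_tensor_def)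
  show "r *\<^sub>R (u + v) = r *\<^sub>R u + r *\<^sub>R v" "(r + s) *\<^sub>R u = r *\<^sub>R u + s *\<^sub>R u"
    "r *\<^sub>R s *\<^sub>R u = (r * s) *\<^sub>R u" "1 *\<^sub>R u = u"
    by (simp_all add: scaleR_tensor_def sa sl ss s1)
  show "u + v + w = u + (v + w)" by transfer (simp add: tensor_rel.refl)
  show "u + v = v + u" by transfer (rule tensor_rel.commute)
  show "0 + u = u" by transfer (simp add: tensor_rel.refl)
  show "- u + u = 0"
    using sl[of "-1" 1 u] s0[of u] s1[of u] by (simp add: uminus_tensor_def)
  show "u - v = u + - v" by (rule minus_tensor_def)
qed

end

lift_definition tensor_of ::
  "'a::complex_vector \<Rightarrow> 'b::complex_vector \<Rightarrow> ('a, 'b) tensor" is "\<lambda>x y. [(x, y)]" .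

lemma tensor_of_simps:
  "tensor_of (x + x') y = tensor_of x y + tensor_of x' y"
  "tensor_of x (y + y') = tensor_of x y + tensor_of x y'"
  "tensor_of (c *\<^sub>C x) y = c *\<^sub>C tensor_of x y"
  "tensor_of x (c *\<^sub>C y) = c *\<^sub>C tensor_of x y"
  by (transfer, simp add: tensor_rel.intros)+

definition tensor_cost :: "('a::complex_normed_vector \<times> 'b::complex_normed_vector) list \<Rightarrow> real" where
  "tensor_cost u = (\<Sum>(x, y)\<leftarrow>u. norm x * norm y)"

(* The projective norm: infimum of the sum of |xi| |yi| over all representations of t as a
   finite sum of xi (x) yi. *)
instantiation tensor :: (complex_normed_vector, complex_normed_vector) complex_seminormed_vector
begin

definition seminorm_tensor :: "('a, 'b) tensor \<Rightarrow> real" where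
  "seminorm_tensor t = (INF u \<in> {u. abs_tensor u = t}. tensor_cost u)"

lemma tensor_cost_nonneg: "0 \<le> tensor_cost u"
  unfolding tensor_cost_def by (rule sum_list_nonneg) auto

lemma seminorm_tensor_le: "seminorm t \<le> tensor_cost u" if "abs_tensor u = (t :: ('a, 'b) tensor)"
  unfolding seminorm_tensor_def
  by (rule cINF_lower) (use that tensor_cost_nonneg in \<open>auto intro!: bdd_belowI2[where m = 0]\<close>)

lemma seminorm_tensor_greatest:
  assumes "\<And>u. abs_tensor u = (t :: ('a, 'b) tensor) \<Longrightarrow> b \<le> tensor_cost u"
  shows "b \<le> seminorm t"
proof -
  have "{u. abs_tensor u = t} \<noteq> {}"
    by (induct t rule: tensor.abs_induct) auto
  then show ?thesis
    unfolding seminorm_tensor_def by (rule cINF_greatest) (simp add: assms)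
qed

instance
proof
  fix s t :: "('a, 'b) tensor" and c :: complex
  have "seminorm (s + t) - seminorm s \<le> tensor_cost v" if v: "abs_tensor v = t" for v
  proof -
    have "seminorm (s + t) - tensor_cost v \<le> seminorm s"
    proof (rule seminorm_tensor_greatest)
      fix u assume u: "abs_tensor u = s"
      have "seminorm (s + t) \<le> tensor_cost (u @ v)"
        by (rule seminorm_tensor_le) (simp flip: u v add: plus_tensor.abs_eq)
      then show "seminorm (s + t) - tensor_cost v \<le> tensor_cost u" by (simp add: tensor_cost_def)
    qed
    then show ?thesis by simp
  qed
  then have "seminorm (s + t) - seminorm s \<le> seminorm t" by (rule seminorm_tensor_greatest)
  then show "seminorm (s + t) \<le> seminorm s + seminorm t" by simp
  have le: "seminorm (c *\<^sub>C t) \<le> cmod c * tensor_cost u" if u: "abs_tensor u = t" for c t and u :: "('a \<times> 'b) list"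
  proof -
    have "seminorm (c *\<^sub>C t) \<le> tensor_cost (map (\<lambda>(x, y). (c *\<^sub>C x, y)) u)"
      by (rule seminorm_tensor_le) (simp flip: u add: scaleC_tensor.abs_eq)
    also have "\<dots> = cmod c * tensor_cost u"
      by (simp add: tensor_cost_def comp_def case_prod_unfold mult.assoc sum_list_const_mult)
    finally show ?thesis .
  qed
  have nonneg: "0 \<le> seminorm t" for t :: "('a, 'b) tensor"
    by (rule seminorm_tensor_greatest) (rule tensor_cost_nonneg)
  have le': "seminorm (c *\<^sub>C t) \<le> cmod c * seminorm t" if "c \<noteq> 0" for c and t :: "('a, 'b) tensor"
  proof -
    have "seminorm (c *\<^sub>C t) / cmod c \<le> seminorm t"
      by (rule seminorm_tensor_greatest) (use le that in \<open>simp add: field_simps\<close>)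
    then show ?thesis using that by (simp add: field_simps)
  qed
  show "seminorm (c *\<^sub>C t) = cmod c * seminorm t"
  proof (cases "c = 0")
    case True
    have "seminorm (0 :: ('a, 'b) tensor) \<le> tensor_cost ([] :: ('a \<times> 'b) list)"
      by (rule seminorm_tensor_le) (simp add: zero_tensor_def)
    then show ?thesis using True nonneg[of 0] by (simp add: tensor_cost_def)
  next
    case False
    have "seminorm (inverse c *\<^sub>C c *\<^sub>C t) \<le> cmod (inverse c) * seminorm (c *\<^sub>C t)"
      using False by (intro le') simp
    moreover have "inverse c *\<^sub>C c *\<^sub>C t = t" using False by simp
    ultimately have "seminorm t \<le> seminorm (c *\<^sub>C t) / cmod c"
      by (simp add: norm_inverse divide_inverse mult.commute)
    then have "cmod c * seminorm t \<le> seminorm (c *\<^sub>C t)"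
      using False by (simp add: field_simps)
    then show ?thesis using le'[OF False, of t] by simp
  qed
qed

end

(* The projective tensor product; well-behaved by ptensor_lift_ex1. *)
type_synonym ('a, 'b) ptensor = "('a, 'b) tensor completion"

definition elem_tensor ::
  "'a::complex_normed_vector \<Rightarrow> 'b::complex_normed_vector \<Rightarrow> ('a, 'b) ptensor" where
  "elem_tensor x y = completion_of (tensor_of x y)"

definition bounded_cbilinear ::
    "('a::complex_normed_vector \<Rightarrow> 'b::complex_normed_vector \<Rightarrow> 'c::complex_normed_vector) \<Rightarrow> bool" where
  "bounded_cbilinear B \<longleftrightarrow> (\<forall>y. clinear (\<lambda>x. B x y)) \<and> (\<forall>x. clinear (\<lambda>y. B x y)) \<and>
    (\<exists>K. \<forall>x y. norm (B x y) \<le> K * norm x * norm y)"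

lemma tensor_induct [case_names zero add]:
  assumes "P 0" "\<And>x y t. P t \<Longrightarrow> P (tensor_of x y + t)"
  shows "P t"
proof (induct t rule: tensor.abs_induct)
  case (1 u)
  show ?case
  proof (induct u)
    case Nil
    then show ?case using assms(1) by (simp add: zero_tensor_def)
  next
    case (Cons p u)
    then show ?case
      using assms(2)[of "abs_tensor u" "fst p" "snd p"]
      by (simp add: tensor_of.abs_eq plus_tensor.abs_eq)
  qed
qed

lemma bounded_cbilinearD:
  assumes "bounded_cbilinear B"
  shows "B (x + x') y = B x y + B x' y" "B x (y + y') = B x y + B x y'"
    "B (c *\<^sub>C x) y = c *\<^sub>C B x y" "B x (c *\<^sub>C y) = c *\<^sub>C B x y" "B 0 y = 0"
proof -
  show 1: "B (x + x') y = B x y + B x' y" "B x (y + y') = B x y + B x y'"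
    "B (c *\<^sub>C x) y = c *\<^sub>C B x y" "B x (c *\<^sub>C y) = c *\<^sub>C B x y" for x x' y y' c
    using assms by (simp_all add: bounded_cbilinear_def clinear_def)
  show "B 0 y = 0" using 1(1)[of 0 0 y] by simp
qed

lemma tensor_lift:
  assumes B: "bounded_cbilinear B"
  obtains f where "clinear f" "\<And>x y. f (tensor_of x y) = B x y"
    "\<And>u. f (abs_tensor u) = (\<Sum>(x, y)\<leftarrow>u. B x y)"
proof -
  note [simp] = bounded_cbilinearD[OF B]
  let ?g = "\<lambda>u. \<Sum>(x, y)\<leftarrow>u. B x y"
  have g: "?g u = ?g v" if "tensor_rel u v" for u v
    using that by (induct rule: tensor_rel.induct) (simp_all add: add.commute)
  define f where "f t = ?g (rep_tensor t)" for t
  have f: "f (abs_tensor u) = ?g u" for u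
    unfolding f_def by (rule g) (rule Quotient_rep_abs[OF Quotient_tensor], rule tensor_rel.refl)
  have gs: "?g (map (\<lambda>(x, y). (c *\<^sub>C x, y)) u) = c *\<^sub>C ?g u" for c u
    by (induct u) (auto simp: scaleC_add_right)
  have "f (s + t) = f s + f t" for s t
  proof (induct s rule: tensor.abs_induct)
    case (1 u)
    show ?case by (induct t rule: tensor.abs_induct) (simp add: plus_tensor.abs_eq f)
  qed
  moreover have "f (c *\<^sub>C t) = c *\<^sub>C f t" for c t
    by (induct t rule: tensor.abs_induct) (simp only: scaleC_tensor.abs_eq f gs)
  ultimately show ?thesis
    using that[of f] f by (simp add: clinear_def tensor_of.abs_eq)
qed

theorem ptensor_lift_ex1:
  fixes B :: "'a::complex_normed_vector \<Rightarrow> 'b::complex_normed_vector \<Rightarrow> 'c::cbanach"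
  assumes B: "bounded_cbilinear B"
  shows "\<exists>!T. bounded_clinear T \<and> (\<forall>x y. T (elem_tensor x y) = B x y)"
proof -
  obtain K0 where K0: "\<And>x y. norm (B x y) \<le> K0 * norm x * norm y"
    using B unfolding bounded_cbilinear_def by blast
  define K where "K = max 0 K0"
  have K: "norm (B x y) \<le> K * (norm x * norm y)" for x y
    using K0[of x y] mult_right_mono[of K0 K "norm x * norm y"]
    by (simp add: K_def mult.assoc)
  have "0 \<le> K" by (simp add: K_def)
  obtain f where f: "clinear f" "\<And>x y. f (tensor_of x y) = B x y"
    "\<And>u. f (abs_tensor u) = (\<Sum>(x, y)\<leftarrow>u. B x y)"
    using tensor_lift[OF B] by blast
  have cost: "norm (\<Sum>(x, y)\<leftarrow>u. B x y) \<le> K * tensor_cost u" for u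
  proof (induct u)
    case (Cons p u)
    then show ?case
      using norm_triangle_ineq[of "B (fst p) (snd p)" "\<Sum>(x, y)\<leftarrow>u. B x y"] K[of "fst p" "snd p"]
      by (simp add: tensor_cost_def case_prod_unfold distrib_left)
  qed (simp add: tensor_cost_def)
  have "norm (f t) \<le> K * seminorm t" for t
  proof (cases "K = 0")
    case True
    have "norm (f t) \<le> 0"
      by (induct t rule: tensor.abs_induct) (use cost True in \<open>simp add: f\<close>)
    then show ?thesis using True by simp
  next
    case False
    then have "K > 0" using \<open>0 \<le> K\<close> by simp
    have "norm (f t) / K \<le> seminorm t"
    proof (rule seminorm_tensor_greatest)
      fix u assume "abs_tensor u = t"
      then show "norm (f t) / K \<le> tensor_cost u"
        using cost[of u] \<open>K > 0\<close> f(3)[of u] by (simp add: field_simps)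
    qed
    then show ?thesis using \<open>K > 0\<close> by (simp add: field_simps)
  qed
  from completion_extend[OF f(1) this \<open>0 \<le> K\<close>]
  obtain T where T: "bounded_clinear T" "\<And>v. T (completion_of v) = f v" by blast
  show ?thesis
  proof (rule ex1I[of _ T])
    show "bounded_clinear T \<and> (\<forall>x y. T (elem_tensor x y) = B x y)"
      using T f by (simp add: elem_tensor_def)
    fix S assume S: "bounded_clinear S \<and> (\<forall>x y. S (elem_tensor x y) = B x y)"
    interpret S: bounded_linear S using S by (simp add: bounded_clinear_imp_linear)
    interpret T: bounded_linear T using T(1) by (rule bounded_clinear_imp_linear)
    have eq: "S (completion_of t) = T (completion_of t)" for t
    proof (induct t rule: tensor_induct)
      case zero
      have "completion_of (0 :: ('a, 'b) tensor) = 0"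
        using norm_completion_of[of "0 :: ('a, 'b) tensor"] by simp
      then show ?case by (simp add: S.zero T.zero)
    next
      case (add x y t)
      then show ?case
        using S T(2) f(2) by (simp add: completion_of_add S.add T.add flip: elem_tensor_def)
          (simp add: elem_tensor_def)
    qed
    show "S = T"
    proof
      fix x show "S x = T x"
      proof (cases x rule: completion_cases)
        case (1 v)
        have lim: "(\<lambda>n. completion_of (v n)) \<longlonglongrightarrow> x" using completion_of_tendsto 1 by simp
        show ?thesis
          using LIMSEQ_unique[OF S.tendsto[OF lim]] T.tendsto[OF lim] by (simp add: eq)
      qed
    qed
  qed
qed

definition ptensor_lift ::
    "('a::complex_normed_vector \<Rightarrow> 'b::complex_normed_vector \<Rightarrow> 'c::cbanach) \<Rightarrow> ('a, 'b) ptensor \<Rightarrow> 'c" where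
  "ptensor_lift B = (THE T. bounded_clinear T \<and> (\<forall>x y. T (elem_tensor x y) = B x y))"

lemma ptensor_lift:
  assumes "bounded_cbilinear B"
  shows "bounded_clinear (ptensor_lift B)" "ptensor_lift B (elem_tensor x y) = B x y"
  using theI'[OF ptensor_lift_ex1[OF assms]] unfolding ptensor_lift_def by blast+

lemma bounded_cbilinear_elem_tensor: "bounded_cbilinear elem_tensor"
  unfolding bounded_cbilinear_def clinear_def
proof (intro conjI exI[of _ 1] allI)
  fix x :: 'a and y :: 'b
  have "seminorm (tensor_of x y) \<le> tensor_cost [(x, y)]"
    by (rule seminorm_tensor_le) (simp add: tensor_of.abs_eq)
  then show "norm (elem_tensor x y) \<le> 1 * norm x * norm y"
    by (simp add: elem_tensor_def norm_completion_of tensor_cost_def)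
qed (simp_all add: elem_tensor_def tensor_of_simps completion_of_add completion_of_scaleC)

definition cadjoint ::
    "('a::complex_normed_vector \<Rightarrow> 'b::complex_normed_vector) \<Rightarrow> 'b cdual \<Rightarrow> 'a cdual" where
  "cadjoint T f = cdual_of (\<lambda>x. cdual_apply f (T x))"

lemma cadjoint_apply:
  "bounded_clinear T \<Longrightarrow> cdual_apply (cadjoint T f) x = cdual_apply f (T x)"
  unfolding cadjoint_def
  by (rule cdual_of_apply) (rule bounded_clinear_compose[OF bounded_clinear_cdual_apply])

lemma bounded_clinear_cadjoint:
  assumes "bounded_clinear T"
  shows "bounded_clinear (cadjoint T)"
proof -
  obtain K0 where "\<And>x. norm (T x) \<le> K0 * norm x"
    using assms unfolding bounded_clinear_def by blast
  then have K: "norm (T x) \<le> \<bar>K0\<bar> * norm x" for x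
    by (meson abs_ge_self mult_right_mono norm_ge_zero order.trans)
  note [simp] = cadjoint_apply[OF assms]
  show ?thesis
  proof (rule bounded_clinearI[where K = "\<bar>K0\<bar>"])
    fix f :: "'b cdual"
    show "norm (cadjoint T f) \<le> \<bar>K0\<bar> * norm f"
    proof (rule norm_cdual_bound)
      fix x
      have "cmod (cdual_apply f (T x)) \<le> norm f * (\<bar>K0\<bar> * norm x)"
        by (rule order.trans[OF norm_cdual_apply mult_left_mono[OF K]]) simp
      then show "cmod (cdual_apply (cadjoint T f) x) \<le> \<bar>K0\<bar> * norm f * norm x"
        by (simp add: mult_ac)
    qed simp
  qed (rule cdual_eqI; simp)+
qed

definition canonical :: "'a::complex_normed_vector \<Rightarrow> 'a cdual cdual" where
  "canonical a = cdual_of (\<lambda>f. cdual_apply f a)"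

lemma canonical_apply: "cdual_apply (canonical a) f = cdual_apply f a"
  unfolding canonical_def by (rule cdual_of_apply) (rule bounded_clinear_eval)

(* Dual module actions: (a . f)(x) = f(x . a) needs the right action r of the module,
   (f . a)(x) = f(a . x) needs its left action l. Iterating, a . F on the second dual is
   cdual_lact (cdual_ract l) a F, and F . a is cdual_ract (cdual_lact r) F a. *)
definition cdual_lact ::
    "('x::complex_normed_vector \<Rightarrow> 'a \<Rightarrow> 'x) \<Rightarrow> 'a \<Rightarrow> 'x cdual \<Rightarrow> 'x cdual" where
  "cdual_lact r a f = cdual_of (\<lambda>x. cdual_apply f (r x a))"

definition cdual_ract ::
    "('a \<Rightarrow> 'x::complex_normed_vector \<Rightarrow> 'x) \<Rightarrow> 'x cdual \<Rightarrow> 'a \<Rightarrow> 'x cdual" where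
  "cdual_ract l f a = cdual_of (\<lambda>x. cdual_apply f (l a x))"

lemma cdual_lact_cadjoint: "cdual_lact r a = cadjoint (\<lambda>x. r x a)"
  by (rule ext) (simp add: cdual_lact_def cadjoint_def)

lemma cdual_ract_cadjoint: "cdual_ract l f a = cadjoint (l a) f"
  by (simp add: cdual_ract_def cadjoint_def)

definition ptensor_mult :: "('a::cbanach_algebra, 'a) ptensor \<Rightarrow> 'a" where
  "ptensor_mult = ptensor_lift (\<lambda>b c. b * c)"

definition ptensor_lact ::
    "'a::cbanach_algebra \<Rightarrow> ('a, 'a) ptensor \<Rightarrow> ('a, 'a) ptensor" where
  "ptensor_lact a = ptensor_lift (\<lambda>b c. elem_tensor (a * b) c)"

definition ptensor_ract ::
    "('a::cbanach_algebra, 'a) ptensor \<Rightarrow> 'a \<Rightarrow> ('a, 'a) ptensor" where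
  "ptensor_ract u a = ptensor_lift (\<lambda>b c. elem_tensor b (c * a)) u"

lemma bounded_clinear_mult_left: "bounded_clinear (\<lambda>x. a * (x :: 'a::complex_normed_algebra))"
  by (rule bounded_clinearI[where K = "norm a"]) (auto simp: distrib_left norm_mult_ineq)

lemma bounded_clinear_mult_right: "bounded_clinear (\<lambda>x. (x :: 'a::complex_normed_algebra) * a)"
  by (rule bounded_clinearI[where K = "norm a"])
    (auto simp: distrib_right mult.commute[of "norm a"] norm_mult_ineq)

lemma bounded_cbilinear_mult:
  "bounded_cbilinear (\<lambda>b c. (b :: 'a::complex_normed_algebra) * c)"
  unfolding bounded_cbilinear_def
proof (intro conjI allI exI[of _ 1])
  show "clinear (\<lambda>x. x * y)" "clinear (\<lambda>x. y * x)" for y :: 'a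
    using bounded_clinear_mult_left[of y] bounded_clinear_mult_right[of y]
    by (simp_all add: bounded_clinear_def)
  show "norm (x * y) \<le> 1 * norm x * norm y" for x y :: 'a by (simp add: norm_mult_ineq)
qed

lemma bounded_cbilinear_compose:
  assumes B: "bounded_cbilinear B" and S: "bounded_clinear S" and T: "bounded_clinear T"
  shows "bounded_cbilinear (\<lambda>x y. B (S x) (T y))"
proof -
  obtain K where K: "\<And>x y. norm (B x y) \<le> K * norm x * norm y"
    using B unfolding bounded_cbilinear_def by blast
  obtain C where C: "\<And>x. norm (S x) \<le> C * norm x" using S unfolding bounded_clinear_def by blast
  obtain D where D: "\<And>x. norm (T x) \<le> D * norm x" using T unfolding bounded_clinear_def by blast
  have "norm (B (S x) (T y)) \<le> (\<bar>K\<bar> * \<bar>C\<bar> * \<bar>D\<bar>) * norm x * norm y" for x y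
  proof -
    have "norm (S x) \<le> \<bar>C\<bar> * norm x" "norm (T y) \<le> \<bar>D\<bar> * norm y"
      by (meson C D abs_ge_self mult_right_mono norm_ge_zero order.trans)+
    then have "norm (S x) * norm (T y) \<le> (\<bar>C\<bar> * norm x) * (\<bar>D\<bar> * norm y)"
      by (intro mult_mono) auto
    then have "\<bar>K\<bar> * (norm (S x) * norm (T y)) \<le> \<bar>K\<bar> * ((\<bar>C\<bar> * norm x) * (\<bar>D\<bar> * norm y))"
      by (rule mult_left_mono) simp
    moreover have "norm (B (S x) (T y)) \<le> \<bar>K\<bar> * (norm (S x) * norm (T y))"
      using K[of "S x" "T y"] mult_right_mono[OF abs_ge_self, of "norm (S x) * norm (T y)" K]
      by (simp add: mult.assoc)
    ultimately show ?thesis by (simp add: mult_ac)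
  qed
  moreover have "clinear (\<lambda>x. B (S x) (T y))" "clinear (\<lambda>y. B (S x) (T y))" for x y
    using S T bounded_cbilinearD[OF B] by (simp_all add: clinear_def bounded_clinear_def)
  ultimately show ?thesis unfolding bounded_cbilinear_def by blast
qed

lemma bounded_clinear_id: "bounded_clinear (\<lambda>x. x)"
  by (rule bounded_clinearI[where K = 1]) auto

lemma ptensor_mult:
  "bounded_clinear (ptensor_mult :: ('a::cbanach_algebra, 'a) ptensor \<Rightarrow> 'a)"
  "ptensor_mult (elem_tensor b (c :: 'a)) = b * c"
  unfolding ptensor_mult_def by (intro ptensor_lift bounded_cbilinear_mult)+

lemma ptensor_lact:
  "bounded_clinear (ptensor_lact a)"
  "ptensor_lact a (elem_tensor b c) = elem_tensor (a * b) c"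
  unfolding ptensor_lact_def
  by (intro ptensor_lift bounded_cbilinear_compose[OF bounded_cbilinear_elem_tensor]
      bounded_clinear_mult_left bounded_clinear_id)+

lemma ptensor_ract:
  "bounded_clinear (\<lambda>u. ptensor_ract u a)"
  "ptensor_ract (elem_tensor b c) a = elem_tensor b (c * a)"
  unfolding ptensor_ract_def
  by (intro ptensor_lift bounded_cbilinear_compose[OF bounded_cbilinear_elem_tensor]
      bounded_clinear_mult_right bounded_clinear_id)+

definition biflat :: "'a::cbanach_algebra itself \<Rightarrow> bool" where
  "biflat _ \<longleftrightarrow> (\<exists>\<rho> :: 'a \<Rightarrow> ('a, 'a) ptensor cdual cdual.
     bounded_clinear \<rho> \<and>
     (\<forall>a b. \<rho> (a * b) = cdual_lact (cdual_ract ptensor_lact) a (\<rho> b) \<and>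
            \<rho> (a * b) = cdual_ract (cdual_lact ptensor_ract) (\<rho> a) b) \<and>
     (\<forall>a. cadjoint (cadjoint ptensor_mult) (\<rho> a) = canonical a))"

(* Continuity is not assumed; it is automatic, see character_bounded. *)
definition characters :: "('a::cbanach_algebra \<Rightarrow> complex) set" where
  "characters = {\<psi>. clinear \<psi> \<and> (\<forall>a b. \<psi> (a * b) = \<psi> a * \<psi> b) \<and> \<psi> \<noteq> (\<lambda>_. 0)}"

(* The extension of psi to the second dual, F |-> F(psi). *)
definition char_ext :: "('a::cbanach_algebra \<Rightarrow> complex) \<Rightarrow> 'a cdual cdual \<Rightarrow> complex" where
  "char_ext \<psi> F = cdual_apply F (cdual_of \<psi>)"

definition left_biflat :: "('a::cbanach_algebra \<Rightarrow> complex) \<Rightarrow> bool" where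
  "left_biflat \<psi> \<longleftrightarrow> (\<exists>\<rho> :: 'a \<Rightarrow> ('a, 'a) ptensor cdual cdual.
     bounded_clinear \<rho> \<and>
     (\<forall>a b. \<rho> (a * b) = \<psi> b *\<^sub>C \<rho> a \<and>
            \<rho> (a * b) = cdual_lact (cdual_ract ptensor_lact) a (\<rho> b)) \<and>
     (\<forall>a. char_ext \<psi> (cadjoint (cadjoint ptensor_mult) (\<rho> a)) = \<psi> a))"

lemma character_norm_le:
  assumes "\<psi> \<in> characters"
  shows "cmod (\<psi> a) \<le> norm a"
proof (rule ccontr)
  assume "\<not> cmod (\<psi> a) \<le> norm a"
  then have less: "norm a < cmod (\<psi> a)" by simp
  have add: "\<psi> (x + y) = \<psi> x + \<psi> y" and scale: "\<psi> (c *\<^sub>C x) = c * \<psi> x"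
    and mult: "\<psi> (x * y) = \<psi> x * \<psi> y" for x y c
    using assms by (auto simp: characters_def clinear_def scaleC_complex_def)
  have nz: "\<psi> a \<noteq> 0" using less norm_ge_zero[of a] by auto
  define y where "y = inverse (\<psi> a) *\<^sub>C a"
  have y1: "\<psi> y = 1" using nz by (simp add: y_def scale)
  have "norm y = norm a / cmod (\<psi> a)" by (simp add: y_def norm_inverse divide_inverse)
  also have "\<dots> < 1" using less nz by simp
  finally have y: "norm y < 1" .
  have "\<exists>!z. y + y * z = z"
  proof (rule banach_fix_type[where c = "norm y"])
    show "\<forall>z w. dist (y + y * z) (y + y * w) \<le> norm y * dist z w"
      by (simp add: dist_norm norm_mult_ineq flip: right_diff_distrib)
  qed (use y in auto)
  then obtain z where z: "y + y * z = z" by blast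
  have "\<psi> y + \<psi> y * \<psi> z = \<psi> z" using arg_cong[OF z, of \<psi>] by (simp add: add mult)
  then show False by (simp add: y1)
qed

lemma character_bounded: "\<psi> \<in> characters \<Longrightarrow> bounded_clinear \<psi>"
  unfolding bounded_clinear_def
  by (metis (mono_tags, lifting) character_norm_le characters_def mem_Collect_eq mult_1)

lemma char_ext_canonical: "\<psi> \<in> characters \<Longrightarrow> char_ext \<psi> (canonical a) = \<psi> a"
  by (simp add: char_ext_def canonical_apply cdual_of_apply character_bounded)

(* A copy of the second dual, needed because the Arens product can only be attached by a type
   class instance to a type constructor of its own. *)
typedef (overloaded) ('a::complex_normed_vector) bidual = "UNIV :: 'a cdual cdual set"
  morphisms bidual_functional Bidual by simp

setup_lifting type_definition_bidual

lemma bidual_eqI: "bidual_functional F = bidual_functional G \<Longrightarrow> F = G"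
  by (simp add: bidual_functional_inject)

instantiation bidual :: (complex_normed_vector) complex_normed_vector
begin
lift_definition zero_bidual :: "'a bidual" is 0 .
lift_definition plus_bidual :: "'a bidual \<Rightarrow> 'a bidual \<Rightarrow> 'a bidual" is "(+)" .
lift_definition minus_bidual :: "'a bidual \<Rightarrow> 'a bidual \<Rightarrow> 'a bidual" is "(-)" .
lift_definition uminus_bidual :: "'a bidual \<Rightarrow> 'a bidual" is uminus .
lift_definition scaleR_bidual :: "real \<Rightarrow> 'a bidual \<Rightarrow> 'a bidual" is scaleR .
lift_definition scaleC_bidual :: "complex \<Rightarrow> 'a bidual \<Rightarrow> 'a bidual" is scaleC .
lift_definition norm_bidual :: "'a bidual \<Rightarrow> real" is norm .
definition "dist_bidual F G = norm (F - G :: 'a bidual)"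
definition "sgn_bidual F = scaleR (inverse (norm F)) (F :: 'a bidual)"
definition uniformity_bidual :: "('a bidual \<times> 'a bidual) filter" where
  "uniformity_bidual = (INF e\<in>{0 <..}. principal {(x, y). dist x y < e})"
definition open_bidual :: "'a bidual set \<Rightarrow> bool" where
  "open_bidual S = (\<forall>x\<in>S. \<forall>\<^sub>F (x', y) in uniformity. x' = x \<longrightarrow> y \<in> S)"
instance
proof
  fix F G H :: "'a bidual" and c d :: complex and r s :: real
  show "c *\<^sub>C (F + G) = c *\<^sub>C F + c *\<^sub>C G" by transfer (rule scaleC_add_right)
  show "(c + d) *\<^sub>C F = c *\<^sub>C F + d *\<^sub>C F" by transfer (rule scaleC_add_left)
  show "c *\<^sub>C d *\<^sub>C F = (c * d) *\<^sub>C F" by transfer (rule scaleC_scaleC)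
  show "1 *\<^sub>C F = F" by transfer (rule scaleC_one)
  show "r *\<^sub>R F = complex_of_real r *\<^sub>C F" by transfer (rule scaleR_scaleC)
  show "r *\<^sub>R (F + G) = r *\<^sub>R F + r *\<^sub>R G" by transfer (rule scaleR_add_right)
  show "(r + s) *\<^sub>R F = r *\<^sub>R F + s *\<^sub>R F" by transfer (rule scaleR_add_left)
  show "r *\<^sub>R s *\<^sub>R F = (r * s) *\<^sub>R F" by transfer simp
  show "1 *\<^sub>R F = F" by transfer simp
  show "norm (c *\<^sub>C F) = cmod c * norm F" by transfer (rule norm_scaleC)
  show "norm (r *\<^sub>R F) = \<bar>r\<bar> * norm F" by transfer simp
  show "F + G + H = F + (G + H)" by transfer simp
  show "F + G = G + F" by transfer simp
  show "0 + F = F" by transfer simp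
  show "- F + F = 0" by transfer simp
  show "F - G = F + - G" by transfer simp
  show "norm F = 0 \<longleftrightarrow> F = 0" by transfer simp
  show "norm (F + G) \<le> norm F + norm G" by transfer (rule norm_triangle_ineq)
  show "open S = (\<forall>x\<in>S. \<forall>\<^sub>F (x', y) in uniformity. x' = x \<longrightarrow> y \<in> S)" for S :: "'a bidual set"
    by (rule open_bidual_def)
qed (simp_all add: dist_bidual_def sgn_bidual_def uniformity_bidual_def)
end

instance bidual :: (complex_normed_vector) cbanach
proof
  fix X :: "nat \<Rightarrow> 'a bidual"
  assume C: "Cauchy X"
  have d: "dist (bidual_functional F) (bidual_functional G) = dist F G" for F G :: "'a bidual"
    by (simp add: dist_norm norm_bidual.rep_eq minus_bidual.rep_eq)
  have "Cauchy (\<lambda>n. bidual_functional (X n))"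
    using C by (simp add: Cauchy_def d)
  then obtain L where L: "(\<lambda>n. bidual_functional (X n)) \<longlonglongrightarrow> L"
    using Cauchy_convergent convergent_def by blast
  have "bidual_functional (Bidual L) = L" by (simp add: Bidual_inverse)
  then have "X \<longlonglongrightarrow> Bidual L"
    using L by (simp add: tendsto_dist_iff[of X] tendsto_dist_iff[of "\<lambda>n. bidual_functional (X n)"] flip: d)
  then show "convergent X" by (auto simp: convergent_def)
qed

(* First Arens product: (f . a)(b) = f(ab), (G . f)(a) = G(f . a), (F G)(f) = F(G . f). *)
definition arens_act ::
    "'a::complex_normed_algebra cdual cdual \<Rightarrow> 'a cdual \<Rightarrow> 'a cdual" where
  "arens_act G f = cdual_of (\<lambda>a. cdual_apply G (cdual_ract (*) f a))"

definition arens_mult ::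
    "'a::complex_normed_algebra cdual cdual \<Rightarrow> 'a cdual cdual \<Rightarrow> 'a cdual cdual" where
  "arens_mult F G = cdual_of (\<lambda>f. cdual_apply F (arens_act G f))"

lemma cdual_ract_mult_apply:
  "cdual_apply (cdual_ract (*) f a) b = cdual_apply f (a * b)"
  for a b :: "'a::complex_normed_algebra"
  by (simp add: cdual_ract_cadjoint cadjoint_apply bounded_clinear_mult_left)

lemma cdual_apply_arg:
  "cdual_apply f (x + y) = cdual_apply f x + cdual_apply f y"
  "cdual_apply f (c *\<^sub>C x) = c * cdual_apply f x"
  using bounded_clinear_cdual_apply[of f]
  by (simp_all add: bounded_clinear_def clinear_def scaleC_complex_def)

lemma norm_cdual_ract_mult: "norm (cdual_ract (*) f a) \<le> norm f * norm a"
  for a :: "'a::complex_normed_algebra"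
proof (rule norm_cdual_bound)
  fix x
  have "cmod (cdual_apply f (a * x)) \<le> norm f * (norm a * norm x)"
    by (rule order.trans[OF norm_cdual_apply mult_left_mono[OF norm_mult_ineq]]) simp
  then show "cmod (cdual_apply (cdual_ract (*) f a) x) \<le> norm f * norm a * norm x"
    by (simp add: cdual_ract_mult_apply mult.assoc)
qed simp

lemma cdual_ract_mult_simps:
  fixes a b :: "'a::complex_normed_algebra"
  shows "cdual_ract (*) f (a + b) = cdual_ract (*) f a + cdual_ract (*) f b"
    "cdual_ract (*) f (c *\<^sub>C a) = c *\<^sub>C cdual_ract (*) f a"
    "cdual_ract (*) (f + g) a = cdual_ract (*) f a + cdual_ract (*) g a"
    "cdual_ract (*) (c *\<^sub>C f) a = c *\<^sub>C cdual_ract (*) f a"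
    "cdual_ract (*) (cdual_ract (*) f a) b = cdual_ract (*) f (a * b)"
  by (rule cdual_eqI; simp add: cdual_ract_mult_apply cdual_apply_arg distrib_right mult.assoc)+

lemma norm_arens_act_aux:
  "cmod (cdual_apply G (cdual_ract (*) f a)) \<le> norm G * norm f * norm a"
  for a :: "'a::complex_normed_algebra"
  using order.trans[OF norm_cdual_apply[of G "cdual_ract (*) f a"]
      mult_left_mono[OF norm_cdual_ract_mult[of f a]]]
  by (simp add: mult.assoc)

lemma arens_act_apply:
  "cdual_apply (arens_act G f) a = cdual_apply G (cdual_ract (*) f a)"
  for a :: "'a::complex_normed_algebra"
  unfolding arens_act_def
proof (rule cdual_of_apply, rule bounded_clinearI)
  show "norm (cdual_apply G (cdual_ract (*) f x)) \<le> (norm G * norm f) * norm x" for x :: 'a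
    by (rule norm_arens_act_aux)
qed (simp_all add: cdual_ract_mult_simps cdual_apply_arg scaleC_complex_def)

lemma norm_arens_act: "norm (arens_act G f) \<le> norm G * norm f"
  by (rule norm_cdual_bound) (simp_all add: arens_act_apply norm_arens_act_aux)

lemma norm_arens_mult_aux:
  "cmod (cdual_apply F (arens_act G f)) \<le> norm F * norm G * norm f"
  using order.trans[OF norm_cdual_apply[of F "arens_act G f"]
      mult_left_mono[OF norm_arens_act[of G f]]]
  by (simp add: mult.assoc)

lemma arens_act_simps:
  "arens_act G (f + g) = arens_act G f + arens_act G g"
  "arens_act G (c *\<^sub>C f) = c *\<^sub>C arens_act G f"
  "arens_act (G + H) f = arens_act G f + arens_act H f"
  "arens_act (c *\<^sub>C G) f = c *\<^sub>C arens_act G f"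
  by (rule cdual_eqI; simp add: arens_act_apply cdual_ract_mult_simps cdual_apply_arg)+

lemma arens_mult_apply:
  "cdual_apply (arens_mult F G) f = cdual_apply F (arens_act G f)"
  unfolding arens_mult_def
proof (rule cdual_of_apply, rule bounded_clinearI)
  show "norm (cdual_apply F (arens_act G f)) \<le> (norm F * norm G) * norm f" for f
    by (rule norm_arens_mult_aux)
qed (simp_all add: arens_act_simps cdual_apply_arg scaleC_complex_def)

lemma cdual_ract_arens_act: "cdual_ract (*) (arens_act G f) a = arens_act G (cdual_ract (*) f a)"
  by (rule cdual_eqI) (simp add: cdual_ract_mult_apply arens_act_apply cdual_ract_mult_simps)

lemma arens_act_arens_mult: "arens_act (arens_mult F G) f = arens_act F (arens_act G f)"
  by (rule cdual_eqI) (simp add: arens_act_apply arens_mult_apply cdual_ract_arens_act)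

instantiation bidual :: (complex_normed_algebra) cbanach_algebra
begin
lift_definition times_bidual :: "'a bidual \<Rightarrow> 'a bidual \<Rightarrow> 'a bidual" is arens_mult .
instance
proof
  fix F G H :: "'a bidual" and c :: complex and r :: real
  have l: "c *\<^sub>C F * G = c *\<^sub>C (F * G)" for c and F G :: "'a bidual"
    by transfer (rule cdual_eqI, simp add: arens_mult_apply arens_act_simps)
  have r: "F * c *\<^sub>C G = c *\<^sub>C (F * G)" for c and F G :: "'a bidual"
    by transfer (rule cdual_eqI, simp add: arens_mult_apply arens_act_simps cdual_apply_arg)
  show "c *\<^sub>C F * G = c *\<^sub>C (F * G)" "F * c *\<^sub>C G = c *\<^sub>C (F * G)" by (rule l r)+
  show "r *\<^sub>R F * G = r *\<^sub>R (F * G)" "F * r *\<^sub>R G = r *\<^sub>R (F * G)"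
    by (simp_all add: scaleR_scaleC l r)
  show "F * G * H = F * (G * H)"
    by transfer (rule cdual_eqI, simp add: arens_mult_apply arens_act_arens_mult)
  show "(F + G) * H = F * H + G * H"
    by transfer (rule cdual_eqI, simp add: arens_mult_apply arens_act_simps)
  show "F * (G + H) = F * G + F * H"
    by transfer (rule cdual_eqI, simp add: arens_mult_apply arens_act_simps cdual_apply_arg)
  show "norm (F * G) \<le> norm F * norm G"
    by transfer (rule norm_cdual_bound, simp_all add: arens_mult_apply norm_arens_mult_aux)
qed
end

(* char_ext, with the second dual regarded as an algebra. *)
definition bidual_char :: "('a::cbanach_algebra \<Rightarrow> complex) \<Rightarrow> 'a bidual \<Rightarrow> complex" where
  "bidual_char \<psi> F = char_ext \<psi> (bidual_functional F)"

lemma bidual_char_in_characters: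
  assumes "\<psi> \<in> characters"
  shows "bidual_char \<psi> \<in> characters"
proof -
  note [simp] = cdual_of_apply[OF character_bounded[OF assms]]
  have mult: "\<psi> (a * b) = \<psi> a * \<psi> b" for a b using assms by (simp add: characters_def)
  have r: "cdual_ract (*) (cdual_of \<psi>) a = \<psi> a *\<^sub>C cdual_of \<psi>" for a
    by (rule cdual_eqI) (simp add: cdual_ract_mult_apply mult)
  have act: "arens_act G (cdual_of \<psi>) = cdual_apply G (cdual_of \<psi>) *\<^sub>C cdual_of \<psi>" for G
    by (rule cdual_eqI) (simp add: arens_act_apply r cdual_apply_arg)
  have "bidual_char \<psi> (F * G) = bidual_char \<psi> F * bidual_char \<psi> G" for F G
    unfolding bidual_char_def char_ext_def
    by (simp add: times_bidual.rep_eq arens_mult_apply act cdual_apply_arg)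
  moreover have "clinear (bidual_char \<psi>)"
    by (simp add: clinear_def bidual_char_def char_ext_def plus_bidual.rep_eq scaleC_bidual.rep_eq
        scaleC_complex_def)
  moreover obtain a where "\<psi> a \<noteq> 0" using assms by (auto simp: characters_def fun_eq_iff)
  then have "bidual_char \<psi> (Bidual (canonical a)) \<noteq> 0"
    using char_ext_canonical[OF assms] by (simp add: bidual_char_def Bidual_inverse)
  ultimately show ?thesis by (auto simp: characters_def fun_eq_iff)
qed

typedef 's ell1 = "{f :: 's \<Rightarrow> complex. f abs_summable_on UNIV}"
  by (rule exI[of _ "\<lambda>_. 0"]) simp

setup_lifting type_definition_ell1

lift_definition ell1_apply :: "'s ell1 \<Rightarrow> 's \<Rightarrow> complex" is "\<lambda>f. f" .

lemma ell1_eqI: "(\<And>x. ell1_apply f x = ell1_apply g x) \<Longrightarrow> f = g"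
  by transfer auto

lemma ell1_abs_summable: "ell1_apply f abs_summable_on UNIV"
  by transfer

lemma abs_summable_add:
  fixes f g :: "'s \<Rightarrow> complex"
  assumes "f abs_summable_on A" "g abs_summable_on A"
  shows "(\<lambda>x. f x + g x) abs_summable_on A"
  by (rule abs_summable_on_comparison_test'[OF summable_on_add[OF assms]]) (rule norm_triangle_ineq)

lemma abs_summable_cmult:
  fixes f :: "'s \<Rightarrow> complex"
  assumes "f abs_summable_on A"
  shows "(\<lambda>x. c * f x) abs_summable_on A"
  using summable_on_cmult_right[OF assms, of "cmod c"] by (simp add: norm_mult)

lemma convolution_fibres:
  fixes h :: "'s::times \<times> 's \<Rightarrow> complex"
  assumes "h abs_summable_on UNIV"
  shows "h abs_summable_on {p. fst p * snd p = s}"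
    and "(\<lambda>s. infsum h {p. fst p * snd p = s}) abs_summable_on UNIV"
    and "infsum (\<lambda>s. norm (infsum h {p. fst p * snd p = s})) UNIV \<le> infsum (\<lambda>p. norm (h p)) UNIV"
proof -
  let ?F = "\<lambda>s. {p :: 's \<times> 's. fst p * snd p = s}"
  show 1: "h abs_summable_on ?F s" for s
    by (rule summable_on_subset_banach[OF assms]) simp
  have re: "bij_betw snd (Sigma UNIV ?F) UNIV"
    by (rule bij_betwI[where g = "\<lambda>p. (fst p * snd p, p)"]) auto
  have S: "(\<lambda>x. h (snd x)) abs_summable_on Sigma UNIV ?F"
    using summable_on_reindex_bij_betw[OF re, of "\<lambda>p. norm (h p)"] assms by simp
  then have "(\<lambda>s. infsum (\<lambda>p. norm (h p)) (?F s)) abs_summable_on UNIV"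
    unfolding abs_summable_on_Sigma_iff snd_conv by (rule conjunct2)
  then have T: "(\<lambda>s. infsum (\<lambda>p. norm (h p)) (?F s)) summable_on UNIV"
    by (rule abs_summable_summable)
  have le: "norm (infsum h (?F s)) \<le> infsum (\<lambda>p. norm (h p)) (?F s)" for s
    by (rule norm_infsum_bound[OF 1])
  show 2: "(\<lambda>s. infsum h (?F s)) abs_summable_on UNIV"
    by (rule abs_summable_on_comparison_test'[OF T le])
  have "infsum (\<lambda>s. norm (infsum h (?F s))) UNIV \<le> infsum (\<lambda>s. infsum (\<lambda>p. norm (h p)) (?F s)) UNIV"
    by (rule infsum_mono[OF 2 T le])
  also have "\<dots> = infsum (\<lambda>(s,p). norm (h p)) (Sigma UNIV ?F)"
    by (rule infsum_Sigma'_banach) (use S in \<open>simp add: case_prod_unfold\<close>)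
  also have "\<dots> = infsum (\<lambda>p. norm (h p)) UNIV"
    using infsum_reindex_bij_betw[OF re, of "\<lambda>p. norm (h p)"] by (simp add: case_prod_unfold)
  finally show "infsum (\<lambda>s. norm (infsum h (?F s))) UNIV \<le> infsum (\<lambda>p. norm (h p)) UNIV" .
qed

lemma abs_summable_product:
  fixes f :: "'s \<Rightarrow> complex" and g :: "'t \<Rightarrow> complex"
  assumes f: "f abs_summable_on UNIV" and g: "g abs_summable_on UNIV"
  shows "(\<lambda>p. f (fst p) * g (snd p)) abs_summable_on UNIV"
    and "infsum (\<lambda>p. norm (f (fst p) * g (snd p))) UNIV
      = infsum (\<lambda>x. norm (f x)) UNIV * infsum (\<lambda>x. norm (g x)) UNIV"
proof -
  have "(\<lambda>p. f (fst p) * g (snd p)) abs_summable_on Sigma UNIV (\<lambda>_. UNIV)"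
    unfolding abs_summable_on_Sigma_iff
    using abs_summable_cmult[OF g] summable_on_cmult_left[OF f, of "infsum (\<lambda>x. norm (g x)) UNIV"]
    by (simp add: norm_mult infsum_cmult_right' infsum_nonneg)
  then show 1: "(\<lambda>p. f (fst p) * g (snd p)) abs_summable_on UNIV" by simp
  have "infsum (\<lambda>(x,y). norm (f x * g y)) (Sigma UNIV (\<lambda>_. UNIV))
      = infsum (\<lambda>x. infsum (\<lambda>y. norm (f x * g y)) UNIV) UNIV"
    by (rule infsum_Sigma'_banach[symmetric]) (use 1 in \<open>simp add: case_prod_unfold\<close>)
  also have "\<dots> = infsum (\<lambda>x. norm (f x)) UNIV * infsum (\<lambda>x. norm (g x)) UNIV"
    by (simp add: norm_mult infsum_cmult_right' infsum_cmult_left')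
  finally show "infsum (\<lambda>p. norm (f (fst p) * g (snd p))) UNIV
      = infsum (\<lambda>x. norm (f x)) UNIV * infsum (\<lambda>x. norm (g x)) UNIV" by (simp add: case_prod_unfold)
qed

instantiation ell1 :: (type) complex_normed_vector
begin
lift_definition zero_ell1 :: "'a ell1" is "\<lambda>_. 0" by simp
lift_definition plus_ell1 :: "'a ell1 \<Rightarrow> 'a ell1 \<Rightarrow> 'a ell1" is "\<lambda>f g x. f x + g x"
  by (rule abs_summable_add)
lift_definition uminus_ell1 :: "'a ell1 \<Rightarrow> 'a ell1" is "\<lambda>f x. - f x" by simp
lift_definition minus_ell1 :: "'a ell1 \<Rightarrow> 'a ell1 \<Rightarrow> 'a ell1" is "\<lambda>f g x. f x - g x"
  subgoal for f g using abs_summable_add[of f UNIV "\<lambda>x. - g x"] by simp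
  done
lift_definition scaleC_ell1 :: "complex \<Rightarrow> 'a ell1 \<Rightarrow> 'a ell1" is "\<lambda>c f x. c * f x"
  by (rule abs_summable_cmult)
lift_definition scaleR_ell1 :: "real \<Rightarrow> 'a ell1 \<Rightarrow> 'a ell1" is "\<lambda>r f x. complex_of_real r * f x"
  by (rule abs_summable_cmult)
lift_definition norm_ell1 :: "'a ell1 \<Rightarrow> real" is "\<lambda>f. \<Sum>\<^sub>\<infinity>x. cmod (f x)" .
definition "dist_ell1 f g = norm (f - g :: 'a ell1)"
definition "sgn_ell1 f = scaleR (inverse (norm f)) (f :: 'a ell1)"
definition uniformity_ell1 :: "('a ell1 \<times> 'a ell1) filter" where
  "uniformity_ell1 = (INF e\<in>{0 <..}. principal {(x, y). dist x y < e})"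
definition open_ell1 :: "'a ell1 set \<Rightarrow> bool" where
  "open_ell1 S = (\<forall>x\<in>S. \<forall>\<^sub>F (x', y) in uniformity. x' = x \<longrightarrow> y \<in> S)"

lemma ell1_apply_simps [simp]:
  "ell1_apply 0 x = 0" "ell1_apply (f + g) x = ell1_apply f x + ell1_apply g x"
  "ell1_apply (f - g) x = ell1_apply f x - ell1_apply g x"
  "ell1_apply (- f) x = - ell1_apply f x"
  "ell1_apply (c *\<^sub>C f) x = c * ell1_apply f x"
  "ell1_apply (r *\<^sub>R f) x = complex_of_real r * ell1_apply f x"
  by (transfer; simp)+

lemma norm_ell1_eq: "norm f = infsum (\<lambda>x. cmod (ell1_apply f x)) UNIV"
  by transfer simp

lemma norm_ell1_apply: "cmod (ell1_apply f x) \<le> norm f"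
proof -
  have "infsum (\<lambda>x. cmod (ell1_apply f x)) {x} \<le> infsum (\<lambda>x. cmod (ell1_apply f x)) UNIV"
    by (rule infsum_mono_neutral) (use ell1_abs_summable[of f] in auto)
  then show ?thesis by (simp add: norm_ell1_eq)
qed

lemma norm_ell1_finite_sum:
  assumes "finite F" shows "(\<Sum>x\<in>F. cmod (ell1_apply f x)) \<le> norm f"
  unfolding norm_ell1_eq
  by (rule finite_sum_le_infsum[OF ell1_abs_summable assms]) auto

instance
proof
  fix f g :: "'a ell1" and c :: complex
  have sc: "norm (c *\<^sub>C f) = cmod c * norm f" for c and f :: "'a ell1"
    by (simp add: norm_ell1_eq norm_mult infsum_cmult_right')
  have rc: "r *\<^sub>R f = complex_of_real r *\<^sub>C f" for r and f :: "'a ell1"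
    by (rule ell1_eqI) simp
  show "norm (c *\<^sub>C f) = cmod c * norm f" by (rule sc)
  show "norm (r *\<^sub>R f) = \<bar>r\<bar> * norm f" for r by (simp add: rc sc)
  show "norm f = 0 \<longleftrightarrow> f = 0"
  proof
    assume "norm f = 0"
    then show "f = 0" using norm_ell1_apply[of f] by (intro ell1_eqI) simp
  qed (simp add: norm_ell1_eq)
  have "norm (f + g) \<le> (\<Sum>\<^sub>\<infinity>x. cmod (ell1_apply f x) + cmod (ell1_apply g x))"
    unfolding norm_ell1_eq ell1_apply_simps
    by (intro infsum_mono summable_on_add ell1_abs_summable abs_summable_add norm_triangle_ineq)
  also have "\<dots> = norm f + norm g"
    unfolding norm_ell1_eq by (intro infsum_add ell1_abs_summable)
  finally show "norm (f + g) \<le> norm f + norm g" .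
  show "open S = (\<forall>x\<in>S. \<forall>\<^sub>F (x', y) in uniformity. x' = x \<longrightarrow> y \<in> S)" for S :: "'a ell1 set"
    by (rule open_ell1_def)
qed (simp_all add: dist_ell1_def sgn_ell1_def uniformity_ell1_def,
    (rule ell1_eqI; simp add: algebra_simps)+)
end


lemma ell1_of_bounded_sums:
  assumes "\<And>F. finite F \<Longrightarrow> (\<Sum>x\<in>F. cmod (h x)) \<le> K"
  obtains f where "ell1_apply f = h" "norm f \<le> K"
proof
  have h: "h abs_summable_on UNIV"
    by (rule nonneg_bdd_above_summable_on) (auto intro!: bdd_aboveI2 assms)
  show "ell1_apply (Abs_ell1 h) = h"
    using h by (simp add: ell1_apply.rep_eq Abs_ell1_inverse)
  then show "norm (Abs_ell1 h) \<le> K"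
    by (simp add: norm_ell1_eq) (rule infsum_le_finite_sums[OF h], simp add: assms)
qed

instance ell1 :: (type) cbanach
proof
  fix X :: "nat \<Rightarrow> 'a ell1"
  assume X: "Cauchy X"
  have "Cauchy (\<lambda>n. ell1_apply (X n) x)" for x
  proof (rule CauchyI)
    fix e :: real assume "e > 0"
    then obtain M where M: "\<And>m n. m \<ge> M \<Longrightarrow> n \<ge> M \<Longrightarrow> norm (X m - X n) < e"
      using CauchyD[OF X] by blast
    show "\<exists>M. \<forall>m\<ge>M. \<forall>n\<ge>M. norm (ell1_apply (X m) x - ell1_apply (X n) x) < e"
    proof (intro exI[of _ M] allI impI)
      fix m n assume "M \<le> m" "M \<le> n"
      then show "norm (ell1_apply (X m) x - ell1_apply (X n) x) < e"
        using M[of m n] norm_ell1_apply[of "X m - X n" x] by simp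
    qed
  qed
  then have "\<exists>l. (\<lambda>n. ell1_apply (X n) x) \<longlonglongrightarrow> l" for x
    using Cauchy_convergent convergent_def by blast
  then obtain h where h: "\<And>x. (\<lambda>n. ell1_apply (X n) x) \<longlonglongrightarrow> h x" by metis
  have key: "(\<Sum>x\<in>F. cmod (h x - ell1_apply (X n) x)) \<le> e"
    if M: "\<And>m n. m \<ge> M \<Longrightarrow> n \<ge> M \<Longrightarrow> norm (X m - X n) < e" and F: "finite F" and n: "n \<ge> M" for e M n F
  proof (rule LIMSEQ_le_const2)
    show "(\<lambda>m. \<Sum>x\<in>F. cmod (ell1_apply (X m) x - ell1_apply (X n) x)) \<longlonglongrightarrow> (\<Sum>x\<in>F. cmod (h x - ell1_apply (X n) x))"
      by (intro tendsto_intros h)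
    show "\<exists>N. \<forall>m\<ge>N. (\<Sum>x\<in>F. cmod (ell1_apply (X m) x - ell1_apply (X n) x)) \<le> e"
    proof (intro exI[of _ M] allI impI)
      fix m assume "M \<le> m"
      show "(\<Sum>x\<in>F. cmod (ell1_apply (X m) x - ell1_apply (X n) x)) \<le> e"
        using norm_ell1_finite_sum[OF F, of "X m - X n"] M[OF \<open>M \<le> m\<close> n] by simp
    qed
  qed
  obtain M1 where M1: "\<And>m n. m \<ge> M1 \<Longrightarrow> n \<ge> M1 \<Longrightarrow> norm (X m - X n) < 1"
    using CauchyD[OF X, of 1] by auto
  obtain d where d: "ell1_apply d = (\<lambda>x. h x - ell1_apply (X M1) x)"
    by (rule ell1_of_bounded_sums[of "\<lambda>x. h x - ell1_apply (X M1) x" 1, OF key[OF M1 _ order_refl]])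
  define L where "L = d + X M1"
  have L: "ell1_apply L x = h x" for x by (simp add: L_def d)
  have "X \<longlonglongrightarrow> L"
  proof (rule LIMSEQ_I)
    fix e :: real assume "e > 0"
    then obtain M where M: "\<And>m n. m \<ge> M \<Longrightarrow> n \<ge> M \<Longrightarrow> norm (X m - X n) < e / 2"
      using CauchyD[OF X, of "e / 2"] by auto
    have "norm (X n - L) < e" if n: "n \<ge> M" for n
    proof -
      obtain f where f: "ell1_apply f = (\<lambda>x. h x - ell1_apply (X n) x)" "norm f \<le> e / 2"
        by (rule ell1_of_bounded_sums[of "\<lambda>x. h x - ell1_apply (X n) x" "e / 2", OF key[OF M _ n]])
      have "f = L - X n" by (rule ell1_eqI) (simp add: f L)
      with f \<open>e > 0\<close> show ?thesis by (simp add: norm_minus_commute)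
    qed
    then show "\<exists>M. \<forall>n\<ge>M. norm (X n - L) < e" by blast
  qed
  then show "convergent X" by (auto simp: convergent_def)
qed

instantiation ell1 :: (semigroup_mult) cbanach_algebra
begin

lift_definition times_ell1 :: "'a ell1 \<Rightarrow> 'a ell1 \<Rightarrow> 'a ell1"
  is "\<lambda>f g s. \<Sum>\<^sub>\<infinity>(t, u) \<in> {(t, u). t * u = s}. f t * g u"
  subgoal for f g
    using convolution_fibres(2)[OF abs_summable_product(1)[of f g]] by (simp add: case_prod_unfold)
  done

lemma ell1_apply_times:
  "ell1_apply (f * g) s = (\<Sum>\<^sub>\<infinity>p \<in> {p. fst p * snd p = s}. ell1_apply f (fst p) * ell1_apply g (snd p))"
  by transfer (simp add: case_prod_unfold)

lemma ell1_times_summable: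
  "(\<lambda>p. ell1_apply f (fst p) * ell1_apply g (snd p)) summable_on {p. fst p * snd p = (s :: 'a)}"
  by (rule abs_summable_summable)
    (rule convolution_fibres(1)[OF abs_summable_product(1)[OF ell1_abs_summable ell1_abs_summable]])

lemma ell1_times_assoc_aux:
  fixes f g h :: "'a ell1"
  shows "ell1_apply (f * g * h) s = (\<Sum>\<^sub>\<infinity>(a, b, c) \<in> {(a, b, c). a * b * c = s}.
      ell1_apply f a * ell1_apply g b * ell1_apply h c)" (is ?A)
    and "ell1_apply (f * (g * h)) s = (\<Sum>\<^sub>\<infinity>(a, b, c) \<in> {(a, b, c). a * b * c = s}.
      ell1_apply f a * ell1_apply g b * ell1_apply h c)" (is ?B)
proof -
  let ?F = "\<lambda>s. {p :: 'a \<times> 'a. fst p * snd p = s}"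
  let ?T = "{(a, b, c). a * b * c = (s :: 'a)}"
  let ?k = "\<lambda>(a, b, c). ell1_apply f a * ell1_apply g b * ell1_apply h c"
  have "?k abs_summable_on UNIV"
    using abs_summable_product(1)[OF ell1_abs_summable[of f]
        abs_summable_product(1)[OF ell1_abs_summable[of g] ell1_abs_summable[of h]]]
    by (simp only: case_prod_unfold mult.assoc)
  then have "?k abs_summable_on ?T" by (rule summable_on_subset_banach) simp
  then have k: "?k summable_on ?T" by (rule abs_summable_summable)
  have "ell1_apply (f * g * h) s
      = (\<Sum>\<^sub>\<infinity>p\<in>?F s. \<Sum>\<^sub>\<infinity>q\<in>?F (fst p). ell1_apply f (fst q) * ell1_apply g (snd q) * ell1_apply h (snd p))"
    by (simp add: ell1_apply_times infsum_cmult_left')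
  also have "\<dots> = (\<Sum>\<^sub>\<infinity>(p, q)\<in>Sigma (?F s) (\<lambda>p. ?F (fst p)). 
      ell1_apply f (fst q) * ell1_apply g (snd q) * ell1_apply h (snd p))"
  proof (rule infsum_Sigma'_banach)
    show "(\<lambda>(p, q). ell1_apply f (fst q) * ell1_apply g (snd q) * ell1_apply h (snd p))
       summable_on Sigma (?F s) (\<lambda>p. ?F (fst p))"
      using k by (rule summable_on_reindex_bij_witness[THEN iffD2, rotated 5,
          where i1 = "\<lambda>(a, b, c). ((a * b, c), (a, b))" and j1 = "\<lambda>((t, c), (a, b)). (a, b, c)"]) auto
  qed
  also have "\<dots> = infsum ?k ?T"
    by (rule infsum_reindex_bij_witness[where i = "\<lambda>(a, b, c). ((a * b, c), (a, b))"
          and j = "\<lambda>((t, c), (a, b)). (a, b, c)"]) auto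
  finally show ?A .
  have "ell1_apply (f * (g * h)) s
      = (\<Sum>\<^sub>\<infinity>p\<in>?F s. \<Sum>\<^sub>\<infinity>q\<in>?F (snd p). ell1_apply f (fst p) * (ell1_apply g (fst q) * ell1_apply h (snd q)))"
    by (simp add: ell1_apply_times infsum_cmult_right')
  also have "\<dots> = (\<Sum>\<^sub>\<infinity>(p, q)\<in>Sigma (?F s) (\<lambda>p. ?F (snd p)). 
      ell1_apply f (fst p) * (ell1_apply g (fst q) * ell1_apply h (snd q)))"
  proof (rule infsum_Sigma'_banach)
    show "(\<lambda>(p, q). ell1_apply f (fst p) * (ell1_apply g (fst q) * ell1_apply h (snd q)))
       summable_on Sigma (?F s) (\<lambda>p. ?F (snd p))"
      using k by (rule summable_on_reindex_bij_witness[THEN iffD2, rotated 5,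
          where i1 = "\<lambda>(a, b, c). ((a, b * c), (b, c))" and j1 = "\<lambda>((a, t), (b, c)). (a, b, c)"])
        (auto simp: mult.assoc)
  qed
  also have "\<dots> = infsum ?k ?T"
    by (rule infsum_reindex_bij_witness[where i = "\<lambda>(a, b, c). ((a, b * c), (b, c))"
          and j = "\<lambda>((a, t), (b, c)). (a, b, c)"]) (auto simp: mult.assoc)
  finally show ?B .
qed

instance
proof
  fix f g h :: "'a ell1" and c :: complex
  show "f * g * h = f * (g * h)" by (rule ell1_eqI) (simp only: ell1_times_assoc_aux)
  show "(f + g) * h = f * h + g * h"
    by (rule ell1_eqI)
      (simp add: ell1_apply_times distrib_right infsum_add ell1_times_summable)
  show "f * (g + h) = f * g + f * h"
    by (rule ell1_eqI)
      (simp add: ell1_apply_times distrib_left infsum_add ell1_times_summable)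
  show l: "(c *\<^sub>C f) * g = c *\<^sub>C (f * g)" for c
    by (rule ell1_eqI) (simp add: ell1_apply_times mult.assoc infsum_cmult_right')
  show r: "f * (c *\<^sub>C g) = c *\<^sub>C (f * g)" for c
    by (rule ell1_eqI) (simp add: ell1_apply_times mult.left_commute infsum_cmult_right')
  show "(r *\<^sub>R f) * g = r *\<^sub>R (f * g)" "f * (r *\<^sub>R g) = r *\<^sub>R (f * g)" for r
    by (simp_all add: scaleR_scaleC l r)
  show "norm (f * g) \<le> norm f * norm g"
    using convolution_fibres(3)[OF abs_summable_product(1)[OF ell1_abs_summable[of f] ell1_abs_summable[of g]]]
    by (simp add: norm_ell1_eq ell1_apply_times abs_summable_product(2)[OF ell1_abs_summable ell1_abs_summable])
qed

end

class inverse_semigroup = semigroup_mult +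
  assumes ex1_generalized_inverse: "\<exists>!t. s * t * s = s \<and> t * s * t = t"
begin

definition star :: "'a \<Rightarrow> 'a" (\<open>_\<^sup>\<star>\<close> [1000] 999) where
  "s\<^sup>\<star> = (THE t. s * t * s = s \<and> t * s * t = t)"

definition natural_le :: "'a \<Rightarrow> 'a \<Rightarrow> bool" where
  "natural_le s t \<longleftrightarrow> s = s * s\<^sup>\<star> * t"

definition idempotents :: "'a set" where
  "idempotents = {e. e * e = e}"

definition uniformly_locally_finite :: "'a set \<Rightarrow> bool" where
  "uniformly_locally_finite T \<longleftrightarrow>
    (\<exists>N. \<forall>x\<in>T. finite {y \<in> T. natural_le y x} \<and> card {y \<in> T. natural_le y x} \<le> N)"

definition maximal_subgroup :: "'a \<Rightarrow> 'a monoid" where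
  "maximal_subgroup e = \<lparr>carrier = {s. s * s\<^sup>\<star> = e \<and> s\<^sup>\<star> * s = e}, mult = (*), one = e\<rparr>"

lemma star_props: "s * s\<^sup>\<star> * s = s" "s\<^sup>\<star> * s * s\<^sup>\<star> = s\<^sup>\<star>"
  using theI'[OF ex1_generalized_inverse[of s]] unfolding star_def by blast+

lemma star_unique: "s * t * s = s \<Longrightarrow> t * s * t = t \<Longrightarrow> s\<^sup>\<star> = t"
  using ex1_generalized_inverse[of s] star_props[of s] by blast

lemma star_star: "(s\<^sup>\<star>)\<^sup>\<star> = s"
  by (rule star_unique) (rule star_props)+

lemma star_idempotent: "e * e = e \<Longrightarrow> e\<^sup>\<star> = e"
  by (rule star_unique) simp_all

lemma group_maximal_subgroup:
  assumes "e \<in> idempotents"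
  shows "group (maximal_subgroup e)"
proof -
  have e: "e * e = e" using assms by (simp add: idempotents_def)
  let ?G = "{s. s * s\<^sup>\<star> = e \<and> s\<^sup>\<star> * s = e}"
  have G: "s * s\<^sup>\<star> = e" "s\<^sup>\<star> * s = e" if "s \<in> ?G" for s using that by simp_all
  have el: "e * s = s" if "s \<in> ?G" for s using star_props(1)[of s] G[OF that] by simp
  have le: "e * s\<^sup>\<star> = s\<^sup>\<star>" if "s \<in> ?G" for s using star_props(2)[of s] G[OF that] by simp
  have st: "s * t \<in> ?G" if s: "s \<in> ?G" and t: "t \<in> ?G" for s t
  proof -
    have "(s * t) * (t\<^sup>\<star> * s\<^sup>\<star>) = s * ((t * t\<^sup>\<star>) * s\<^sup>\<star>)" by (simp only: mult.assoc)
    then have 1: "(s * t) * (t\<^sup>\<star> * s\<^sup>\<star>) = e" using G[OF s] G[OF t] le[OF s] by simp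
    have "(t\<^sup>\<star> * s\<^sup>\<star>) * (s * t) = t\<^sup>\<star> * ((s\<^sup>\<star> * s) * t)" by (simp only: mult.assoc)
    then have 2: "(t\<^sup>\<star> * s\<^sup>\<star>) * (s * t) = e" using G[OF s] G[OF t] el[OF t] by simp
    have "(s * t)\<^sup>\<star> = t\<^sup>\<star> * s\<^sup>\<star>"
    proof (rule star_unique)
      show "(s * t) * (t\<^sup>\<star> * s\<^sup>\<star>) * (s * t) = s * t"
        unfolding 1 using el[OF s] by (simp flip: mult.assoc)
      show "(t\<^sup>\<star> * s\<^sup>\<star>) * (s * t) * (t\<^sup>\<star> * s\<^sup>\<star>) = t\<^sup>\<star> * s\<^sup>\<star>"
        unfolding 2 using le[OF t] by (simp flip: mult.assoc)
    qed
    then show ?thesis using 1 2 by simp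
  qed
  have "e \<in> ?G" using e by (simp add: star_idempotent)
  moreover have "s\<^sup>\<star> \<in> ?G" if "s \<in> ?G" for s
    using that by (simp add: star_star)
  moreover have "carrier (maximal_subgroup e) = ?G" "\<one>\<^bsub>maximal_subgroup e\<^esub> = e"
    "x \<otimes>\<^bsub>maximal_subgroup e\<^esub> y = x * y" for x y
    by (simp_all add: maximal_subgroup_def)
  ultimately show ?thesis
    by (intro groupI) (simp_all only: st el mult.assoc, use G in blast)
qed

end

class clifford_semigroup = inverse_semigroup +
  assumes star_commute: "s * s\<^sup>\<star> = s\<^sup>\<star> * s"

lemma clifford_union:
  "(\<Union>e\<in>idempotents. carrier (maximal_subgroup e)) = (UNIV :: 's::clifford_semigroup set)"
proof -
  have "s * s\<^sup>\<star> \<in> idempotents" for s :: 's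
    by (metis (mono_tags, lifting) idempotents_def mem_Collect_eq mult.assoc star_props(1))
  then show ?thesis by (auto simp: maximal_subgroup_def star_commute)
qed

(* A left invariant mean on the bounded real functions on G. HOL functions are total, so m takes
   functions on the whole type; by linearity and positivity its value on L depends only on the
   restriction to the carrier. *)
definition left_invariant_mean :: "('g, 'r) monoid_scheme \<Rightarrow> (('g \<Rightarrow> real) \<Rightarrow> real) \<Rightarrow> bool" where
  "left_invariant_mean G m \<longleftrightarrow>
    (let L = {f. bounded (f ` carrier G)} in
      (\<forall>f\<in>L. \<forall>h\<in>L. m (\<lambda>x. f x + h x) = m f + m h) \<and>
      (\<forall>c. \<forall>f\<in>L. m (\<lambda>x. c * f x) = c * m f) \<and>
      (\<forall>f\<in>L. (\<forall>x\<in>carrier G. 0 \<le> f x) \<longrightarrow> 0 \<le> m f) \<and>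
      m (\<lambda>_. 1) = 1 \<and>
      (\<forall>g\<in>carrier G. \<forall>f\<in>L. m (\<lambda>x. f (g \<otimes>\<^bsub>G\<^esub> x)) = m f))"

definition amenable_group :: "('g, 'r) monoid_scheme \<Rightarrow> bool" where
  "amenable_group G \<longleftrightarrow> group G \<and> (\<exists>m. left_invariant_mean G m)"

end

theory Submission
  imports Defs
begin

text \<open>
  Idempotents of a Clifford semigroup are central, and every character \<open>\<phi>\<close> of \<open>\<ell>\<^sup>1(S)\<close> takes the
  value \<open>1\<close> at \<open>\<delta>\<^sub>e\<close> for some idempotent \<open>e\<close>. Evaluating a splitting map \<open>\<rho>\<close> at this central element
  \<open>p = \<delta>\<^sub>e\<close> turns left \<open>\<phi>\<close>-biflatness into the existence of a functional \<open>m\<close> on the dual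
  with \<open>m(f \<cdot> a) = \<phi>(a) m(f)\<close> and \<open>m(\<phi>) = 1\<close> (\<open>left_biflat_iff_left_char_amenable\<close>). This
  condition passes between a Banach algebra and its second dual in both directions
  (\<open>left_char_amenable_bidual_iff\<close>), and \<open>p\<close> stays central in the second dual, so that the first two
  conditions are equivalent. Biflatness yields such an \<open>m\<close> in the same way
  (\<open>biflat_imp_left_char_amenable\<close>).

  For an idempotent \<open>e\<close>, the indicator function of \<open>{s. e \<le> s s\<^sup>\<star>}\<close> is multiplicative
  and defines a character. Pulling bounded functions on \<open>G\<^sub>e\<close> back along \<open>s \<mapsto> s e\<close> and applying the
  functional \<open>m\<close> of this character gives a bounded left invariant functional on \<open>\<ell>\<^sup>\<infinity>(G\<^sub>e)\<close> with value
  \<open>1\<close> at \<open>1\<close>; its normalized positive part is an invariant mean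
  (\<open>left_char_amenable_imp_amenable_subgroup\<close>).

  Conversely, let all \<open>G\<^sub>e\<close> be amenable. By Moebius inversion over the semilattice of idempotents,
  \<open>\<delta>\<^sub>e\<close> is the sum of orthogonal central idempotents \<open>p\<^sub>f\<close> with \<open>f \<le> e\<close>, which decompose \<open>\<ell>\<^sup>1(S)\<close>
  into copies of the algebras \<open>\<ell>\<^sup>1(G\<^sub>f)\<close>. Averaging \<open>p\<^sub>f g \<otimes> g\<inverse> p\<^sub>f\<close> over \<open>G\<^sub>f\<close> gives a
  virtual diagonal of each copy (\<open>virtual_diagonal_of_subgroup\<close>), and these fit together to a
  splitting map of \<open>\<ell>\<^sup>1(S)\<close>. It is bounded because uniform local finiteness bounds the number of
  \<open>f \<le> e\<close> and with it the norm of \<open>p\<^sub>f\<close> (\<open>amenable_subgroups_imp_biflat\<close>).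
\<close>

section \<open>Functionals on projective tensor products\<close>

lemma bounded_clinearD:
  assumes "bounded_clinear T"
  shows "T (x + y) = T x + T y" "T (c *\<^sub>C x) = c *\<^sub>C T x" "T 0 = 0" "T (x - y) = T x - T y"
    "T (sum h I) = (\<Sum>i\<in>I. T (h i))"
proof -
  interpret bounded_linear T by (rule bounded_clinear_imp_linear[OF assms])
  show "T (x + y) = T x + T y" "T 0 = 0" "T (x - y) = T x - T y" "T (sum h I) = (\<Sum>i\<in>I. T (h i))"
    by (rule add zero diff sum)+
  show "T (c *\<^sub>C x) = c *\<^sub>C T x" using assms by (simp add: bounded_clinear_def clinear_def)
qed

lemmas cdual_apply_linear = bounded_clinearD[OF bounded_clinear_cdual_apply]

lemma bounded_clinear_scaleC: "bounded_clinear ((*\<^sub>C) c :: 'a::complex_normed_vector \<Rightarrow> 'a)"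
  by (rule bounded_clinearI[where K = "cmod c"]) (simp_all add: scaleC_add_right mult.commute)

lemma bounded_clinear_scaleC_left:
  "bounded_clinear (\<lambda>c. c *\<^sub>C (x :: 'a::complex_normed_vector))"
  by (rule bounded_clinearI[where K = "norm x"])
    (simp_all add: scaleC_add_left scaleC_complex_def mult.commute)

lemma bounded_clinear_zero: "bounded_clinear (\<lambda>_. 0)"
  by (rule bounded_clinearI[where K = 0]) simp_all

lemma bounded_cbilinear_of_map:
  assumes "bounded_clinear T"
  shows "bounded_cbilinear (\<lambda>x y. T (elem_tensor x y))"
proof -
  note E = bounded_cbilinear_elem_tensor
  obtain K where K: "\<And>x. norm (T x) \<le> K * norm x"
    using assms unfolding bounded_clinear_def by blast
  obtain C where C: "\<And>x y. norm (elem_tensor x y :: ('a, 'b) ptensor) \<le> C * norm x * norm y"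
    using E unfolding bounded_cbilinear_def by blast
  have "norm (T (elem_tensor x y)) \<le> (\<bar>K\<bar> * C) * norm x * norm y" for x y
  proof -
    have "norm (T (elem_tensor x y)) \<le> \<bar>K\<bar> * norm (elem_tensor x y)"
      by (meson K abs_ge_self mult_right_mono norm_ge_zero order.trans)
    also have "\<dots> \<le> \<bar>K\<bar> * (C * norm x * norm y)" by (rule mult_left_mono[OF C]) simp
    finally show ?thesis by (simp add: mult.assoc)
  qed
  then show ?thesis
    unfolding bounded_cbilinear_def clinear_def
    by (auto simp: bounded_cbilinearD[OF E] bounded_clinearD[OF assms])
qed

lemma ptensor_map_eqI:
  fixes S T :: "('a::complex_normed_vector, 'b::complex_normed_vector) ptensor \<Rightarrow> 'c::cbanach"
  assumes "bounded_clinear S" "bounded_clinear T"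
    and "\<And>x y. S (elem_tensor x y) = T (elem_tensor x y)"
  shows "S = T"
  using ptensor_lift_ex1[OF bounded_cbilinear_of_map[OF assms(2)]] assms by auto

lemma ptensor_cdual_eqI:
  assumes "\<And>x y. cdual_apply S (elem_tensor x y) = cdual_apply T (elem_tensor x y)"
  shows "S = T"
  using ptensor_map_eqI[OF bounded_clinear_cdual_apply[of S] bounded_clinear_cdual_apply[of T] assms]
  by (intro cdual_eqI) (simp add: fun_eq_iff)

lemma norm_elem_tensor: "norm (elem_tensor x y) \<le> norm x * norm y"
  using seminorm_tensor_le[of "[(x, y)]" "tensor_of x y"]
  by (simp add: elem_tensor_def norm_completion_of tensor_cost_def tensor_of.abs_eq)

text \<open>The projective norm is the largest one with \<open>\<parallel>x \<otimes> y\<parallel> \<le> \<parallel>x\<parallel> \<parallel>y\<parallel>\<close>, so a bound on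
  elementary tensors is a bound on the whole tensor product with the same constant. This makes
  the module actions depend boundedly on the algebra element.\<close>

lemma norm_ptensor_map_le:
  fixes T :: "('a::complex_normed_vector, 'b::complex_normed_vector) ptensor \<Rightarrow> 'c::cbanach"
  assumes T: "bounded_clinear T" and "0 \<le> K"
    and K: "\<And>x y. norm (T (elem_tensor x y)) \<le> K * (norm x * norm y)"
  shows "norm (T u) \<le> K * norm u"
proof -
  have c0: "completion_of (0 :: ('a, 'b) tensor) = 0"
    using norm_completion_of[of "0 :: ('a, 'b) tensor"] by simp
  have cost: "norm (T (completion_of (abs_tensor v))) \<le> K * tensor_cost v" for v
  proof (induct v)
    case Nil
    show ?case using c0 by (simp add: zero_tensor_def tensor_cost_def bounded_clinearD[OF T])
  next
    case (Cons p v)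
    have "abs_tensor (p # v) = tensor_of (fst p) (snd p) + abs_tensor v"
      by (simp add: tensor_of.abs_eq plus_tensor.abs_eq)
    then have "T (completion_of (abs_tensor (p # v)))
        = T (elem_tensor (fst p) (snd p)) + T (completion_of (abs_tensor v))"
      by (simp add: completion_of_add bounded_clinearD[OF T] elem_tensor_def)
    then show ?case
      using norm_triangle_ineq[of "T (elem_tensor (fst p) (snd p))" "T (completion_of (abs_tensor v))"]
        K[of "fst p" "snd p"] Cons
      by (simp add: tensor_cost_def case_prod_unfold distrib_left)
  qed
  have le: "norm (T (completion_of t)) \<le> K * norm (completion_of t)" for t
  proof (cases "K = 0")
    case True
    have "norm (T (completion_of t)) \<le> 0"
      by (induct t rule: tensor.abs_induct) (use cost True in simp)
    then show ?thesis using True by simp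
  next
    case False
    then have "K > 0" using \<open>0 \<le> K\<close> by simp
    have "norm (T (completion_of t)) / K \<le> seminorm t"
    proof (rule seminorm_tensor_greatest)
      fix v assume "abs_tensor v = t"
      then show "norm (T (completion_of t)) / K \<le> tensor_cost v"
        using cost[of v] \<open>K > 0\<close> by (simp add: field_simps)
    qed
    then show ?thesis using \<open>K > 0\<close> by (simp add: field_simps norm_completion_of)
  qed
  obtain X where X: "seminorm_Cauchy X" "u = abs_completion X" by (rule completion_cases)
  have lim: "(\<lambda>n. completion_of (X n)) \<longlonglongrightarrow> u" using completion_of_tendsto X by simp
  have limT: "(\<lambda>n. T (completion_of (X n))) \<longlonglongrightarrow> T u"
    by (rule bounded_linear.tendsto[OF bounded_clinear_imp_linear[OF T] lim])
  show ?thesis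
    by (rule LIMSEQ_le[OF tendsto_norm[OF limT] tendsto_mult[OF tendsto_const tendsto_norm[OF lim]]])
      (simp add: le)
qed

definition dual_tensor ::
    "'a::complex_normed_vector cdual \<Rightarrow> 'b::complex_normed_vector cdual \<Rightarrow> ('a, 'b) ptensor cdual" where
  "dual_tensor f g = cdual_of (ptensor_lift (\<lambda>x y. cdual_apply f x * cdual_apply g y))"

lemma dual_tensor_elem [simp]:
  "cdual_apply (dual_tensor f g) (elem_tensor x y) = cdual_apply f x * cdual_apply g y"
proof -
  have B: "bounded_cbilinear (\<lambda>x y. cdual_apply f x * cdual_apply g y)"
    by (rule bounded_cbilinear_compose[OF bounded_cbilinear_mult bounded_clinear_cdual_apply
          bounded_clinear_cdual_apply])
  show ?thesis
    unfolding dual_tensor_def by (simp add: cdual_of_apply ptensor_lift[OF B])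
qed

lemma norm_cdual_ptensor_le:
  assumes "0 \<le> K" "\<And>x y. cmod (cdual_apply T (elem_tensor x y)) \<le> K * (norm x * norm y)"
  shows "norm T \<le> K"
  by (rule norm_cdual_bound[OF assms(1)])
    (rule norm_ptensor_map_le[OF bounded_clinear_cdual_apply assms])

lemma bounded_clinear_dual_tensor: "bounded_clinear (\<lambda>f. dual_tensor f g)"
proof (rule bounded_clinearI[where K = "norm g"])
  show "norm (dual_tensor f g) \<le> norm g * norm f" for f :: "'a cdual"
  proof (rule norm_cdual_ptensor_le)
    fix x y
    show "cmod (cdual_apply (dual_tensor f g) (elem_tensor x y))
        \<le> norm g * norm f * (norm x * norm y)"
      using mult_mono[OF norm_cdual_apply[of f x] norm_cdual_apply[of g y]]
      by (simp add: norm_mult mult_ac)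
  qed simp
qed (rule ptensor_cdual_eqI; simp add: distrib_right)+

definition tensor_slice ::
    "('a::complex_normed_vector, 'b::complex_normed_vector) ptensor cdual \<Rightarrow> 'b \<Rightarrow> 'a cdual" where
  "tensor_slice T y = cdual_of (\<lambda>x. cdual_apply T (elem_tensor x y))"

lemma bounded_clinear_elem_tensor_left: "bounded_clinear (\<lambda>x. elem_tensor x y)"
  by (rule bounded_clinearI[where K = "norm y"])
    (simp_all add: bounded_cbilinearD[OF bounded_cbilinear_elem_tensor]
      norm_elem_tensor mult.commute[of "norm y"])

lemma tensor_slice_apply [simp]:
  "cdual_apply (tensor_slice T y) x = cdual_apply T (elem_tensor x y)"
  unfolding tensor_slice_def
  by (intro cdual_of_apply bounded_clinear_compose[OF bounded_clinear_cdual_apply]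
      bounded_clinear_elem_tensor_left)

lemma bounded_clinear_tensor_slice:
  "bounded_clinear (\<lambda>T :: ('a::complex_normed_vector, 'b::complex_normed_vector) ptensor cdual. tensor_slice T y)"
proof (rule bounded_clinearI[where K = "norm y"])
  fix T :: "('a, 'b) ptensor cdual"
  show "norm (tensor_slice T y) \<le> norm y * norm T"
  proof (rule norm_cdual_bound)
    fix x
    have "cmod (cdual_apply T (elem_tensor x y)) \<le> norm T * (norm x * norm y)"
      by (rule order.trans[OF norm_cdual_apply mult_left_mono[OF norm_elem_tensor]]) simp
    then show "cmod (cdual_apply (tensor_slice T y) x) \<le> norm y * norm T * norm x"
      by (simp add: mult_ac)
  qed simp
qed (rule cdual_eqI; simp)+

section \<open>The module structure on the second dual of the projective tensor square\<close>

abbreviation tensor_lact ::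
    "'a::cbanach_algebra \<Rightarrow> ('a, 'a) ptensor cdual cdual \<Rightarrow> ('a, 'a) ptensor cdual cdual" where
  "tensor_lact \<equiv> cdual_lact (cdual_ract ptensor_lact)"

abbreviation tensor_ract ::
    "('a, 'a) ptensor cdual cdual \<Rightarrow> 'a::cbanach_algebra \<Rightarrow> ('a, 'a) ptensor cdual cdual" where
  "tensor_ract \<equiv> cdual_ract (cdual_lact ptensor_ract)"

abbreviation tensor_bidual_mult ::
    "('a::cbanach_algebra, 'a) ptensor cdual cdual \<Rightarrow> 'a cdual cdual" where
  "tensor_bidual_mult \<equiv> cadjoint (cadjoint ptensor_mult)"

lemma ptensor_dual_ract_elem [simp]:
  "cdual_apply (cdual_ract ptensor_lact T a) (elem_tensor b c) = cdual_apply T (elem_tensor (a * b) c)"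
  by (simp add: cdual_ract_cadjoint cadjoint_apply ptensor_lact)

lemma ptensor_dual_lact_elem [simp]:
  "cdual_apply (cdual_lact ptensor_ract a T) (elem_tensor b c) = cdual_apply T (elem_tensor b (c * a))"
  by (simp add: cdual_lact_cadjoint cadjoint_apply ptensor_ract)

lemma ptensor_bidual_lact_apply:
  "cdual_apply (tensor_lact a M) T = cdual_apply M (cdual_ract ptensor_lact T a)"
  by (simp add: cdual_lact_cadjoint cdual_ract_cadjoint cadjoint_apply bounded_clinear_cadjoint
      ptensor_lact)

lemma ptensor_bidual_ract_apply:
  "cdual_apply (tensor_ract M a) T = cdual_apply M (cdual_lact ptensor_ract a T)"
  by (simp add: cdual_lact_cadjoint cdual_ract_cadjoint cadjoint_apply bounded_clinear_cadjoint
      ptensor_ract)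

lemma bidual_ptensor_mult_apply:
  "cdual_apply (tensor_bidual_mult M) f = cdual_apply M (cadjoint ptensor_mult f)"
  by (simp add: cadjoint_apply bounded_clinear_cadjoint ptensor_mult)

lemma cadjoint_ptensor_mult_elem [simp]:
  "cdual_apply (cadjoint ptensor_mult f) (elem_tensor b c) = cdual_apply f (b * c)"
  by (simp add: cadjoint_apply ptensor_mult)

lemmas elem_tensor_linear = bounded_cbilinearD[OF bounded_cbilinear_elem_tensor]

lemma elem_tensor_zero [simp]: "elem_tensor 0 y = 0" "elem_tensor x 0 = 0"
  using norm_elem_tensor[of 0 y] norm_elem_tensor[of x 0] by simp_all

lemma norm_ptensor_dual_ract_le:
  "norm (cdual_ract ptensor_lact T a) \<le> norm T * norm (a :: 'a::cbanach_algebra)"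
proof (rule norm_cdual_ptensor_le)
  fix b c :: 'a
  have "norm (elem_tensor (a * b) c) \<le> norm a * norm b * norm c"
    by (rule order.trans[OF norm_elem_tensor mult_right_mono[OF norm_mult_ineq]]) simp
  then have "cmod (cdual_apply T (elem_tensor (a * b) c)) \<le> norm T * (norm a * norm b * norm c)"
    by (rule order.trans[OF norm_cdual_apply mult_left_mono]) simp
  then show "cmod (cdual_apply (cdual_ract ptensor_lact T a) (elem_tensor b c)) \<le> norm T * norm a * (norm b * norm c)"
    by (simp add: mult.assoc)
qed simp

lemma norm_ptensor_dual_lact_le:
  "norm (cdual_lact ptensor_ract a T) \<le> norm T * norm (a :: 'a::cbanach_algebra)"
proof (rule norm_cdual_ptensor_le)
  fix b c :: 'a
  have "norm (elem_tensor b (c * a)) \<le> norm b * (norm c * norm a)"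
    by (rule order.trans[OF norm_elem_tensor mult_left_mono[OF norm_mult_ineq]]) simp
  then have "cmod (cdual_apply T (elem_tensor b (c * a))) \<le> norm T * (norm b * (norm c * norm a))"
    by (rule order.trans[OF norm_cdual_apply mult_left_mono]) simp
  then show "cmod (cdual_apply (cdual_lact ptensor_ract a T) (elem_tensor b c)) \<le> norm T * norm a * (norm b * norm c)"
    by (simp add: mult_ac)
qed simp

lemma norm_tensor_lact_le: "norm (tensor_lact a M) \<le> norm a * norm M"
proof (rule norm_cdual_bound)
  fix T :: "('a, 'a) ptensor cdual"
  have "cmod (cdual_apply M (cdual_ract ptensor_lact T a)) \<le> norm M * (norm T * norm a)"
    by (rule order.trans[OF norm_cdual_apply mult_left_mono[OF norm_ptensor_dual_ract_le]]) simp
  then show "cmod (cdual_apply (tensor_lact a M) T) \<le> norm a * norm M * norm T"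
    by (simp add: ptensor_bidual_lact_apply mult_ac)
qed simp

lemma norm_tensor_ract_le: "norm (tensor_ract M a) \<le> norm M * norm a"
proof (rule norm_cdual_bound)
  fix T :: "('a, 'a) ptensor cdual"
  have "cmod (cdual_apply M (cdual_lact ptensor_ract a T)) \<le> norm M * (norm T * norm a)"
    by (rule order.trans[OF norm_cdual_apply mult_left_mono[OF norm_ptensor_dual_lact_le]]) simp
  then show "cmod (cdual_apply (tensor_ract M a) T) \<le> norm M * norm a * norm T"
    by (simp add: ptensor_bidual_ract_apply mult_ac)
qed simp

lemma tensor_lact_simps:
  "tensor_lact (a + b) M = tensor_lact a M + tensor_lact b M"
  "tensor_lact (c *\<^sub>C a) M = c *\<^sub>C tensor_lact a M"
  "tensor_lact (a * b) M = tensor_lact a (tensor_lact b M)"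
proof -
  have "cdual_ract ptensor_lact T (a + b) = cdual_ract ptensor_lact T a + cdual_ract ptensor_lact T b"
    "cdual_ract ptensor_lact T (c *\<^sub>C a) = c *\<^sub>C cdual_ract ptensor_lact T a"
    "cdual_ract ptensor_lact T (a * b) = cdual_ract ptensor_lact (cdual_ract ptensor_lact T a) b" for T
    by (rule ptensor_cdual_eqI; simp add: elem_tensor_linear cdual_apply_arg distrib_right mult.assoc)+
  then show "tensor_lact (a + b) M = tensor_lact a M + tensor_lact b M"
    "tensor_lact (c *\<^sub>C a) M = c *\<^sub>C tensor_lact a M"
    "tensor_lact (a * b) M = tensor_lact a (tensor_lact b M)"
    by (intro cdual_eqI; simp add: ptensor_bidual_lact_apply cdual_apply_arg)+
qed

lemma tensor_ract_simps:
  "tensor_ract M (a + b) = tensor_ract M a + tensor_ract M b"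
  "tensor_ract M (c *\<^sub>C a) = c *\<^sub>C tensor_ract M a"
proof -
  have "cdual_lact ptensor_ract (a + b) T = cdual_lact ptensor_ract a T + cdual_lact ptensor_ract b T"
    "cdual_lact ptensor_ract (c *\<^sub>C a) T = c *\<^sub>C cdual_lact ptensor_ract a T" for T
    by (rule ptensor_cdual_eqI; simp add: elem_tensor_linear cdual_apply_arg distrib_left)+
  then show "tensor_ract M (a + b) = tensor_ract M a + tensor_ract M b"
    "tensor_ract M (c *\<^sub>C a) = c *\<^sub>C tensor_ract M a"
    by (intro cdual_eqI; simp add: ptensor_bidual_ract_apply cdual_apply_arg)+
qed

lemma tensor_lact_ract: "tensor_ract (tensor_lact a M) b = tensor_lact a (tensor_ract M b)"
proof (rule cdual_eqI)
  fix T :: "('a, 'a) ptensor cdual"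
  have "cdual_ract ptensor_lact (cdual_lact ptensor_ract b T) a
      = cdual_lact ptensor_ract b (cdual_ract ptensor_lact T a)"
    by (rule ptensor_cdual_eqI) simp
  then show "cdual_apply (tensor_ract (tensor_lact a M) b) T = cdual_apply (tensor_lact a (tensor_ract M b)) T"
    by (simp add: ptensor_bidual_lact_apply ptensor_bidual_ract_apply)
qed

lemma bounded_clinear_tensor_lact: "bounded_clinear (\<lambda>a. tensor_lact a M)" "bounded_clinear (tensor_lact a)"
proof -
  show "bounded_clinear (\<lambda>a. tensor_lact a M)"
    by (rule bounded_clinearI[where K = "norm M"])
      (simp_all add: tensor_lact_simps norm_tensor_lact_le mult.commute[of "norm M"])
  show "bounded_clinear (tensor_lact a)"
    by (rule bounded_clinearI[where K = "norm a"])
      (rule norm_tensor_lact_le | rule cdual_eqI, simp add: ptensor_bidual_lact_apply)+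
qed

lemma bounded_clinear_tensor_ract: "bounded_clinear (tensor_ract M)" "bounded_clinear (\<lambda>M. tensor_ract M a)"
proof -
  show "bounded_clinear (tensor_ract M)"
    by (rule bounded_clinearI[where K = "norm M"])
      (simp_all add: tensor_ract_simps norm_tensor_ract_le)
  have "norm (tensor_ract M a) \<le> norm a * norm M" for M
    using norm_tensor_ract_le[of M a] by (simp add: mult.commute)
  then show "bounded_clinear (\<lambda>M. tensor_ract M a)"
    by (intro bounded_clinearI[where K = "norm a"])
      (assumption | rule cdual_eqI, simp add: ptensor_bidual_ract_apply)+
qed

lemma bounded_clinear_canonical: "bounded_clinear canonical"
proof (rule bounded_clinearI[where K = 1])
  fix x :: 'a
  show "norm (canonical x) \<le> 1 * norm x"
    by (rule norm_cdual_bound) (use norm_cdual_apply in \<open>auto simp: canonical_apply mult.commute\<close>)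
qed (rule cdual_eqI; simp add: canonical_apply cdual_apply_arg)+

lemma bounded_clinear_tensor_bidual_mult: "bounded_clinear tensor_bidual_mult"
  by (intro bounded_clinear_cadjoint ptensor_mult)

lemma tensor_bidual_mult_lact:
  assumes "tensor_bidual_mult M = canonical p"
  shows "tensor_bidual_mult (tensor_lact a M) = canonical (a * p)"
proof (rule cdual_eqI)
  fix f :: "'a cdual"
  have "cdual_ract ptensor_lact (cadjoint ptensor_mult f) a = cadjoint ptensor_mult (cdual_ract (*) f a)"
    by (rule ptensor_cdual_eqI) (simp add: cdual_ract_mult_apply mult.assoc)
  then have "cdual_apply (tensor_bidual_mult (tensor_lact a M)) f
      = cdual_apply (tensor_bidual_mult M) (cdual_ract (*) f a)"
    by (simp add: bidual_ptensor_mult_apply ptensor_bidual_lact_apply)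
  then show "cdual_apply (tensor_bidual_mult (tensor_lact a M)) f = cdual_apply (canonical (a * p)) f"
    by (simp add: assms canonical_apply cdual_ract_mult_apply)
qed

section \<open>Left character amenability\<close>

lemma characterD:
  assumes "\<psi> \<in> characters"
  shows "\<psi> (a + b) = \<psi> a + \<psi> b" "\<psi> (c *\<^sub>C a) = c * \<psi> a" "\<psi> (a * b) = \<psi> a * \<psi> b"
    "cdual_apply (cdual_of \<psi>) a = \<psi> a"
  using assms cdual_of_apply[OF character_bounded[OF assms]]
  by (auto simp: characters_def clinear_def scaleC_complex_def)

lemma character_normalized:
  assumes "\<psi> \<in> characters"
  obtains a where "\<psi> a = 1"
proof -
  obtain b where "\<psi> b \<noteq> 0" using assms by (auto simp: characters_def fun_eq_iff)
  then have "\<psi> (inverse (\<psi> b) *\<^sub>C b) = 1" by (simp add: characterD[OF assms])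
  then show ?thesis using that by blast
qed

text \<open>Kaniuth, Lau and Pym's left \<open>\<psi>\<close>-amenability. It is easier to handle than left
  \<open>\<psi>\<close>-biflatness because it involves no tensor product, and both properties agree if \<open>\<psi>\<close> does
  not vanish on the centre.\<close>

definition left_char_amenable :: "('a::cbanach_algebra \<Rightarrow> complex) \<Rightarrow> bool" where
  "left_char_amenable \<psi> \<longleftrightarrow> (\<exists>m :: 'a cdual cdual.
     (\<forall>a f. cdual_apply m (cdual_ract (*) f a) = \<psi> a * cdual_apply m f) \<and>
     cdual_apply m (cdual_of \<psi>) = 1)"

text \<open>Tensoring the mean \<open>m\<close> on the right with a fixed element on which \<open>\<psi>\<close> is \<open>1\<close> gives an
  element \<open>M\<close> of the second dual of the tensor square with \<open>a \<cdot> M = \<psi>(a) M\<close>;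
  then \<open>\<rho>(a) = \<psi>(a) M\<close> works.\<close>

lemma left_char_amenable_imp_left_biflat:
  assumes psi: "\<psi> \<in> characters" and "left_char_amenable \<psi>"
  shows "left_biflat \<psi>"
proof -
  obtain m :: "'a cdual cdual" where
    m: "\<And>a f. cdual_apply m (cdual_ract (*) f a) = \<psi> a * cdual_apply m f"
    and m1: "cdual_apply m (cdual_of \<psi>) = 1"
    using assms(2) unfolding left_char_amenable_def by blast
  obtain b where b: "\<psi> b = 1" using character_normalized[OF psi] .
  note [simp] = characterD[OF psi]
  define M where "M = cdual_of (\<lambda>T. cdual_apply m (tensor_slice T b))"
  have M: "cdual_apply M T = cdual_apply m (tensor_slice T b)" for T
    unfolding M_def
    by (intro cdual_of_apply bounded_clinear_compose[OF bounded_clinear_cdual_apply]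
        bounded_clinear_tensor_slice)
  have slice: "tensor_slice (cdual_ract ptensor_lact T a) b = cdual_ract (*) (tensor_slice T b) a"
    for T a by (rule cdual_eqI) (simp add: cdual_ract_mult_apply)
  have aM: "tensor_lact a M = \<psi> a *\<^sub>C M" for a
    by (rule cdual_eqI) (simp add: ptensor_bidual_lact_apply M slice m)
  have "tensor_slice (cadjoint ptensor_mult (cdual_of \<psi>)) b = cdual_of \<psi>"
    by (rule cdual_eqI) (simp add: b)
  then have M1: "cdual_apply M (cadjoint ptensor_mult (cdual_of \<psi>)) = 1"
    by (simp add: M m1)
  have lact: "tensor_lact a (c *\<^sub>C M) = c *\<^sub>C tensor_lact a M"
    for a c by (rule cdual_eqI) (simp add: ptensor_bidual_lact_apply)
  show ?thesis
    unfolding left_biflat_def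
  proof (intro exI[of _ "\<lambda>a. \<psi> a *\<^sub>C M"] conjI allI)
    show "bounded_clinear (\<lambda>a. \<psi> a *\<^sub>C M)"
      by (rule bounded_clinear_compose[OF bounded_clinear_scaleC_left character_bounded[OF psi]])
    show "\<psi> (a * c) *\<^sub>C M = \<psi> c *\<^sub>C \<psi> a *\<^sub>C M"
      "\<psi> (a * c) *\<^sub>C M = tensor_lact a (\<psi> c *\<^sub>C M)" for a c
      by (simp_all add: lact aM mult.commute)
    show "char_ext \<psi> (tensor_bidual_mult (\<psi> a *\<^sub>C M)) = \<psi> a" for a
      by (simp add: char_ext_def bidual_ptensor_mult_apply M1)
  qed
qed

text \<open>Applying \<open>\<psi>\<close> to the second tensor factor of \<open>M\<close> leaves a mean. Both left biflatness and
  biflatness supply \<open>M = \<rho>(p)\<close> with \<open>p\<close> central: then \<open>a \<cdot> M = \<rho>(a p) = \<rho>(p a)\<close>, which is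
  \<open>\<psi>(a) M\<close> in the first case, and \<open>M \<cdot> a\<close> in the second, where \<open>\<psi>\<close> turns the right action
  into multiplication by \<open>\<psi>(a)\<close>. Invariance is therefore only required after applying \<open>\<psi>\<close>.\<close>

lemma left_char_amenableI:
  assumes psi: "\<psi> \<in> characters"
    and inv: "\<And>a f. cdual_apply (tensor_lact a M) (dual_tensor f (cdual_of \<psi>))
      = \<psi> a * cdual_apply M (dual_tensor f (cdual_of \<psi>))"
    and one: "char_ext \<psi> (tensor_bidual_mult M) = 1"
  shows "left_char_amenable \<psi>"
proof -
  note [simp] = characterD[OF psi]
  define m where "m = cdual_of (\<lambda>f. cdual_apply M (dual_tensor f (cdual_of \<psi>)))"
  have m: "cdual_apply m f = cdual_apply M (dual_tensor f (cdual_of \<psi>))" for f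
    unfolding m_def
    by (intro cdual_of_apply bounded_clinear_compose[OF bounded_clinear_cdual_apply]
        bounded_clinear_dual_tensor)
  have "dual_tensor (cdual_ract (*) f a) (cdual_of \<psi>)
      = cdual_ract ptensor_lact (dual_tensor f (cdual_of \<psi>)) a" for f a
    by (rule ptensor_cdual_eqI) (simp add: cdual_ract_mult_apply)
  then have "cdual_apply m (cdual_ract (*) f a) = \<psi> a * cdual_apply m f" for a f
    using inv[of a f] by (simp add: m ptensor_bidual_lact_apply)
  moreover have "dual_tensor (cdual_of \<psi>) (cdual_of \<psi>) = cadjoint ptensor_mult (cdual_of \<psi>)"
    by (rule ptensor_cdual_eqI) simp
  then have "cdual_apply m (cdual_of \<psi>) = 1"
    using one by (simp add: m char_ext_def bidual_ptensor_mult_apply)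
  ultimately show ?thesis unfolding left_char_amenable_def by blast
qed

lemma left_biflat_imp_left_char_amenable:
  assumes psi: "\<psi> \<in> characters" and central: "\<And>a. p * a = a * p" and "\<psi> p = 1"
    and "left_biflat \<psi>"
  shows "left_char_amenable \<psi>"
proof -
  obtain \<rho> :: "'a \<Rightarrow> ('a, 'a) ptensor cdual cdual" where
    \<rho>: "\<And>a b. \<rho> (a * b) = \<psi> b *\<^sub>C \<rho> a"
      "\<And>a b. \<rho> (a * b) = tensor_lact a (\<rho> b)"
      "\<And>a. char_ext \<psi> (tensor_bidual_mult (\<rho> a)) = \<psi> a"
    using assms(4) unfolding left_biflat_def by blast
  have "tensor_lact a (\<rho> p) = \<psi> a *\<^sub>C \<rho> p" for a
    using \<rho>(1)[of p a] \<rho>(2)[of a p] central[of a] by simp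
  then show ?thesis
    using \<rho>(3)[of p] assms(3) by (intro left_char_amenableI[OF psi, of "\<rho> p"]) simp_all
qed

lemma biflat_imp_left_char_amenable:
  assumes psi: "\<psi> \<in> characters" and central: "\<And>a. p * a = a * p" and p1: "\<psi> p = 1"
    and "biflat TYPE('a::cbanach_algebra)"
  shows "left_char_amenable (\<psi> :: 'a \<Rightarrow> complex)"
proof -
  obtain \<rho> :: "'a \<Rightarrow> ('a, 'a) ptensor cdual cdual" where
    \<rho>: "\<And>a b. \<rho> (a * b) = tensor_lact a (\<rho> b)"
      "\<And>a b. \<rho> (a * b) = tensor_ract (\<rho> a) b"
      "\<And>a. tensor_bidual_mult (\<rho> a) = canonical a"
    using assms(4) unfolding biflat_def by blast
  show ?thesis
  proof (rule left_char_amenableI[OF psi, of "\<rho> p"])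
    show "char_ext \<psi> (tensor_bidual_mult (\<rho> p)) = 1"
      by (simp add: \<rho>(3) char_ext_canonical[OF psi] p1)
    fix a and f :: "'a cdual"
    let ?T = "dual_tensor f (cdual_of \<psi>)"
    have "cdual_lact ptensor_ract a ?T = \<psi> a *\<^sub>C ?T"
      by (rule ptensor_cdual_eqI) (simp add: characterD[OF psi])
    then have "cdual_apply (tensor_ract (\<rho> p) a) ?T = \<psi> a * cdual_apply (\<rho> p) ?T"
      by (simp add: ptensor_bidual_ract_apply cdual_apply_arg)
    then show "cdual_apply (tensor_lact a (\<rho> p)) ?T = \<psi> a * cdual_apply (\<rho> p) ?T"
      using \<rho>(1)[of a p] \<rho>(2)[of p a] central[of a] by simp
  qed
qed

lemma bidual_functional_Bidual [simp]: "bidual_functional (Bidual F) = F"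
  by (simp add: Bidual_inverse)

lemma bounded_clinear_bidual_functional: "bounded_clinear bidual_functional"
  by (rule bounded_clinearI[where K = 1])
    (simp_all add: plus_bidual.rep_eq scaleC_bidual.rep_eq norm_bidual.rep_eq)

text \<open>Evaluation at a functional \<open>f\<close> of \<open>B\<close>, as a functional on \<open>B\<^sup>*\<^sup>*\<close>: the canonical image of
  \<open>f\<close> in the third dual.\<close>

definition bidual_eval :: "'a::complex_normed_vector cdual \<Rightarrow> 'a bidual cdual" where
  "bidual_eval f = cdual_of (\<lambda>F. cdual_apply (bidual_functional F) f)"

lemma bidual_eval_apply [simp]:
  "cdual_apply (bidual_eval f) F = cdual_apply (bidual_functional F) f"
  unfolding bidual_eval_def
  by (intro cdual_of_apply bounded_clinear_compose[OF bounded_clinear_eval]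
      bounded_clinear_bidual_functional)

lemma bounded_clinear_bidual_eval: "bounded_clinear bidual_eval"
proof (rule bounded_clinearI[where K = 1])
  fix f :: "'a cdual"
  show "norm (bidual_eval f) \<le> 1 * norm f"
    by (rule norm_cdual_bound)
      (use norm_cdual_apply in \<open>auto simp: norm_bidual.rep_eq mult.commute\<close>)
qed (rule cdual_eqI; simp add: plus_bidual.rep_eq scaleC_bidual.rep_eq cdual_apply_linear scaleC_complex_def)+

text \<open>A mean \<open>m\<close> for \<open>\<psi>\<close> satisfies \<open>F * m = F(\<psi>) m\<close> for all \<open>F\<close> in the second
  dual, so its canonical image is a mean for the extension of \<open>\<psi>\<close>. Conversely a mean on
  \<open>B\<^sup>*\<^sup>*\<^sup>*\<close> restricts to one on \<open>B\<^sup>*\<close>.\<close>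

lemma left_char_amenable_bidual_iff:
  assumes psi: "\<psi> \<in> characters"
  shows "left_char_amenable (bidual_char \<psi>) \<longleftrightarrow> left_char_amenable \<psi>"
proof
  have char: "cdual_of (bidual_char \<psi>) = bidual_eval (cdual_of \<psi>)"
    by (rule cdual_eqI)
      (simp add: characterD[OF bidual_char_in_characters[OF psi]] bidual_char_def char_ext_def)
  {
    assume "left_char_amenable \<psi>"
    then obtain m :: "'a cdual cdual" where
      m: "\<And>a f. cdual_apply m (cdual_ract (*) f a) = \<psi> a * cdual_apply m f"
      and m1: "cdual_apply m (cdual_of \<psi>) = 1"
      unfolding left_char_amenable_def by blast
    have act: "arens_act m f = cdual_apply m f *\<^sub>C cdual_of \<psi>" for f
      by (rule cdual_eqI) (simp add: arens_act_apply m characterD[OF psi])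
    have mult: "F * Bidual m = bidual_char \<psi> F *\<^sub>C Bidual m" for F
      by (intro bidual_eqI cdual_eqI)
        (simp add: times_bidual.rep_eq scaleC_bidual.rep_eq arens_mult_apply act cdual_apply_arg
          bidual_char_def char_ext_def)
    show "left_char_amenable (bidual_char \<psi>)"
      unfolding left_char_amenable_def
      by (rule exI[of _ "canonical (Bidual m)"])
        (simp add: canonical_apply cdual_ract_mult_apply mult cdual_apply_arg char m1)
  next
    assume "left_char_amenable (bidual_char \<psi>)"
    then obtain m :: "'a bidual cdual cdual" where
      m: "\<And>F f. cdual_apply m (cdual_ract (*) f F) = bidual_char \<psi> F * cdual_apply m f"
      and m1: "cdual_apply m (cdual_of (bidual_char \<psi>)) = 1"
      unfolding left_char_amenable_def by blast
    have eval: "bidual_eval (cdual_ract (*) f a) = cdual_ract (*) (bidual_eval f) (Bidual (canonical a))"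
      for f and a :: 'a
      by (rule cdual_eqI)
        (simp add: cdual_ract_mult_apply times_bidual.rep_eq arens_mult_apply canonical_apply
          arens_act_apply)
    have ch: "bidual_char \<psi> (Bidual (canonical a)) = \<psi> a" for a
      by (simp add: bidual_char_def char_ext_canonical[OF psi])
    show "left_char_amenable \<psi>"
      unfolding left_char_amenable_def
    proof (intro exI[of _ "cadjoint bidual_eval m"] conjI allI)
      note [simp] = cadjoint_apply[OF bounded_clinear_bidual_eval]
      show "cdual_apply (cadjoint bidual_eval m) (cdual_ract (*) f a)
          = \<psi> a * cdual_apply (cadjoint bidual_eval m) f" for a f
        by (simp add: eval m ch)
      show "cdual_apply (cadjoint bidual_eval m) (cdual_of \<psi>) = 1"
        using m1 by (simp add: char)
    qed
  }
qed

text \<open>In general the first Arens product is weak-star continuous only in its left factor. Multiplication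
  by a canonical image is weak-star continuous on both sides, which is why centrality survives.\<close>

lemma bidual_canonical_central:
  assumes "\<And>a. p * a = a * (p :: 'a::cbanach_algebra)"
  shows "Bidual (canonical p) * F = F * Bidual (canonical p)"
proof (intro bidual_eqI cdual_eqI)
  fix f :: "'a cdual"
  have "arens_act (canonical p) f = cdual_ract (*) f p"
    by (rule cdual_eqI) (simp add: arens_act_apply canonical_apply cdual_ract_mult_apply assms)
  then show "cdual_apply (bidual_functional (Bidual (canonical p) * F)) f
      = cdual_apply (bidual_functional (F * Bidual (canonical p))) f"
    by (simp add: times_bidual.rep_eq arens_mult_apply canonical_apply arens_act_apply)
qed

lemma left_biflat_iff_left_char_amenable:
  assumes psi: "\<psi> \<in> characters" and "\<And>a. p * a = a * p" and "\<psi> p = 1"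
  shows "left_biflat \<psi> \<longleftrightarrow> left_char_amenable \<psi>"
  using left_biflat_imp_left_char_amenable[OF assms] left_char_amenable_imp_left_biflat[OF psi]
  by blast

lemma left_biflat_bidual_iff:
  assumes psi: "\<psi> \<in> characters" and central: "\<And>a. p * a = a * p" and p1: "\<psi> p = 1"
  shows "left_biflat (bidual_char \<psi>) \<longleftrightarrow> left_biflat \<psi>"
proof -
  have "bidual_char \<psi> (Bidual (canonical p)) = 1"
    by (simp add: bidual_char_def char_ext_canonical[OF psi] p1)
  from left_biflat_iff_left_char_amenable[OF bidual_char_in_characters[OF psi]
      bidual_canonical_central[OF central] this]
  show ?thesis
    by (simp add: left_char_amenable_bidual_iff[OF psi]
        left_biflat_iff_left_char_amenable[OF assms])
qed

section \<open>The Banach space of absolutely summable families\<close>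

lemma infsum_single:
  assumes "\<And>x. x \<in> A \<Longrightarrow> x \<noteq> i \<Longrightarrow> f x = 0" and "i \<in> A"
  shows "infsum f A = f i"
proof -
  have "infsum f A = infsum f {i}" by (rule infsum_cong_neutral) (use assms in auto)
  then show ?thesis by simp
qed

lift_definition delta :: "'s \<Rightarrow> 's ell1" is "\<lambda>s t. if t = s then 1 else 0"
  by (rule finite_nonzero_values_imp_summable_on) simp

lemma delta_apply: "ell1_apply (delta s) t = (if t = s then 1 else 0)"
  by transfer simp

lemma norm_delta [simp]: "norm (delta s) = 1"
  unfolding norm_ell1_eq delta_apply by (subst infsum_single[where i = s]) auto

lemma delta_mult: "delta s * delta t = delta (s * t)"
proof (rule ell1_eqI)
  fix u
  let ?S = "\<Sum>\<^sub>\<infinity>p \<in> {p. fst p * snd p = u}.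
    (if fst p = s then 1 else 0) * (if snd p = t then 1 else (0 :: complex))"
  have "?S = (if u = s * t then 1 else 0)"
  proof (cases "u = s * t")
    case True
    then show ?thesis by (subst infsum_single[where i = "(s, t)"]) auto
  next
    case False
    then show ?thesis by (subst infsum_0) auto
  qed
  then show "ell1_apply (delta s * delta t) u = ell1_apply (delta (s * t)) u"
    by (simp only: ell1_apply_times delta_apply)
qed

lemma infsum_bounded_clinear:
  assumes "bounded_clinear T" "f summable_on A"
  shows "(\<Sum>\<^sub>\<infinity>x\<in>A. T (f x)) = T (infsum f A)"
  by (rule infsumI[OF has_sum_bounded_linear[OF bounded_clinear_imp_linear[OF assms(1)]
        has_sum_infsum[OF assms(2)]]])

lemma bounded_clinear_ell1_apply: "bounded_clinear (\<lambda>a. ell1_apply a s)"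
  by (rule bounded_clinearI[where K = 1]) (simp_all add: scaleC_complex_def norm_ell1_apply)

lemma ell1_family_summable:
  fixes k :: "'s \<Rightarrow> 'x::cbanach"
  assumes "\<And>s. norm (k s) \<le> C"
  shows "(\<lambda>s. norm (ell1_apply a s *\<^sub>C k s)) summable_on UNIV"
    and "(\<lambda>s. ell1_apply a s *\<^sub>C k s) summable_on UNIV"
proof -
  have "0 \<le> C" using assms norm_ge_zero order.trans by blast
  show 1: "(\<lambda>s. norm (ell1_apply a s *\<^sub>C k s)) summable_on UNIV"
  proof (rule summable_on_comparison_test[OF summable_on_cmult_left[of _ _ C]])
    show "(\<lambda>s. cmod (ell1_apply a s)) summable_on UNIV" by (rule ell1_abs_summable)
  qed (auto intro: mult_left_mono assms)
  show "(\<lambda>s. ell1_apply a s *\<^sub>C k s) summable_on UNIV"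
    by (rule abs_summable_summable[OF 1])
qed

text \<open>\<open>\<ell>\<^sup>1(S)\<close> is the free Banach space on \<open>S\<close>: bounded linear maps out of it correspond to
  bounded families indexed by \<open>S\<close>.\<close>

definition ell1_lift :: "('s \<Rightarrow> 'x::cbanach) \<Rightarrow> 's ell1 \<Rightarrow> 'x" where
  "ell1_lift k a = (\<Sum>\<^sub>\<infinity>s. ell1_apply a s *\<^sub>C k s)"

lemma norm_ell1_lift_le:
  assumes "\<And>s. norm (k s) \<le> C"
  shows "norm (ell1_lift k a) \<le> C * norm a"
proof -
  note S = ell1_family_summable[of k C, OF assms]
  have "norm (ell1_lift k a) \<le> (\<Sum>\<^sub>\<infinity>s. norm (ell1_apply a s *\<^sub>C k s))"
    unfolding ell1_lift_def by (rule norm_infsum_bound[OF S(1)])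
  also have "\<dots> \<le> (\<Sum>\<^sub>\<infinity>s. cmod (ell1_apply a s) * C)"
    by (rule infsum_mono[OF S(1) summable_on_cmult_left[OF ell1_abs_summable]])
      (simp add: mult_left_mono assms)
  also have "\<dots> = C * norm a" by (simp add: norm_ell1_eq infsum_cmult_left')
  finally show ?thesis .
qed

lemma bounded_clinear_ell1_lift:
  assumes "\<And>s. norm (k s) \<le> C"
  shows "bounded_clinear (ell1_lift k)"
proof (rule bounded_clinearI[where K = C])
  note S = ell1_family_summable(2)[of k C, OF assms]
  show "ell1_lift k (a + b) = ell1_lift k a + ell1_lift k b" for a b
    by (simp add: ell1_lift_def scaleC_add_left infsum_add S)
  show "ell1_lift k (c *\<^sub>C a) = c *\<^sub>C ell1_lift k a" for c a
    using infsum_bounded_clinear[OF bounded_clinear_scaleC[of c] S[of a]]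
    by (simp add: ell1_lift_def)
qed (rule norm_ell1_lift_le[OF assms])

lemma ell1_lift_delta [simp]: "ell1_lift k (delta s) = k s"
  unfolding ell1_lift_def delta_apply by (subst infsum_single[where i = s]) auto

lemma ell1_map_eq_lift:
  fixes T :: "'s ell1 \<Rightarrow> 'x::cbanach"
  assumes T: "bounded_clinear T"
  shows "T a = ell1_lift (\<lambda>s. T (delta s)) a"
proof -
  note S = ell1_family_summable(2)[of delta 1 a, simplified]
  have id: "ell1_lift delta a = a"
  proof (rule ell1_eqI)
    fix t
    have "ell1_apply (ell1_lift delta a) t = (\<Sum>\<^sub>\<infinity>s. ell1_apply (ell1_apply a s *\<^sub>C delta s) t)"
      using infsum_bounded_clinear[OF bounded_clinear_ell1_apply[of t] S]
      by (simp add: ell1_lift_def)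
    also have "\<dots> = ell1_apply a t"
      unfolding ell1_apply_simps delta_apply by (subst infsum_single[where i = t]) auto
    finally show "ell1_apply (ell1_lift delta a) t = ell1_apply a t" .
  qed
  have "T (ell1_lift delta a) = ell1_lift (\<lambda>s. T (delta s)) a"
    using infsum_bounded_clinear[OF T S]
    by (simp add: ell1_lift_def bounded_clinearD[OF T])
  then show ?thesis by (simp add: id)
qed

lemma ell1_map_eqI:
  fixes T T' :: "'s ell1 \<Rightarrow> 'x::cbanach"
  assumes "bounded_clinear T" "bounded_clinear T'" "\<And>s. T (delta s) = T' (delta s)"
  shows "T a = T' a"
  by (subst ell1_map_eq_lift[OF assms(1)], subst ell1_map_eq_lift[OF assms(2)]) (simp add: assms(3))

lemma ell1_bilinear_eqI:
  fixes B B' :: "'s ell1 \<Rightarrow> 't ell1 \<Rightarrow> 'x::cbanach"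
  assumes "\<And>a. bounded_clinear (B a)" "\<And>b. bounded_clinear (\<lambda>a. B a b)"
    and "\<And>a. bounded_clinear (B' a)" "\<And>b. bounded_clinear (\<lambda>a. B' a b)"
    and "\<And>s t. B (delta s) (delta t) = B' (delta s) (delta t)"
  shows "B a b = B' a b"
proof -
  have "B (delta s) b = B' (delta s) b" for s
    by (rule ell1_map_eqI[OF assms(1,3)]) (rule assms(5))
  then show ?thesis by (rule ell1_map_eqI[OF assms(2,4)])
qed

lemma delta_central:
  fixes p :: "'s::semigroup_mult"
  assumes "\<And>s. p * s = s * p"
  shows "delta p * a = a * delta p"
  by (rule ell1_map_eqI[OF bounded_clinear_mult_left bounded_clinear_mult_right])
    (simp add: delta_mult assms)

lemma ell1_lift_character:
  fixes k :: "'s::semigroup_mult \<Rightarrow> complex"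
  assumes bound: "\<And>s. cmod (k s) \<le> C" and mult: "\<And>s t. k (s * t) = k s * k t" and "k s \<noteq> 0"
  shows "ell1_lift k \<in> characters"
proof -
  note L = bounded_clinear_ell1_lift[of k C, OF bound]
  have "ell1_lift k (a * b) = ell1_lift k a * ell1_lift k b" for a b
    by (rule ell1_bilinear_eqI[where B = "\<lambda>a b. ell1_lift k (a * b)" and B' = "\<lambda>a b. ell1_lift k a * ell1_lift k b"])
      (simp_all add: delta_mult mult bounded_clinear_compose[OF L bounded_clinear_mult_left]
        bounded_clinear_compose[OF L bounded_clinear_mult_right]
        bounded_clinear_compose[OF bounded_clinear_mult_left L]
        bounded_clinear_compose[OF bounded_clinear_mult_right L])
  moreover have "ell1_lift k (delta s) \<noteq> 0" using \<open>k s \<noteq> 0\<close> by simp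
  then have "ell1_lift k \<noteq> (\<lambda>_. 0)" by (metis (no_types))
  ultimately show ?thesis using L by (simp add: characters_def bounded_clinear_def)
qed

section \<open>Clifford semigroups\<close>

lemma inverse_semigroup_idempotents_commute:
  fixes e f :: "'s::inverse_semigroup"
  assumes e: "e * e = e" and f: "f * f = f"
  shows "e * f = f * e"
proof -
  have idem: "(e * f) * (e * f) = e * f" if e: "e * e = e" and f: "f * f = f" for e f :: 's
  proof -
    let ?x = "(e * f)\<^sup>\<star>"
    have e': "e * (e * z) = e * z" and f': "f * (f * z) = f * z" for z
      using e f by (simp_all flip: mult.assoc)
    have x1: "e * (f * (?x * (e * f))) = e * f" using star_props(1)[of "e * f"] by (simp add: mult.assoc)
    have x2: "?x * (e * (f * ?x)) = ?x" using star_props(2)[of "e * f"] by (simp add: mult.assoc)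
    have x2': "?x * (e * (f * (?x * z))) = ?x * z" for z using x2 by (metis mult.assoc)
    \<comment> \<open>\<open>f (e f)\<^sup>\<star> e\<close> is a second inverse of \<open>e f\<close>, so \<open>(e f)\<^sup>\<star>\<close> equals it and is idempotent.\<close>
    have x: "?x = f * ?x * e"
    proof (rule star_unique)
      show "e * f * (f * ?x * e) * (e * f) = e * f" using x1 by (simp add: mult.assoc e' f')
      show "f * ?x * e * (e * f) * (f * ?x * e) = f * ?x * e" by (simp add: mult.assoc e' f' x2')
    qed
    have "?x * ?x = (f * ?x * e) * (f * ?x * e)"
      by (rule arg_cong2[where f = "(*)", OF x x])
    also have "\<dots> = f * ?x * e" by (simp add: mult.assoc x2')
    also have "\<dots> = ?x" by (rule x[symmetric])
    finally have "?x * ?x = ?x" .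
    then show ?thesis using star_idempotent[of ?x] star_star[of "e * f"] by simp
  qed
  have e': "e * (e * z) = e * z" and f': "f * (f * z) = f * z" for z
    using e f by (simp_all flip: mult.assoc)
  have 1: "e * (f * (e * f)) = e * f" using idem[OF e f] by (simp add: mult.assoc)
  have 2: "f * (e * (f * e)) = f * e" using idem[OF f e] by (simp add: mult.assoc)
  have "(e * f)\<^sup>\<star> = f * e"
    by (rule star_unique) (simp_all add: mult.assoc e' f' 1 2)
  moreover have "(e * f)\<^sup>\<star> = e * f" by (rule star_idempotent[OF idem[OF e f]])
  ultimately show ?thesis by simp
qed

lemma star_mult: "(s * t)\<^sup>\<star> = t\<^sup>\<star> * s\<^sup>\<star>" for s t :: "'s::inverse_semigroup"
proof (rule star_unique)
  have c: "(t * t\<^sup>\<star>) * (s\<^sup>\<star> * s) = (s\<^sup>\<star> * s) * (t * t\<^sup>\<star>)"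
    by (rule inverse_semigroup_idempotents_commute) (metis mult.assoc star_props)+
  have "s * t * (t\<^sup>\<star> * s\<^sup>\<star>) * (s * t) = s * ((t * t\<^sup>\<star>) * (s\<^sup>\<star> * s)) * t" by (simp only: mult.assoc)
  also have "\<dots> = (s * s\<^sup>\<star> * s) * (t * t\<^sup>\<star> * t)" unfolding c by (simp only: mult.assoc)
  finally show "s * t * (t\<^sup>\<star> * s\<^sup>\<star>) * (s * t) = s * t" by (simp only: star_props)
  have "t\<^sup>\<star> * s\<^sup>\<star> * (s * t) * (t\<^sup>\<star> * s\<^sup>\<star>) = t\<^sup>\<star> * ((s\<^sup>\<star> * s) * (t * t\<^sup>\<star>)) * s\<^sup>\<star>"
    by (simp only: mult.assoc)
  also have "\<dots> = (t\<^sup>\<star> * t * t\<^sup>\<star>) * (s\<^sup>\<star> * s * s\<^sup>\<star>)" unfolding c[symmetric] by (simp only: mult.assoc)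
  finally show "t\<^sup>\<star> * s\<^sup>\<star> * (s * t) * (t\<^sup>\<star> * s\<^sup>\<star>) = t\<^sup>\<star> * s\<^sup>\<star>" by (simp only: star_props)
qed

text \<open>Comparing \<open>(e s) (e s)\<^sup>\<star>\<close> with \<open>(e s)\<^sup>\<star> (e s)\<close> gives \<open>s\<^sup>\<star> e s = s s\<^sup>\<star> e\<close>;
  multiplying by \<open>s\<close> from the left yields the claim.\<close>

lemma idempotent_central:
  fixes e s :: "'s::clifford_semigroup"
  assumes e: "e * e = e"
  shows "e * s = s * e"
proof -
  have i: "(s * s\<^sup>\<star>) * (s * s\<^sup>\<star>) = s * s\<^sup>\<star>" by (metis mult.assoc star_props(1))
  have c: "e * (s * s\<^sup>\<star>) = (s * s\<^sup>\<star>) * e" by (rule inverse_semigroup_idempotents_commute[OF e i])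
  have "(e * s) * (e * s)\<^sup>\<star> = (e * s)\<^sup>\<star> * (e * s)" by (rule star_commute)
  then have "e * (s * s\<^sup>\<star>) * e = s\<^sup>\<star> * (e * e) * s"
    by (simp only: star_mult star_idempotent[OF e] mult.assoc)
  then have "s\<^sup>\<star> * (e * e) * s = (s * s\<^sup>\<star>) * e * e" by (simp only: c)
  then have k: "s\<^sup>\<star> * e * s = (s * s\<^sup>\<star>) * e" by (simp only: e mult.assoc)
  have "e * s = e * (s * s\<^sup>\<star> * s)" by (simp only: star_props)
  also have "\<dots> = e * (s * s\<^sup>\<star>) * s" by (simp only: mult.assoc)
  also have "\<dots> = s * (s\<^sup>\<star> * e * s)" unfolding c by (simp only: mult.assoc)
  also have "\<dots> = s * ((s\<^sup>\<star> * s) * e)" by (simp only: k star_commute[of s])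
  also have "\<dots> = s * (s\<^sup>\<star> * s) * e" by (simp only: mult.assoc)
  also have "s * (s\<^sup>\<star> * s) = s" using star_props(1)[of s] by (simp only: mult.assoc)
  finally show ?thesis .
qed

text \<open>The identity of the maximal subgroup containing \<open>s\<close>.\<close>

definition supp :: "'s::clifford_semigroup \<Rightarrow> 's" where
  "supp s = s * s\<^sup>\<star>"

lemma supp_idem [simp]: "supp s * supp s = supp s"
  unfolding supp_def by (metis mult.assoc star_props(1))

lemma supp_central: "supp s * t = t * supp s"
  by (rule idempotent_central) simp

lemma supp_mult_self [simp]: "supp s * s = s" "s * supp s = s"
  using supp_central[of s s] star_props(1)[of s] by (simp_all add: supp_def)

lemma supp_mult: "supp (s * t) = supp s * supp t"
proof -
  have "supp (s * t) = s * supp t * s\<^sup>\<star>" by (simp only: supp_def star_mult mult.assoc)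
  also have "\<dots> = supp t * s * s\<^sup>\<star>" by (simp only: supp_central)
  also have "\<dots> = supp t * supp s" by (simp only: supp_def mult.assoc)
  also have "\<dots> = supp s * supp t" by (rule supp_central)
  finally show ?thesis .
qed

lemma supp_idempotent: "e * e = e \<Longrightarrow> supp e = e"
  by (simp add: supp_def star_idempotent)

lemma carrier_maximal_subgroup: "carrier (maximal_subgroup e) = {s. supp s = e}"
  by (auto simp: maximal_subgroup_def supp_def star_commute)

lemma mult_maximal_subgroup [simp]: "s \<otimes>\<^bsub>maximal_subgroup e\<^esub> t = s * t"
  by (simp add: maximal_subgroup_def)

text \<open>Below, \<open>e * supp s = e\<close> says that \<open>e\<close> lies below the identity of the subgroup of \<open>s\<close>;
  exactly then \<open>s * e\<close> belongs to the subgroup at \<open>e\<close>.\<close>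

lemma below_supp_mult_iff:
  assumes "e * e = e"
  shows "e * supp (s * t) = e \<longleftrightarrow> e * supp s = e \<and> e * supp t = e"
proof
  assume a: "e * supp (s * t) = e"
  then have 1: "e * supp s * supp t = e" by (simp add: supp_mult mult.assoc)
  have "e * supp t = (e * supp s * supp t) * supp t" by (simp only: 1)
  also have "\<dots> = e * supp s * (supp t * supp t)" by (simp only: mult.assoc)
  also have "\<dots> = e" by (simp only: supp_idem 1)
  finally have 2: "e * supp t = e" .
  have "e * supp s = (e * supp s * supp t) * supp s" by (simp only: 1)
  also have "\<dots> = e * supp s * (supp t * supp s)" by (simp only: mult.assoc)
  also have "supp t * supp s = supp s * supp t" by (rule supp_central)
  also have "e * supp s * (supp s * supp t) = e * (supp s * supp s) * supp t" by (simp only: mult.assoc)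
  also have "\<dots> = e" by (simp only: supp_idem 1)
  finally show "e * supp s = e \<and> e * supp t = e" using 2 by simp
qed (simp add: supp_mult flip: mult.assoc)

text \<open>A character that is non-zero at \<open>s\<close> is non-zero at the idempotent \<open>s s\<^sup>\<star>\<close>, hence \<open>1\<close> there.\<close>

lemma ell1_character_normalized_idempotent:
  fixes \<phi> :: "'s::clifford_semigroup ell1 \<Rightarrow> complex"
  assumes phi: "\<phi> \<in> characters"
  obtains e where "e * e = e" "\<phi> (delta e) = 1"
proof -
  have "\<exists>s. \<phi> (delta s) \<noteq> 0"
  proof (rule ccontr)
    assume z: "\<not> (\<exists>s. \<phi> (delta s) \<noteq> 0)"
    have "\<phi> a = 0" for a
      by (rule ell1_map_eqI[OF character_bounded[OF phi] bounded_clinear_zero]) (use z in simp)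
    then show False using phi by (auto simp: characters_def)
  qed
  then obtain s where s: "\<phi> (delta s) \<noteq> 0" by blast
  have "\<phi> (delta (supp s)) * \<phi> (delta s) = \<phi> (delta s)"
    by (simp flip: characterD(3)[OF phi] add: delta_mult)
  then show ?thesis using that[of "supp s"] s by simp
qed

section \<open>From bounded invariant functionals to invariant means\<close>

lemma bounded_real_image_iff: "bounded (f ` A) \<longleftrightarrow> (\<exists>B. \<forall>x\<in>A. \<bar>f x\<bar> \<le> B)" for f :: "'a \<Rightarrow> real"
  by (simp add: bounded_iff)

text \<open>The mean is the normalized positive part of the functional \<open>n\<close>, in the sense of the Jordan
  decomposition: on non-negative \<open>h\<close> it is the supremum of \<open>n\<close> over the order interval from \<open>0\<close>
  to \<open>h\<close>. Translation permutes these order intervals, so the positive part inherits invariance,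
  and it does not vanish because its value at \<open>1\<close> is at least \<open>n 1 = 1\<close>.\<close>

lemma bounded_invariant_functional_imp_amenable:
  fixes G (structure) and n :: "('g \<Rightarrow> real) \<Rightarrow> real"
  assumes "group G"
    and n_add: "\<And>f h. bounded (f ` carrier G) \<Longrightarrow> bounded (h ` carrier G) \<Longrightarrow>
      n (\<lambda>x. f x + h x) = n f + n h"
    and n_scale: "\<And>c f. bounded (f ` carrier G) \<Longrightarrow> n (\<lambda>x. c * f x) = c * n f"
    and n_bound: "\<And>f B. (\<And>x. x \<in> carrier G \<Longrightarrow> \<bar>f x\<bar> \<le> B) \<Longrightarrow> n f \<le> C * B"
    and n_inv: "\<And>g f. g \<in> carrier G \<Longrightarrow> bounded (f ` carrier G) \<Longrightarrow> n (\<lambda>x. f (g \<otimes> x)) = n f"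
    and n_one: "n (\<lambda>_. 1) = 1"
  shows "amenable_group G"
proof -
  interpret group G by fact
  have bd: "bounded (f ` carrier G) \<longleftrightarrow> (\<exists>B. \<forall>x\<in>carrier G. \<bar>f x\<bar> \<le> B)" for f :: "'g \<Rightarrow> real"
    by (rule bounded_real_image_iff)
  have bd_const: "bounded ((\<lambda>_. c) ` carrier G)" for c :: real
    unfolding bd by blast
  define I where "I h = {k. \<forall>x\<in>carrier G. 0 \<le> k x \<and> k x \<le> h x}" for h :: "'g \<Rightarrow> real"
  define q where "q h = (SUP k\<in>I h. n k)" for h
  define P where "P h \<longleftrightarrow> bounded (h ` carrier G) \<and> (\<forall>x\<in>carrier G. 0 \<le> h x)" for h :: "'g \<Rightarrow> real"
  have I_bd: "bounded (k ` carrier G)" if h: "P h" and k: "k \<in> I h" for h k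
  proof -
    obtain B where "\<forall>x\<in>carrier G. \<bar>h x\<bar> \<le> B" using h unfolding P_def bd by blast
    then show ?thesis unfolding bd using k by (intro exI[of _ B]) (force simp: I_def)
  qed
  have zero_I: "(\<lambda>_. 0) \<in> I h" if "P h" for h using that by (simp add: P_def I_def)
  have n_zero: "n (\<lambda>_. 0) = 0" using n_scale[OF bd_const, of 0 0] by simp
  have bdd: "bdd_above (n ` I h)" if h: "P h" for h
  proof -
    obtain B where B: "\<forall>x\<in>carrier G. \<bar>h x\<bar> \<le> B" using h unfolding P_def bd by blast
    have "n k \<le> C * B" if "k \<in> I h" for k
      by (rule n_bound) (use B that in \<open>force simp: I_def\<close>)
    then show ?thesis by (rule bdd_aboveI2)
  qed
  have q_upper: "n k \<le> q h" if "P h" "k \<in> I h" for h k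
    unfolding q_def by (rule cSUP_upper[OF that(2) bdd[OF that(1)]])
  have q_least: "q h \<le> z" if "P h" "\<And>k. k \<in> I h \<Longrightarrow> n k \<le> z" for h z
    unfolding q_def by (rule cSUP_least) (use zero_I that in auto)
  have q_nonneg: "0 \<le> q h" if "P h" for h
    using q_upper[OF that zero_I[OF that]] n_zero by simp
  have q_cong: "q h = q k" if "\<And>x. x \<in> carrier G \<Longrightarrow> h x = k x" for h k
    using that by (simp add: q_def I_def)
  have P_add: "P (\<lambda>x. h x + k x)" if hk: "P h" "P k" for h k
  proof -
    obtain A B where "\<forall>x\<in>carrier G. \<bar>h x\<bar> \<le> A" "\<forall>x\<in>carrier G. \<bar>k x\<bar> \<le> B"
      using hk unfolding P_def bd by blast
    then show ?thesis using hk unfolding P_def bd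
      by (intro conjI exI[of _ "A + B"]) (force intro: order.trans[OF abs_triangle_ineq] add_mono)+
  qed
  have P_scale: "P (\<lambda>x. c * h x)" if h: "P h" "0 \<le> c" for h c
  proof -
    obtain B where "\<forall>x\<in>carrier G. \<bar>h x\<bar> \<le> B" using h unfolding P_def bd by blast
    then show ?thesis using h unfolding P_def bd
      by (intro conjI exI[of _ "c * B"]) (auto simp: abs_mult intro: mult_left_mono)
  qed
  have q_add: "q (\<lambda>x. h x + k x) = q h + q k" if h: "P h" and k: "P k" for h k
  proof (rule antisym)
    note hk = P_add[OF h k]
    show "q (\<lambda>x. h x + k x) \<le> q h + q k"
    proof (rule q_least[OF hk])
      fix u assume u: "u \<in> I (\<lambda>x. h x + k x)"
      \<comment> \<open>Riesz decomposition of \<open>u \<le> h + k\<close>\<close>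
      have 1: "(\<lambda>x. min (u x) (h x)) \<in> I h" using u h by (auto simp: I_def P_def)
      have 2: "(\<lambda>x. u x - min (u x) (h x)) \<in> I k" using u k by (auto simp: I_def P_def min_def)
      have "n u = n (\<lambda>x. min (u x) (h x) + (u x - min (u x) (h x)))" by simp
      also have "\<dots> = n (\<lambda>x. min (u x) (h x)) + n (\<lambda>x. u x - min (u x) (h x))"
        by (rule n_add[OF I_bd[OF h 1] I_bd[OF k 2]])
      also have "\<dots> \<le> q h + q k" by (rule add_mono[OF q_upper[OF h 1] q_upper[OF k 2]])
      finally show "n u \<le> q h + q k" .
    qed
    have uv: "n u + n v \<le> q (\<lambda>x. h x + k x)" if u: "u \<in> I h" and v: "v \<in> I k" for u v
    proof -
      have "(\<lambda>x. u x + v x) \<in> I (\<lambda>x. h x + k x)" using u v by (auto simp: I_def add_mono)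
      from q_upper[OF hk this] show ?thesis by (simp add: n_add[OF I_bd[OF h u] I_bd[OF k v]])
    qed
    have "q k \<le> q (\<lambda>x. h x + k x) - n u" if "u \<in> I h" for u
      by (rule q_least[OF k]) (use uv[OF that] in \<open>simp add: algebra_simps\<close>)
    then have "q h \<le> q (\<lambda>x. h x + k x) - q k"
      by (intro q_least[OF h]) (simp add: algebra_simps)
    then show "q h + q k \<le> q (\<lambda>x. h x + k x)" by simp
  qed
  have q_scale_le: "q (\<lambda>x. c * h x) \<le> c * q h" if h: "P h" and c: "c > 0" for h c
  proof (rule q_least[OF P_scale[OF h less_imp_le[OF c]]])
    fix u assume u: "u \<in> I (\<lambda>x. c * h x)"
    have 1: "(\<lambda>x. inverse c * u x) \<in> I h" using u c by (auto simp: I_def field_simps)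
    have "n u = n (\<lambda>x. c * (inverse c * u x))" using c by (simp flip: mult.assoc)
    also have "\<dots> = c * n (\<lambda>x. inverse c * u x)" by (rule n_scale[OF I_bd[OF h 1]])
    also have "\<dots> \<le> c * q h" using q_upper[OF h 1] c by simp
    finally show "n u \<le> c * q h" .
  qed
  have P0: "P (\<lambda>_. 0)" by (simp add: P_def bd_const)
  have q0: "q (\<lambda>_. 0) = 0" using q_add[OF P0 P0] by simp
  have q_scale: "q (\<lambda>x. c * h x) = c * q h" if h: "P h" and c: "0 \<le> c" for h c
  proof (cases "c = 0")
    case False
    then have c: "c > 0" using c by simp
    have "q h = q (\<lambda>x. inverse c * (c * h x))" using c by (intro q_cong) (simp flip: mult.assoc)
    also have "\<dots> \<le> inverse c * q (\<lambda>x. c * h x)"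
      by (rule q_scale_le) (use P_scale[OF h] c in auto)
    finally have "c * q h \<le> q (\<lambda>x. c * h x)" using c by (simp add: field_simps)
    then show ?thesis using q_scale_le[OF h c] by simp
  qed (simp add: q0)
  have P_trans: "P (\<lambda>x. h (g \<otimes> x))" if "P h" "g \<in> carrier G" for h g
    using that unfolding P_def bd by fastforce
  have q_inv_le: "q h \<le> q (\<lambda>x. h (g \<otimes> x))" if h: "P h" and g: "g \<in> carrier G" for h g
  proof (rule q_least[OF h])
    fix u assume u: "u \<in> I h"
    have "(\<lambda>x. u (g \<otimes> x)) \<in> I (\<lambda>x. h (g \<otimes> x))" using u g by (auto simp: I_def)
    from q_upper[OF P_trans[OF h g] this] show "n u \<le> q (\<lambda>x. h (g \<otimes> x))"
      by (simp add: n_inv[OF g I_bd[OF h u]])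
  qed
  have q_inv: "q (\<lambda>x. h (g \<otimes> x)) = q h" if h: "P h" and g: "g \<in> carrier G" for h g
  proof (rule antisym[OF _ q_inv_le[OF h g]])
    have "q (\<lambda>x. h (g \<otimes> x)) \<le> q (\<lambda>x. h (g \<otimes> (inv g \<otimes> x)))"
      using q_inv_le[OF P_trans[OF h g] inv_closed[OF g]] .
    also have "\<dots> = q h"
      by (rule q_cong) (use g in \<open>simp flip: m_assoc\<close>)
    finally show "q (\<lambda>x. h (g \<otimes> x)) \<le> q h" .
  qed
  define r where "r h = q (\<lambda>x. max (h x) 0) - q (\<lambda>x. max (- h x) 0)" for h
  have P_parts: "P (\<lambda>x. max (h x) 0)" "P (\<lambda>x. max (- h x) 0)" if h: "bounded (h ` carrier G)" for h
  proof -
    obtain B where B: "\<forall>x\<in>carrier G. \<bar>h x\<bar> \<le> B" using h unfolding bd by blast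
    then show "P (\<lambda>x. max (h x) 0)" "P (\<lambda>x. max (- h x) 0)"
      unfolding P_def bd by (force intro!: exI[of _ B])+
  qed
  \<comment> \<open>The canonical decomposition into positive and negative part may be replaced by any other one.\<close>
  have r_eq: "r h = q u - q v" if u: "P u" and v: "P v" and huv: "\<And>x. x \<in> carrier G \<Longrightarrow> h x = u x - v x" for h u v
  proof -
    obtain A B where "\<forall>x\<in>carrier G. \<bar>u x\<bar> \<le> A" "\<forall>x\<in>carrier G. \<bar>v x\<bar> \<le> B"
      using u v unfolding P_def bd by blast
    then have "bounded (h ` carrier G)"
      unfolding bd using huv
      by (intro exI[of _ "A + B"]) (force intro: order.trans[OF abs_triangle_ineq4] add_mono)
    note p = P_parts[OF this]
    have "q (\<lambda>x. max (h x) 0 + v x) = q (\<lambda>x. max (- h x) 0 + u x)"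
      by (rule q_cong) (use huv in \<open>simp add: max_def\<close>)
    then show ?thesis
      using q_add[OF p(1) v] q_add[OF p(2) u] by (simp add: r_def)
  qed
  have r_add: "r (\<lambda>x. f x + h x) = r f + r h"
    if f: "bounded (f ` carrier G)" and h: "bounded (h ` carrier G)" for f h
  proof -
    note pf = P_parts[OF f] and ph = P_parts[OF h]
    have "r (\<lambda>x. f x + h x) = q (\<lambda>x. max (f x) 0 + max (h x) 0) - q (\<lambda>x. max (- f x) 0 + max (- h x) 0)"
      by (rule r_eq[OF P_add[OF pf(1) ph(1)] P_add[OF pf(2) ph(2)]]) (simp add: max_def)
    then show ?thesis by (simp add: q_add pf ph r_def)
  qed
  have r_scale: "r (\<lambda>x. c * f x) = c * r f" if f: "bounded (f ` carrier G)" for c f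
  proof (cases "0 \<le> c")
    case True
    note pf = P_parts[OF f]
    have "r (\<lambda>x. c * f x) = q (\<lambda>x. c * max (f x) 0) - q (\<lambda>x. c * max (- f x) 0)"
      by (rule r_eq[OF P_scale[OF pf(1) True] P_scale[OF pf(2) True]]) (simp add: max_def)
    then show ?thesis by (simp add: q_scale pf True r_def right_diff_distrib)
  next
    case False
    then have c: "0 \<le> - c" by simp
    note pf = P_parts[OF f]
    have "r (\<lambda>x. c * f x) = q (\<lambda>x. - c * max (- f x) 0) - q (\<lambda>x. - c * max (f x) 0)"
      by (rule r_eq[OF P_scale[OF pf(2) c] P_scale[OF pf(1) c]]) (simp add: max_def)
    also have "\<dots> = c * r f"
      unfolding q_scale[OF pf(2) c] q_scale[OF pf(1) c] r_def by (simp add: algebra_simps)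
    finally show ?thesis .
  qed
  have r_inv: "r (\<lambda>x. f (g \<otimes> x)) = r f" if f: "bounded (f ` carrier G)" and g: "g \<in> carrier G" for f g
    unfolding r_def using q_inv[OF P_parts(1)[OF f] g] q_inv[OF P_parts(2)[OF f] g] by simp
  have r_pos: "0 \<le> r f" if f: "bounded (f ` carrier G)" "\<And>x. x \<in> carrier G \<Longrightarrow> 0 \<le> f x" for f
  proof -
    have "P f" using f by (simp add: P_def)
    from r_eq[OF this P0, of f] q_nonneg[OF this] show ?thesis by (simp add: q0)
  qed
  have P1: "P (\<lambda>_. 1)" by (simp add: P_def bd_const) 
  have "r (\<lambda>_. 1) = q (\<lambda>_. 1)" using r_eq[OF P1 P0, of "\<lambda>_. 1"] by (simp add: q0)
  also have "\<dots> \<ge> 1" using q_upper[OF P1, of "\<lambda>_. 1"] n_one by (simp add: I_def)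
  finally have r1: "r (\<lambda>_. 1) > 0" by simp
  have "left_invariant_mean G (\<lambda>f. r f / r (\<lambda>_. 1))"
    unfolding left_invariant_mean_def Let_def
    using r1 by (simp add: r_add r_scale r_inv r_pos add_divide_distrib)
  then show ?thesis unfolding amenable_group_def using \<open>group G\<close> by blast
qed

section \<open>Left character amenability forces amenable maximal subgroups\<close>

lemma ell1_cdual_eqI:
  assumes "\<And>s. cdual_apply f (delta s) = cdual_apply g (delta s)"
  shows "f = g"
  by (rule cdual_eqI)
    (rule ell1_map_eqI[OF bounded_clinear_cdual_apply bounded_clinear_cdual_apply assms])

text \<open>For an idempotent \<open>e\<close>, the map \<open>s \<mapsto> s * e\<close> retracts the subsemigroup of all \<open>s\<close> lying
  above \<open>e\<close> onto the maximal subgroup at \<open>e\<close>, and the remaining elements form an ideal. Functions on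
  the subgroup are pulled back along it and continued by \<open>0\<close>; the constant \<open>1\<close> becomes a
  multiplicative function on \<open>S\<close>.\<close>

definition subgroup_pullback :: "'s::clifford_semigroup \<Rightarrow> ('s \<Rightarrow> real) \<Rightarrow> 's \<Rightarrow> complex" where
  "subgroup_pullback e h s = (if e * supp s = e then complex_of_real (h (s * e)) else 0)"

abbreviation subgroup_character :: "'s::clifford_semigroup \<Rightarrow> 's ell1 \<Rightarrow> complex" where
  "subgroup_character e \<equiv> ell1_lift (subgroup_pullback e (\<lambda>_. 1))"

lemma subgroup_character:
  fixes e :: "'s::clifford_semigroup"
  assumes e: "e * e = e"
  shows "subgroup_character e \<in> characters" "subgroup_character e (delta e) = 1"
proof -
  show "subgroup_character e \<in> characters"
    by (rule ell1_lift_character[where C = 1 and s = e])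
      (auto simp: subgroup_pullback_def below_supp_mult_iff[OF e] supp_idempotent[OF e] e)
  show "subgroup_character e (delta e) = 1"
    by (simp add: subgroup_pullback_def supp_idempotent[OF e] e)
qed

lemma left_char_amenable_imp_amenable_subgroup:
  fixes e :: "'s::clifford_semigroup"
  assumes e: "e * e = e" and "left_char_amenable (subgroup_character e)"
  shows "amenable_group (maximal_subgroup e)"
proof -
  let ?G = "maximal_subgroup e"
  obtain m :: "'s ell1 cdual cdual" where
    m: "\<And>a f. cdual_apply m (cdual_ract (*) f a) = subgroup_character e a * cdual_apply m f"
    and m1: "cdual_apply m (cdual_of (subgroup_character e)) = 1"
    using assms(2) unfolding left_char_amenable_def by blast
  define F where "F h = cdual_of (ell1_lift (subgroup_pullback e h))" for h
  have in_G: "s * e \<in> carrier ?G" if "e * supp s = e" for s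
    using that by (simp add: carrier_maximal_subgroup supp_mult supp_idempotent[OF e] idempotent_central[OF e])
  have pb: "cmod (subgroup_pullback e h s) \<le> B" if "\<And>x. x \<in> carrier ?G \<Longrightarrow> \<bar>h x\<bar> \<le> B" for h s B
  proof -
    have "e \<in> carrier ?G" by (simp add: carrier_maximal_subgroup supp_idempotent[OF e])
    then have "0 \<le> B" using that[of e] by simp
    then show ?thesis using that[OF in_G] by (simp add: subgroup_pullback_def)
  qed
  have F_apply: "cdual_apply (F h) a = ell1_lift (subgroup_pullback e h) a"
    if h: "bounded (h ` carrier ?G)" for h a
  proof -
    obtain B where "\<forall>x\<in>carrier ?G. \<bar>h x\<bar> \<le> B"
      using h unfolding bounded_real_image_iff by blast
    then show ?thesis
      unfolding F_def by (intro cdual_of_apply bounded_clinear_ell1_lift[where C = B] pb) simp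
  qed
  have bounded_add: "bounded ((\<lambda>x. f x + h x) ` carrier ?G)"
    if "bounded (f ` carrier ?G)" "bounded (h ` carrier ?G)" for f h :: "'s \<Rightarrow> real"
    using that by (rule bounded_plus_comp)
  have bounded_scale: "bounded ((\<lambda>x. c * f x) ` carrier ?G)"
    if "bounded (f ` carrier ?G)" for c and f :: "'s \<Rightarrow> real"
    using bounded_scaleR_comp[OF that, of c] by simp
  show ?thesis
  proof (rule bounded_invariant_functional_imp_amenable[where n = "\<lambda>h. Re (cdual_apply m (F h))"
        and C = "norm m"])
    show "group ?G" by (rule group_maximal_subgroup) (simp add: idempotents_def e)
    fix f h :: "'s \<Rightarrow> real" and c :: real
    assume f: "bounded (f ` carrier ?G)"
    show "Re (cdual_apply m (F (\<lambda>x. c * f x))) = c * Re (cdual_apply m (F f))"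
    proof -
      have "F (\<lambda>x. c * f x) = complex_of_real c *\<^sub>C F f"
        by (rule ell1_cdual_eqI) (simp add: F_apply f bounded_scale subgroup_pullback_def)
      then show ?thesis by (simp add: cdual_apply_arg)
    qed
    assume h: "bounded (h ` carrier ?G)"
    have "F (\<lambda>x. f x + h x) = F f + F h"
      by (rule ell1_cdual_eqI) (simp add: F_apply f h bounded_add subgroup_pullback_def)
    then show "Re (cdual_apply m (F (\<lambda>x. f x + h x)))
        = Re (cdual_apply m (F f)) + Re (cdual_apply m (F h))"
      by (simp add: cdual_apply_arg)
  next
    fix f :: "'s \<Rightarrow> real" and B
    assume B: "\<And>x. x \<in> carrier ?G \<Longrightarrow> \<bar>f x\<bar> \<le> B"
    then have f: "bounded (f ` carrier ?G)" unfolding bounded_real_image_iff by blast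
    have "0 \<le> B" using order.trans[OF norm_ge_zero pb[OF B]] .
    then have "norm (F f) \<le> B"
      by (rule norm_cdual_bound) (simp add: F_apply[OF f] norm_ell1_lift_le pb[OF B])
    then have "cmod (cdual_apply m (F f)) \<le> norm m * B"
      using order.trans[OF norm_cdual_apply mult_left_mono[OF _ norm_ge_zero]] by blast
    then show "Re (cdual_apply m (F f)) \<le> norm m * B"
      using complex_Re_le_cmod order.trans by blast
  next
    fix g and f :: "'s \<Rightarrow> real"
    assume "g \<in> carrier ?G" and f: "bounded (f ` carrier ?G)"
    then have g: "supp g = e" by (simp add: carrier_maximal_subgroup)
    have gf: "bounded ((\<lambda>x. f (g * x)) ` carrier ?G)"
      by (rule bounded_subset[OF f])
        (auto simp: carrier_maximal_subgroup supp_mult g e)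
    have "F (\<lambda>x. f (g * x)) = cdual_ract (*) (F f) (delta g)"
      by (rule ell1_cdual_eqI)
        (simp add: F_apply f gf cdual_ract_mult_apply delta_mult subgroup_pullback_def
          below_supp_mult_iff[OF e] g e mult.assoc)
    moreover have "subgroup_character e (delta g) = 1"
      by (simp add: subgroup_pullback_def g e)
    ultimately show "Re (cdual_apply m (F (\<lambda>x. f (g \<otimes>\<^bsub>?G\<^esub> x)))) = Re (cdual_apply m (F f))"
      by (simp add: m)
  next
    show "Re (cdual_apply m (F (\<lambda>_. 1))) = 1" by (simp add: F_def m1)
  qed
qed

section \<open>Orthogonal central idempotents of the semigroup algebra\<close>

definition idempotents_below :: "'s::clifford_semigroup \<Rightarrow> 's set" where
  "idempotents_below e = {f. f * f = f \<and> f * e = f}"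

lemma idempotents_below_mono:
  "f \<in> idempotents_below e \<Longrightarrow> idempotents_below f \<subseteq> idempotents_below e"
  by (auto simp: idempotents_below_def) (metis mult.assoc)

lemma idempotents_below_self: "e * e = e \<Longrightarrow> e \<in> idempotents_below e"
  by (simp add: idempotents_below_def)

lemma idempotents_below_psubset:
  assumes "e * e = e" "f \<in> idempotents_below e" "f \<noteq> e"
  shows "idempotents_below f \<subset> idempotents_below e"
proof -
  have "e \<notin> idempotents_below f"
    using assms idempotent_central[of e f] by (auto simp: idempotents_below_def)
  then show ?thesis
    using idempotents_below_mono[OF assms(2)] idempotents_below_self[OF assms(1)] by blast
qed

text \<open>Moebius inversion of \<open>delta e = (\<Sum>f\<le>e. primitive_idempotent f)\<close> over the semilattice of
  idempotents. Multiplication by \<open>primitive_idempotent e\<close> cuts the summand \<open>\<ell>\<^sup>1(G\<^sub>e)\<close> out of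
  \<open>\<ell>\<^sup>1(S)\<close>. The index set is empty unless \<open>e\<close> is an idempotent with finitely many idempotents
  below it, so that the recursion terminates.\<close>

function primitive_idempotent :: "'s::clifford_semigroup \<Rightarrow> 's ell1" where
  "primitive_idempotent e = delta e -
     (\<Sum>f\<in>{f \<in> idempotents_below e. e * e = e \<and> finite (idempotents_below e) \<and> f \<noteq> e}.
       primitive_idempotent f)"
  by auto
termination
  by (relation "measure (\<lambda>e. card (idempotents_below e))")
    (auto intro!: psubset_card_mono dest: idempotents_below_psubset)

declare primitive_idempotent.simps [simp del]

lemma primitive_idempotent_eq:
  assumes "e * e = e" "finite (idempotents_below e)"
  shows "primitive_idempotent e = delta e - (\<Sum>f\<in>idempotents_below e - {e}. primitive_idempotent f)"
proof -
  have "{f \<in> idempotents_below e. e * e = e \<and> finite (idempotents_below e) \<and> f \<noteq> e}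
      = idempotents_below e - {e}"
    using assms by auto
  then show ?thesis by (subst primitive_idempotent.simps) (simp only:)
qed

lemma delta_eq_sum_primitive_idempotents:
  assumes "e * e = e" "finite (idempotents_below e)"
  shows "delta e = (\<Sum>f\<in>idempotents_below e. primitive_idempotent f)"
  using primitive_idempotent_eq[OF assms]
    sum.remove[OF assms(2) idempotents_below_self[OF assms(1)], of primitive_idempotent] by simp

lemma idempotent_induct [consumes 2, case_names step]:
  fixes e :: "'s::clifford_semigroup"
  assumes "e * e = e" "finite (idempotents_below e)"
    and "\<And>e. e * e = e \<Longrightarrow> finite (idempotents_below e) \<Longrightarrow>
      (\<And>f. f \<in> idempotents_below e - {e} \<Longrightarrow> P f) \<Longrightarrow> P e"
  shows "P e"
  using assms(1,2)
proof (induct "card (idempotents_below e)" arbitrary: e rule: less_induct)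
  case less
  show ?case
  proof (rule assms(3)[OF less.prems])
    fix f assume f: "f \<in> idempotents_below e - {e}"
    then have f': "idempotents_below f \<subset> idempotents_below e"
      using idempotents_below_psubset[OF less.prems(1)] by simp
    show "P f"
    proof (rule less.hyps)
      show "card (idempotents_below f) < card (idempotents_below e)"
        by (rule psubset_card_mono[OF less.prems(2) f'])
      show "f * f = f" using f by (simp add: idempotents_below_def)
      show "finite (idempotents_below f)"
        by (rule finite_subset[OF psubset_imp_subset[OF f'] less.prems(2)])
    qed
  qed
qed

lemma primitive_idempotent_central:
  assumes "e * e = e" "finite (idempotents_below e)"
  shows "delta s * primitive_idempotent e = primitive_idempotent e * delta s"
  using assms
proof (induct rule: idempotent_induct)
  case (step e)
  show ?case
    by (simp add: primitive_idempotent_eq[OF step(1,2)] algebra_simps sum_distrib_left sum_distrib_right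
        delta_mult idempotent_central[OF step(1)] step(3))
qed

text \<open>Multiplying the recursion by \<open>delta f\<close> keeps, by induction, the terms below \<open>f\<close>. If \<open>e\<close> is not
  below \<open>f\<close>, these are all idempotents below \<open>e * f\<close>, and they sum to \<open>delta (e * f)\<close>.\<close>

lemma delta_mult_primitive_idempotent:
  assumes "e * e = e" "finite (idempotents_below e)" and f: "f * f = f"
  shows "delta f * primitive_idempotent e = (if e * f = e then primitive_idempotent e else 0)"
  using assms(1,2)
proof (induct rule: idempotent_induct)
  case (step e)
  note e = step(1)
  have fe: "f * e = e * f" by (rule idempotent_central[OF f])
  have "delta f * primitive_idempotent e
      = delta (e * f) - (\<Sum>g\<in>idempotents_below e - {e}. delta f * primitive_idempotent g)"
    by (simp add: primitive_idempotent_eq[OF step(1,2)] right_diff_distrib delta_mult fe sum_distrib_left)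
  also have "(\<Sum>g\<in>idempotents_below e - {e}. delta f * primitive_idempotent g)
      = (\<Sum>g\<in>idempotents_below e - {e}. if g * f = g then primitive_idempotent g else 0)"
    by (rule sum.cong) (simp_all add: step(3))
  finally have eq: "delta f * primitive_idempotent e = delta (e * f)
      - (\<Sum>g\<in>idempotents_below e - {e}. if g * f = g then primitive_idempotent g else 0)" .
  show ?case
  proof (cases "e * f = e")
    case True
    have "g * f = g" if "g \<in> idempotents_below e" for g
    proof -
      have "g * f = (g * e) * f" using that by (simp add: idempotents_below_def)
      also have "\<dots> = g * (e * f)" by (rule mult.assoc)
      also have "\<dots> = g" using that True by (simp add: idempotents_below_def)
      finally show ?thesis .
    qed
    then show ?thesis
      unfolding eq by (simp add: True primitive_idempotent_eq[OF step(1,2)])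
  next
    case False
    have ef: "e * f * (e * f) = e * f"
      by (metis e f fe mult.assoc)
    have "g * e = g \<and> g * f = g \<longleftrightarrow> g * (e * f) = g" if "g * g = g" for g
      by (metis e f fe mult.assoc)
    then have below: "{g \<in> idempotents_below e - {e}. g * f = g} = idempotents_below (e * f)"
      using False by (auto simp: idempotents_below_def)
    have sum: "(\<Sum>g\<in>idempotents_below e - {e}. if g * f = g then primitive_idempotent g else 0)
        = (\<Sum>g\<in>idempotents_below (e * f). primitive_idempotent g)"
      unfolding below[symmetric] by (rule sum.inter_filter[symmetric]) (use step(2) in simp)
    have "finite (idempotents_below (e * f))"
      unfolding below[symmetric] using step(2) by simp
    from delta_eq_sum_primitive_idempotents[OF ef this] show ?thesis
      unfolding eq sum using False by simp
  qed
qed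

lemma delta_mult_primitive_idempotent_eq_0:
  assumes "e * e = e" "finite (idempotents_below e)" "e * supp s \<noteq> e"
  shows "delta s * primitive_idempotent e = 0"
proof -
  have "delta s * primitive_idempotent e = delta s * (delta (supp s) * primitive_idempotent e)"
    by (simp add: delta_mult flip: mult.assoc)
  then show ?thesis using assms by (simp add: delta_mult_primitive_idempotent)
qed

lemma delta_self_mult_primitive_idempotent:
  assumes "e * e = e" "finite (idempotents_below e)"
  shows "delta (s * e) * primitive_idempotent e = delta s * primitive_idempotent e"
  by (simp add: delta_mult_primitive_idempotent[OF assms assms(1)] assms(1) mult.assoc flip: delta_mult)

lemma primitive_idempotent_idem:
  assumes e: "e * e = e" and fin: "finite (idempotents_below e)"
  shows "primitive_idempotent e * primitive_idempotent e = primitive_idempotent e"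
proof -
  have "primitive_idempotent f * primitive_idempotent e = 0" if f: "f \<in> idempotents_below e - {e}" for f
  proof -
    have ff: "f * f = f" and ef: "e * f \<noteq> e"
      using f idempotent_central[OF e, of f] by (auto simp: idempotents_below_def)
    have finf: "finite (idempotents_below f)"
      using f idempotents_below_mono finite_subset[OF _ fin] by blast
    have "primitive_idempotent f = primitive_idempotent f * delta f"
      by (simp add: delta_mult_primitive_idempotent[OF ff finf ff] ff
          flip: primitive_idempotent_central[OF ff finf])
    then have "primitive_idempotent f * primitive_idempotent e
        = primitive_idempotent f * (delta f * primitive_idempotent e)"
      by (metis mult.assoc)
    then show ?thesis using ef by (simp add: delta_mult_primitive_idempotent[OF e fin ff])
  qed
  then have "(delta e - (\<Sum>f\<in>idempotents_below e - {e}. primitive_idempotent f)) * primitive_idempotent e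
      = delta e * primitive_idempotent e"
    by (simp add: left_diff_distrib sum_distrib_right)
  then show ?thesis
    by (simp add: delta_mult_primitive_idempotent[OF e fin e] e flip: primitive_idempotent_eq[OF e fin])
qed

text \<open>With \<open>n\<close> idempotents strictly below \<open>e\<close>, the recursion bounds the norm by
  \<open>1 + n * n! \<le> (n + 1)!\<close>. The bound depends on the number of idempotents below \<open>e\<close> only, so it
  is uniform in \<open>e\<close> for a uniformly locally finite semilattice.\<close>

lemma norm_primitive_idempotent_le:
  assumes "e * e = e" "finite (idempotents_below e)"
  shows "norm (primitive_idempotent e) \<le> fact (card (idempotents_below e))"
  using assms
proof (induct rule: idempotent_induct)
  case (step e)
  let ?B = "idempotents_below e"
  obtain n where n: "card ?B = Suc n"
    using idempotents_below_self[OF step(1)] step(2) by (metis card_Suc_Diff1)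
  have "norm (primitive_idempotent f) \<le> fact n" if f: "f \<in> ?B - {e}" for f
  proof -
    have "card (idempotents_below f) < card ?B"
      using f by (intro psubset_card_mono[OF step(2)] idempotents_below_psubset[OF step(1)]) auto
    then have "(fact (card (idempotents_below f)) :: real) \<le> fact n"
      using n by (intro fact_mono) simp
    then show ?thesis using step(3)[OF f] by simp
  qed
  then have "norm (\<Sum>f\<in>?B - {e}. primitive_idempotent f) \<le> real (card (?B - {e})) * fact n"
    by (intro order.trans[OF norm_sum] sum_bounded_above) 
  also have "card (?B - {e}) = n"
    using n idempotents_below_self[OF step(1)] by simp
  finally have "norm (primitive_idempotent e) \<le> 1 + real n * fact n"
    using norm_triangle_ineq4[of "delta e" "\<Sum>f\<in>?B - {e}. primitive_idempotent f"]
    by (simp add: primitive_idempotent_eq[OF step(1,2)])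
  also have "\<dots> \<le> fact (Suc n)"
    using fact_ge_1[of n, where ?'a = real] by (simp add: algebra_simps)
  finally show ?case by (simp add: n)
qed

section \<open>Complex-valued invariant means\<close>

lemma bounded_Re_Im_image:
  fixes f :: "'g \<Rightarrow> complex"
  assumes "bounded (f ` A)"
  shows "bounded ((\<lambda>x. Re (f x)) ` A)" "bounded ((\<lambda>x. Im (f x)) ` A)"
  using bounded_linear_image[OF assms bounded_linear_Re] bounded_linear_image[OF assms bounded_linear_Im]
  by (simp_all add: image_image)

text \<open>The factor \<open>2\<close> comes from bounding real and imaginary part separately. Values off the
  carrier are arbitrary, so invariance is stated for functions that are translates on the
  carrier only.\<close>

lemma amenable_group_complex_mean:
  fixes G (structure)
  assumes "amenable_group G"
  obtains \<mu> :: "('g \<Rightarrow> complex) \<Rightarrow> complex" where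
    "\<And>f h. bounded (f ` carrier G) \<Longrightarrow> bounded (h ` carrier G) \<Longrightarrow> \<mu> (\<lambda>x. f x + h x) = \<mu> f + \<mu> h"
    "\<And>c f. bounded (f ` carrier G) \<Longrightarrow> \<mu> (\<lambda>x. c * f x) = c * \<mu> f"
    "\<And>f B. (\<And>x. x \<in> carrier G \<Longrightarrow> cmod (f x) \<le> B) \<Longrightarrow> cmod (\<mu> f) \<le> 2 * B"
    "\<And>f c. (\<And>x. x \<in> carrier G \<Longrightarrow> f x = c) \<Longrightarrow> \<mu> f = c"
    "\<And>g f h. g \<in> carrier G \<Longrightarrow> bounded (f ` carrier G) \<Longrightarrow>
      (\<And>x. x \<in> carrier G \<Longrightarrow> h x = f (g \<otimes>\<^bsub>G\<^esub> x)) \<Longrightarrow> \<mu> h = \<mu> f"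
proof -
  interpret group G using assms by (simp add: amenable_group_def)
  obtain m where lim: "left_invariant_mean G m" using assms by (auto simp: amenable_group_def)
  let ?L = "\<lambda>f. bounded (f ` carrier G)"
  have add: "m (\<lambda>x. f x + h x) = m f + m h" if "?L f" "?L h" for f h
    using lim that by (simp add: left_invariant_mean_def Let_def)
  have scale: "m (\<lambda>x. c * f x) = c * m f" if "?L f" for c f
    using lim that by (simp add: left_invariant_mean_def Let_def)
  have pos: "0 \<le> m f" if "?L f" "\<And>x. x \<in> carrier G \<Longrightarrow> 0 \<le> f x" for f
    using lim that by (simp add: left_invariant_mean_def Let_def)
  have one: "m (\<lambda>_. 1) = 1" using lim by (simp add: left_invariant_mean_def Let_def)
  have inv: "m (\<lambda>x. f (g \<otimes> x)) = m f" if "?L f" "g \<in> carrier G" for f g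
    using lim that by (simp add: left_invariant_mean_def Let_def)
  have L_const: "?L (\<lambda>_. c)" for c :: real unfolding bounded_real_image_iff by blast
  have L_scale: "?L (\<lambda>x. c * f x)" if "?L f" for c :: real and f
    using bounded_scaleR_comp[OF that, of c] by simp
  have const: "m (\<lambda>_. c) = c" for c using scale[OF L_const, of c 1] one by simp
  have mono: "m f \<le> m h" if f: "?L f" and h: "?L h" and le: "\<And>x. x \<in> carrier G \<Longrightarrow> f x \<le> h x" for f h
  proof -
    have "0 \<le> m (\<lambda>x. h x + (- 1) * f x)"
      by (rule pos[OF bounded_plus_comp[OF h L_scale[OF f]]]) (use le in simp)
    also have "\<dots> = m h - m f"
      unfolding add[OF h L_scale[OF f]] scale[OF f] by simp
    finally show ?thesis by simp
  qed
  have le: "\<bar>m f\<bar> \<le> B" if B: "\<And>x. x \<in> carrier G \<Longrightarrow> \<bar>f x\<bar> \<le> B" for f B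
  proof -
    have f: "?L f" unfolding bounded_real_image_iff using B by blast
    have "m f \<le> m (\<lambda>_. B)" "m (\<lambda>_. - B) \<le> m f"
      by (rule mono[OF f L_const] mono[OF L_const f]; use B in \<open>force simp: abs_le_iff\<close>)+
    then show ?thesis by (simp add: const)
  qed
  have cong: "m f = m h" if f: "?L f" and fh: "\<And>x. x \<in> carrier G \<Longrightarrow> h x = f x" for f h
  proof -
    have h: "?L h" using f fh by (simp cong: image_cong)
    show ?thesis by (rule antisym) (rule mono; use f h fh in simp)+
  qed
  define \<mu> where "\<mu> f = Complex (m (\<lambda>x. Re (f x))) (m (\<lambda>x. Im (f x)))" for f
  note RI = bounded_Re_Im_image
  show ?thesis
  proof
    fix f h :: "'g \<Rightarrow> complex" and c :: complex
    assume f: "bounded (f ` carrier G)"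
    show "\<mu> (\<lambda>x. c * f x) = c * \<mu> f"
    proof (rule complex_eqI)
      have "m (\<lambda>x. Re c * Re (f x) + (- Im c) * Im (f x)) = Re c * m (\<lambda>x. Re (f x)) + (- Im c) * m (\<lambda>x. Im (f x))"
        by (simp only: add scale L_scale RI[OF f])
      then show "Re (\<mu> (\<lambda>x. c * f x)) = Re (c * \<mu> f)" by (simp add: \<mu>_def)
      have "m (\<lambda>x. Re c * Im (f x) + Im c * Re (f x)) = Re c * m (\<lambda>x. Im (f x)) + Im c * m (\<lambda>x. Re (f x))"
        by (simp only: add scale L_scale RI[OF f])
      then show "Im (\<mu> (\<lambda>x. c * f x)) = Im (c * \<mu> f)" by (simp add: \<mu>_def)
    qed
    assume h: "bounded (h ` carrier G)"
    show "\<mu> (\<lambda>x. f x + h x) = \<mu> f + \<mu> h"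
      by (simp add: \<mu>_def complex_eq_iff add RI[OF f] RI[OF h])
  next
    fix f :: "'g \<Rightarrow> complex" and B
    assume B: "\<And>x. x \<in> carrier G \<Longrightarrow> cmod (f x) \<le> B"
    have "\<bar>m (\<lambda>x. Re (f x))\<bar> \<le> B" "\<bar>m (\<lambda>x. Im (f x))\<bar> \<le> B"
      by (rule le, rule order.trans[OF _ B], simp_all add: abs_Re_le_cmod abs_Im_le_cmod)+
    then show "cmod (\<mu> f) \<le> 2 * B" using cmod_le[of "\<mu> f"] by (simp add: \<mu>_def)
  next
    fix f :: "'g \<Rightarrow> complex" and c
    assume "\<And>x. x \<in> carrier G \<Longrightarrow> f x = c"
    then show "\<mu> f = c"
      using cong[OF L_const, of "\<lambda>x. Re (f x)" "Re c"] cong[OF L_const, of "\<lambda>x. Im (f x)" "Im c"]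
      by (simp add: \<mu>_def const complex_eq_iff)
  next
    fix g and f h :: "'g \<Rightarrow> complex"
    assume g: "g \<in> carrier G" and f: "bounded (f ` carrier G)"
      and h: "\<And>x. x \<in> carrier G \<Longrightarrow> h x = f (g \<otimes> x)"
    have fg: "bounded ((\<lambda>x. f (g \<otimes> x)) ` carrier G)"
      by (rule bounded_subset[OF f]) (use g in auto)
    show "\<mu> h = \<mu> f"
      using cong[OF RI(1)[OF fg], of "\<lambda>x. Re (h x)"] cong[OF RI(2)[OF fg], of "\<lambda>x. Im (h x)"]
        inv[OF RI(1)[OF f] g] inv[OF RI(2)[OF f] g] by (simp add: \<mu>_def h)
  qed
qed

section \<open>Biflatness from invariant means\<close>

text \<open>Averaging \<open>p * g \<otimes> g\<^sup>\<star> * p\<close> over the amenable group \<open>G\<^sub>e\<close>, where \<open>p\<close> is the idempotent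
  cutting out \<open>\<ell>\<^sup>1(G\<^sub>e)\<close>, yields Johnson's virtual diagonal of \<open>\<ell>\<^sup>1(G\<^sub>e)\<close>, seen as an
  element of the second dual of the tensor square of \<open>\<ell>\<^sup>1(S)\<close>. An element \<open>t\<close> above \<open>e\<close> acts
  through \<open>t * e \<in> G\<^sub>e\<close>, and invariance of the mean moves it across the tensor sign; any other \<open>t\<close>
  annihilates \<open>p\<close>.\<close>

lemma virtual_diagonal_of_subgroup:
  fixes e :: "'s::clifford_semigroup"
  assumes e: "e * e = e" and fin: "finite (idempotents_below e)"
    and "amenable_group (maximal_subgroup e)"
  obtains M :: "('s ell1, 's ell1) ptensor cdual cdual" where
    "\<And>t. tensor_lact (delta t) M = tensor_ract M (delta t)"
    "\<And>t. e * supp t \<noteq> e \<Longrightarrow> tensor_lact (delta t) M = 0"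
    "tensor_bidual_mult M = canonical (primitive_idempotent e)"
    "norm M \<le> 2 * (norm (primitive_idempotent e))\<^sup>2"
proof -
  let ?G = "carrier (maximal_subgroup e)" and ?p = "primitive_idempotent e"
  obtain \<mu> :: "('s \<Rightarrow> complex) \<Rightarrow> complex" where
    add: "\<And>f h. bounded (f ` ?G) \<Longrightarrow> bounded (h ` ?G) \<Longrightarrow> \<mu> (\<lambda>x. f x + h x) = \<mu> f + \<mu> h"
    and scale: "\<And>c f. bounded (f ` ?G) \<Longrightarrow> \<mu> (\<lambda>x. c * f x) = c * \<mu> f"
    and bound: "\<And>f B. (\<And>x. x \<in> ?G \<Longrightarrow> cmod (f x) \<le> B) \<Longrightarrow> cmod (\<mu> f) \<le> 2 * B"
    and const: "\<And>f c. (\<And>x. x \<in> ?G \<Longrightarrow> f x = c) \<Longrightarrow> \<mu> f = c"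
    and inv: "\<And>g f h. g \<in> ?G \<Longrightarrow> bounded (f ` ?G) \<Longrightarrow>
      (\<And>x. x \<in> ?G \<Longrightarrow> h x = f (g * x)) \<Longrightarrow> \<mu> h = \<mu> f"
  proof (rule amenable_group_complex_mean[OF assms(3), unfolded mult_maximal_subgroup], goal_cases)
    case (1 \<mu>)
    show ?thesis by (rule that) (fact 1)+
  qed
  define \<tau> where "\<tau> g = elem_tensor (?p * delta g) (delta (g\<^sup>\<star>) * ?p)" for g
  have norm_\<tau>: "norm (\<tau> g) \<le> (norm ?p)\<^sup>2" for g
  proof -
    have "norm (?p * delta g) \<le> norm ?p" "norm (delta (g\<^sup>\<star>) * ?p) \<le> norm ?p"
      using norm_mult_ineq[of ?p "delta g"] norm_mult_ineq[of "delta (g\<^sup>\<star>)" ?p] by simp_all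
    then have "norm (?p * delta g) * norm (delta (g\<^sup>\<star>) * ?p) \<le> norm ?p * norm ?p"
      by (rule mult_mono) simp_all
    then show ?thesis
      unfolding \<tau>_def power2_eq_square by (rule order.trans[OF norm_elem_tensor])
  qed
  have T_bound: "cmod (cdual_apply T (\<tau> g)) \<le> norm T * (norm ?p)\<^sup>2" for T g
    by (rule order.trans[OF norm_cdual_apply mult_left_mono[OF norm_\<tau>]]) simp
  have T_bounded: "bounded ((\<lambda>g. cdual_apply T (\<tau> g)) ` ?G)" for T
    unfolding bounded_iff using T_bound by blast
  define M where "M = cdual_of (\<lambda>T. \<mu> (\<lambda>g. cdual_apply T (\<tau> g)))"
  have norm_\<mu>: "cmod (\<mu> (\<lambda>g. cdual_apply T (\<tau> g))) \<le> 2 * (norm ?p)\<^sup>2 * norm T" for T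
    using bound[of "\<lambda>g. cdual_apply T (\<tau> g)", OF T_bound] by (simp add: mult_ac)
  have M: "cdual_apply M T = \<mu> (\<lambda>g. cdual_apply T (\<tau> g))" for T
    unfolding M_def
    by (rule cdual_of_apply, rule bounded_clinearI[where K = "2 * (norm ?p)\<^sup>2"])
      (simp_all add: add scale T_bounded norm_\<mu> scaleC_complex_def)
  note central = primitive_idempotent_central[OF e fin]
  note absorb = delta_self_mult_primitive_idempotent[OF e fin]
  note annihilate = delta_mult_primitive_idempotent_eq_0[OF e fin]
  have lact: "cdual_apply (tensor_lact a M) T
      = \<mu> (\<lambda>g. cdual_apply T (elem_tensor (a * ?p * delta g) (delta (g\<^sup>\<star>) * ?p)))" for a T
    by (simp add: ptensor_bidual_lact_apply M \<tau>_def mult.assoc)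
  have ract: "cdual_apply (tensor_ract M a) T
      = \<mu> (\<lambda>g. cdual_apply T (elem_tensor (?p * delta g) (delta (g\<^sup>\<star>) * ?p * a)))" for a T
    by (simp add: ptensor_bidual_ract_apply M \<tau>_def)
  show ?thesis
  proof
    show zero: "tensor_lact (delta t) M = 0" if "e * supp t \<noteq> e" for t
      by (rule cdual_eqI) (simp add: lact annihilate[OF that] cdual_apply_linear const)
    show "tensor_lact (delta t) M = tensor_ract M (delta t)" for t
    proof (cases "e * supp t = e")
      case False
      have "tensor_ract M (delta t) = 0"
        by (rule cdual_eqI)
          (simp add: ract mult.assoc annihilate[OF False] cdual_apply_linear const flip: central)
      then show ?thesis by (simp add: zero[OF False])
    next
      case True
      define u where "u = t * e"
      have u: "supp u = e"
        by (simp add: u_def supp_mult supp_idempotent[OF e] supp_central[of t e] True)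
      have uG: "u \<in> ?G" by (simp add: carrier_maximal_subgroup u)
      have uu: "u\<^sup>\<star> * u = e" using u by (simp add: supp_def star_commute)
      show ?thesis
      proof (rule cdual_eqI)
        fix T
        let ?f = "\<lambda>g. cdual_apply T (elem_tensor (?p * delta g) (delta (g\<^sup>\<star>) * ?p * delta t))"
        have "?f = (\<lambda>g. cdual_apply (cdual_lact ptensor_ract (delta t) T) (\<tau> g))"
          by (simp add: \<tau>_def)
        then have f: "bounded (?f ` ?G)" by (simp only: T_bounded)
        have "\<mu> (\<lambda>g. cdual_apply T (elem_tensor (delta t * ?p * delta g) (delta (g\<^sup>\<star>) * ?p))) = \<mu> ?f"
        proof (rule inv[OF uG f])
          fix g assume "g \<in> ?G"
          have "?p * delta (u * g) = delta u * ?p * delta g"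
            by (simp add: central mult.assoc flip: delta_mult)
          also have "delta u * ?p = delta t * ?p" unfolding u_def by (rule absorb)
          finally have 1: "?p * delta (u * g) = delta t * ?p * delta g" .
          have "delta (u\<^sup>\<star>) * ?p * delta t = delta (u\<^sup>\<star>) * (delta t * ?p)"
            by (simp only: central[of t] mult.assoc)
          also have "delta t * ?p = delta u * ?p" unfolding u_def by (rule absorb[symmetric])
          also have "delta (u\<^sup>\<star>) * (delta u * ?p) = delta (u\<^sup>\<star> * u) * ?p"
            by (simp only: mult.assoc flip: delta_mult)
          also have "\<dots> = ?p"
            unfolding uu by (simp add: delta_mult_primitive_idempotent[OF e fin e] e)
          finally have 2: "delta (u\<^sup>\<star>) * ?p * delta t = ?p" .
          have "delta ((u * g)\<^sup>\<star>) * ?p * delta t = delta (g\<^sup>\<star>) * (delta (u\<^sup>\<star>) * ?p * delta t)"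
            by (simp only: star_mult mult.assoc flip: delta_mult)
          then have "delta ((u * g)\<^sup>\<star>) * ?p * delta t = delta (g\<^sup>\<star>) * ?p" by (simp only: 2)
          then show "cdual_apply T (elem_tensor (delta t * ?p * delta g) (delta (g\<^sup>\<star>) * ?p)) = ?f (u * g)"
            by (simp only: 1)
        qed
        then show "cdual_apply (tensor_lact (delta t) M) T = cdual_apply (tensor_ract M (delta t)) T"
          by (simp only: lact ract)
      qed
    qed
    show "tensor_bidual_mult M = canonical ?p"
    proof (rule cdual_eqI)
      fix f :: "'s ell1 cdual"
      have "?p * delta g * (delta (g\<^sup>\<star>) * ?p) = ?p" if "g \<in> ?G" for g
      proof -
        have "?p * delta g * (delta (g\<^sup>\<star>) * ?p) = ?p * (delta (g * g\<^sup>\<star>) * ?p)"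
          by (simp only: mult.assoc flip: delta_mult)
        also have "g * g\<^sup>\<star> = e" using that by (simp add: carrier_maximal_subgroup supp_def)
        finally show ?thesis
          by (simp add: delta_mult_primitive_idempotent[OF e fin e] e primitive_idempotent_idem[OF e fin])
      qed
      then have "\<mu> (\<lambda>g. cdual_apply f (?p * delta g * (delta (g\<^sup>\<star>) * ?p))) = cdual_apply f ?p"
        by (intro const) simp
      then show "cdual_apply (tensor_bidual_mult M) f = cdual_apply (canonical ?p) f"
        by (simp add: bidual_ptensor_mult_apply M \<tau>_def canonical_apply)
    qed
    show "norm M \<le> 2 * (norm ?p)\<^sup>2"
      by (rule norm_cdual_bound) (simp_all add: M norm_\<mu>)
  qed
qed

text \<open>The splitting map sends \<open>\<delta>\<^sub>s\<close> to the sum of \<open>\<delta>\<^sub>s \<cdot> M\<^sub>e\<close> over all idempotents \<open>e\<close> below \<open>s\<close>.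
  Uniform local finiteness bounds both the number of summands and the norms of the \<open>M\<^sub>e\<close>, so
  this extends to a bounded map on \<open>\<ell>\<^sup>1(S)\<close>. Summing over too many \<open>e\<close> does no harm
  because \<open>\<delta>\<^sub>t\<close> annihilates \<open>M\<^sub>e\<close> when \<open>t\<close> is not above \<open>e\<close>; this reconciles the different
  index sets in the module identities.\<close>

lemma amenable_subgroups_imp_biflat:
  assumes fin: "\<And>e :: 's. e * e = e \<Longrightarrow> finite (idempotents_below e)"
    and card: "\<And>e :: 's. e * e = e \<Longrightarrow> card (idempotents_below e) \<le> N"
    and amenable: "\<And>e :: 's. e * e = e \<Longrightarrow> amenable_group (maximal_subgroup e)"
  shows "biflat TYPE('s::clifford_semigroup ell1)"
proof -
  have "\<forall>e :: 's. e * e = e \<longrightarrow> (\<exists>M :: ('s ell1, 's ell1) ptensor cdual cdual.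
      (\<forall>t. tensor_lact (delta t) M = tensor_ract M (delta t)) \<and>
      (\<forall>t. e * supp t \<noteq> e \<longrightarrow> tensor_lact (delta t) M = 0) \<and>
      tensor_bidual_mult M = canonical (primitive_idempotent e) \<and>
      norm M \<le> 2 * (norm (primitive_idempotent e))\<^sup>2)"
  proof (intro allI impI)
    fix e :: 's assume e: "e * e = e"
    show "\<exists>M :: ('s ell1, 's ell1) ptensor cdual cdual.
        (\<forall>t. tensor_lact (delta t) M = tensor_ract M (delta t)) \<and>
        (\<forall>t. e * supp t \<noteq> e \<longrightarrow> tensor_lact (delta t) M = 0) \<and>
        tensor_bidual_mult M = canonical (primitive_idempotent e) \<and>
        norm M \<le> 2 * (norm (primitive_idempotent e))\<^sup>2"
      by (rule virtual_diagonal_of_subgroup[OF e fin[OF e] amenable[OF e]]) blast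
  qed
  then obtain M :: "'s \<Rightarrow> ('s ell1, 's ell1) ptensor cdual cdual" where
    commute: "\<And>e t. e * e = e \<Longrightarrow> tensor_lact (delta t) (M e) = tensor_ract (M e) (delta t)"
    and zero: "\<And>e t. e * e = e \<Longrightarrow> e * supp t \<noteq> e \<Longrightarrow> tensor_lact (delta t) (M e) = 0"
    and mult: "\<And>e. e * e = e \<Longrightarrow> tensor_bidual_mult (M e) = canonical (primitive_idempotent e)"
    and norm_M: "\<And>e. e * e = e \<Longrightarrow> norm (M e) \<le> 2 * (norm (primitive_idempotent e))\<^sup>2"
    by metis
  have idem: "e * e = e" if "e \<in> idempotents_below s" for e s :: 's
    using that by (simp add: idempotents_below_def)
  define k where "k s = (\<Sum>e\<in>idempotents_below (supp s). tensor_lact (delta s) (M e))" for s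
  have norm_k: "norm (k s) \<le> real N * (2 * (fact N)\<^sup>2)" for s
  proof -
    have "norm (tensor_lact (delta s) (M e)) \<le> 2 * (fact N)\<^sup>2" if "e \<in> idempotents_below (supp s)" for e
    proof -
      note e = idem[OF that]
      have "norm (tensor_lact (delta s) (M e)) \<le> norm (M e)"
        using norm_tensor_lact_le[of "delta s" "M e"] by simp
      also have "\<dots> \<le> 2 * (norm (primitive_idempotent e))\<^sup>2" by (rule norm_M[OF e])
      also have "\<dots> \<le> 2 * (fact N)\<^sup>2"
        using order.trans[OF norm_primitive_idempotent_le[OF e fin[OF e]] fact_mono[OF card[OF e]]]
        by (simp add: power_mono)
      finally show ?thesis .
    qed
    then have "norm (k s) \<le> real (card (idempotents_below (supp s))) * (2 * (fact N)\<^sup>2)"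
      unfolding k_def by (intro order.trans[OF norm_sum] sum_bounded_above)
    also have "\<dots> \<le> real N * (2 * (fact N)\<^sup>2)"
      by (intro mult_right_mono) (simp_all add: card)
    finally show ?thesis .
  qed
  define \<rho> where "\<rho> = ell1_lift k"
  have \<rho>: "bounded_clinear \<rho>" unfolding \<rho>_def by (rule bounded_clinear_ell1_lift[OF norm_k])
  have \<rho>_delta: "\<rho> (delta s) = k s" for s by (simp add: \<rho>_def)
  have extend: "(\<Sum>e\<in>idempotents_below (supp u). tensor_lact (delta (s * t)) (M e)) = k (s * t)"
    if u: "idempotents_below (supp (s * t)) \<subseteq> idempotents_below (supp u)" for s t u
    unfolding k_def
  proof (rule sum.mono_neutral_right[OF _ u])
    show "\<forall>e\<in>idempotents_below (supp u) - idempotents_below (supp (s * t)).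
        tensor_lact (delta (s * t)) (M e) = 0"
      by (intro ballI zero) (simp_all add: idempotents_below_def)
  qed (simp add: fin)
  have "supp (s * t) * supp s = supp (s * t)" "supp (s * t) * supp t = supp (s * t)" for s t :: 's
    by (metis mult.assoc supp_central supp_idem supp_mult)+
  then have below: "idempotents_below (supp (s * t)) \<subseteq> idempotents_below (supp s)"
    "idempotents_below (supp (s * t)) \<subseteq> idempotents_below (supp t)" for s t :: 's
    by (intro idempotents_below_mono; simp add: idempotents_below_def)+
  have left: "k (s * t) = tensor_lact (delta s) (k t)" for s t
    unfolding k_def[of t] bounded_clinearD(5)[OF bounded_clinear_tensor_lact(2)]
    using extend[OF below(2), of s t] by (simp add: tensor_lact_simps(3) flip: delta_mult)
  have right: "k (s * t) = tensor_ract (k s) (delta t)" for s t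
    unfolding k_def[of s] bounded_clinearD(5)[OF bounded_clinear_tensor_ract(2)]
    using extend[OF below(1), of s t]
    by (simp add: tensor_lact_ract idem tensor_lact_simps(3) flip: delta_mult commute cong: sum.cong)
  have "\<rho> (a * b) = tensor_lact a (\<rho> b)" for a b
    by (rule ell1_bilinear_eqI[where B = "\<lambda>a b. \<rho> (a * b)" and B' = "\<lambda>a b. tensor_lact a (\<rho> b)"])
      (simp_all add: delta_mult \<rho>_delta left
        bounded_clinear_compose[OF \<rho> bounded_clinear_mult_left]
        bounded_clinear_compose[OF \<rho> bounded_clinear_mult_right]
        bounded_clinear_tensor_lact(1) bounded_clinear_compose[OF bounded_clinear_tensor_lact(2) \<rho>])
  moreover have "\<rho> (a * b) = tensor_ract (\<rho> a) b" for a b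
    by (rule ell1_bilinear_eqI[where B = "\<lambda>a b. \<rho> (a * b)" and B' = "\<lambda>a b. tensor_ract (\<rho> a) b"])
      (simp_all add: delta_mult \<rho>_delta right
        bounded_clinear_compose[OF \<rho> bounded_clinear_mult_left]
        bounded_clinear_compose[OF \<rho> bounded_clinear_mult_right]
        bounded_clinear_tensor_ract(1) bounded_clinear_compose[OF bounded_clinear_tensor_ract(2) \<rho>])
  moreover have "tensor_bidual_mult (\<rho> a) = canonical a" for a
  proof (rule ell1_map_eqI[OF bounded_clinear_compose[OF bounded_clinear_tensor_bidual_mult \<rho>]
        bounded_clinear_canonical])
    fix s
    have "tensor_bidual_mult (k s) = (\<Sum>e\<in>idempotents_below (supp s). canonical (delta s * primitive_idempotent e))"
      unfolding k_def bounded_clinearD(5)[OF bounded_clinear_tensor_bidual_mult]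
      by (rule sum.cong) (simp_all add: tensor_bidual_mult_lact mult idem)
    also have "\<dots> = canonical (delta s * delta (supp s))"
      by (simp add: bounded_clinearD(5)[OF bounded_clinear_canonical] sum_distrib_left
          delta_eq_sum_primitive_idempotents[OF supp_idem fin[OF supp_idem]])
    finally show "tensor_bidual_mult (\<rho> (delta s)) = canonical (delta s)"
      by (simp add: \<rho>_delta delta_mult)
  qed
  ultimately show ?thesis unfolding biflat_def using \<rho> by blast
qed

section \<open>The equivalence\<close>

lemma idempotents_iff: "e \<in> idempotents \<longleftrightarrow> e * e = e"
  by (simp add: idempotents_def)

lemma idempotents_below_eq:
  "idempotents_below e = {f \<in> idempotents. natural_le f e}"
  by (auto simp: idempotents_below_def idempotents_iff natural_le_def star_idempotent)

theorem proposition3p4: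
  assumes "uniformly_locally_finite (idempotents :: 's::clifford_semigroup set)"
  shows "((\<forall>\<phi> \<in> (characters :: ('s ell1 \<Rightarrow> complex) set). left_biflat (bidual_char \<phi>))
            \<longleftrightarrow> (\<forall>\<phi> \<in> (characters :: ('s ell1 \<Rightarrow> complex) set). left_biflat \<phi>))
       \<and> ((\<forall>\<phi> \<in> (characters :: ('s ell1 \<Rightarrow> complex) set). left_biflat \<phi>)
            \<longleftrightarrow> (\<forall>e \<in> (idempotents :: 's set). amenable_group (maximal_subgroup e)))
       \<and> ((\<forall>e \<in> (idempotents :: 's set). amenable_group (maximal_subgroup e))
            \<longleftrightarrow> biflat TYPE('s ell1))"
proof -
  have central: "delta e * a = a * delta e" if "e * e = e" for e :: 's and a
    by (rule delta_central) (rule idempotent_central[OF that])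
  have "left_biflat (bidual_char \<phi>) \<longleftrightarrow> left_biflat \<phi>"
    if phi: "\<phi> \<in> characters" for \<phi> :: "'s ell1 \<Rightarrow> complex"
  proof -
    obtain e where e: "e * e = e" "\<phi> (delta e) = 1"
      by (rule ell1_character_normalized_idempotent[OF phi])
    show ?thesis by (rule left_biflat_bidual_iff[OF phi central[OF e(1)] e(2)])
  qed
  then have bidual: "(\<forall>\<phi> \<in> (characters :: ('s ell1 \<Rightarrow> complex) set). left_biflat (bidual_char \<phi>))
      \<longleftrightarrow> (\<forall>\<phi> \<in> (characters :: ('s ell1 \<Rightarrow> complex) set). left_biflat \<phi>)" by blast
  have amenable: "amenable_group (maximal_subgroup e)"
    if biflat: "\<forall>\<phi> \<in> (characters :: ('s ell1 \<Rightarrow> complex) set). left_biflat \<phi>"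
      and "e \<in> idempotents" for e :: 's
  proof -
    have e: "e * e = e" using \<open>e \<in> idempotents\<close> by (simp add: idempotents_iff)
    note \<phi> = subgroup_character[OF e]
    show ?thesis
      using left_biflat_imp_left_char_amenable[OF \<phi>(1) central[OF e] \<phi>(2)] biflat \<phi>(1)
      by (intro left_char_amenable_imp_amenable_subgroup[OF e]) blast
  qed
  have biflat: "biflat TYPE('s ell1)"
    if "\<forall>e \<in> (idempotents :: 's set). amenable_group (maximal_subgroup e)"
  proof -
    obtain N where N: "\<forall>e \<in> (idempotents :: 's set).
        finite (idempotents_below e) \<and> card (idempotents_below e) \<le> N"
      using assms unfolding uniformly_locally_finite_def idempotents_below_eq[symmetric] ..
    show ?thesis
      by (rule amenable_subgroups_imp_biflat[where N = N]) (use N that in \<open>simp_all add: idempotents_iff\<close>)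
  qed
  have left_biflat: "left_biflat \<phi>"
    if "biflat TYPE('s ell1)" and phi: "\<phi> \<in> characters" for \<phi> :: "'s ell1 \<Rightarrow> complex"
  proof -
    obtain e where e: "e * e = e" "\<phi> (delta e) = 1"
      by (rule ell1_character_normalized_idempotent[OF phi])
    from biflat_imp_left_char_amenable[OF phi central[OF e(1)] e(2) that(1)]
    show ?thesis by (rule left_char_amenable_imp_left_biflat[OF phi])
  qed
  show ?thesis using bidual amenable biflat left_biflat by blast
qed

end
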